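(* Let $M$ be a simple orientable matroid on $n>0$ elements. For every real $q$ with $-1<q<1$, $$\operatorname{Mag}(M;q)\ge\frac{2n(1-q)}{(1+q)(1-q^n)}>1.$$ The bound is sharp for every $n$: equality holds for $U_{1,1}$ when $n=1$, and for $U_{2,n}$ when $n\ge2$.
   Context: All matroids are finite. A matroid is orientable if it is the underlying matroid of some oriented matroid. $U_{r,n}$ is the uniform matroid of rank $r$ on $n$ elements. For a matroid $M$ on $E$ with rank function $r_M$ and $r(M)=r_M(E)$, $\chi_M(x)=\sum_{S\subseteq E}(-1)^{|S|}x^{r(M)-r_M(S)}$. For $w\in\mathbb Z_{\ge0}^E$ put $|w|=\sum_ew_e$, $\operatorname{wt}_M(w)=\max_B\sum_{e\in B}w_e$ over bases $B$ of $M$; the maximizing bases are the bases of the initial matroid $M_w$ on $E$. The motivic zeta function is $Z_M(x,T)=\sum_{w\in\mathbb Z_{\ge0}^E}\chi_{M_w}(x)x^{-r(M)-\operatorname{wt}_M(w)}T^{|w|}$, and the magnitude is $\operatorname{Mag}(M;q)=Z_M(-1,q)\in\mathbb Z[[q]]$; for loopless $M$ it is a rational function whose poles are roots of unity other than $1$, and $\operatorname{Mag}(M;q)$ for real $q$ denotes its value. *)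

theory Defs
  imports Complex_Main "HOL-Library.FuncSet" "HOL-Computational_Algebra.Computational_Algebra"
begin

record 'a matroid_data =
  ground :: "'a set"
  bases :: "'a set set"

locale matroid =
  fixes M :: "'a matroid_data"
  assumes finite_ground: "finite (ground M)"
    and bases_nonempty: "bases M \<noteq> {}"
    and bases_subset: "B \<in> bases M \<Longrightarrow> B \<subseteq> ground M"
    and basis_exchange: "\<lbrakk>B1 \<in> bases M; B2 \<in> bases M; x \<in> B1 - B2\<rbrakk>
      \<Longrightarrow> \<exists>y \<in> B2 - B1. insert y (B1 - {x}) \<in> bases M"

definition indep :: "'a matroid_data \<Rightarrow> 'a set \<Rightarrow> bool" where
  "indep M I \<longleftrightarrow> (\<exists>B \<in> bases M. I \<subseteq> B)"

definition rank :: "'a matroid_data \<Rightarrow> 'a set \<Rightarrow> nat" where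
  "rank M S = Max (card ` {I. I \<subseteq> S \<and> indep M I})"

definition circuits :: "'a matroid_data \<Rightarrow> 'a set set" where
  "circuits M = {C. C \<subseteq> ground M \<and> \<not> indep M C \<and> (\<forall>D. D \<subset> C \<longrightarrow> indep M D)}"

definition loop :: "'a matroid_data \<Rightarrow> 'a \<Rightarrow> bool" where
  "loop M e \<longleftrightarrow> {e} \<in> circuits M"

definition parallel :: "'a matroid_data \<Rightarrow> 'a \<Rightarrow> 'a \<Rightarrow> bool" where
  "parallel M e f \<longleftrightarrow> e \<noteq> f \<and> {e, f} \<in> circuits M"

definition simple_matroid :: "'a matroid_data \<Rightarrow> bool" where
  "simple_matroid M \<longleftrightarrow> (\<forall>e. \<not> loop M e) \<and> (\<forall>e f. \<not> parallel M e f)"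

text \<open>The uniform matroid, on the ground set \<open>{0, \<dots>, n - 1}\<close>; it is a matroid only for \<open>r \<le> n\<close>.\<close>

definition uniform_matroid :: "nat \<Rightarrow> nat \<Rightarrow> nat matroid_data" where
  "uniform_matroid r n = \<lparr>ground = {..<n}, bases = {B. B \<subseteq> {..<n} \<and> card B = r}\<rparr>"

text \<open>A signed set is a pair of disjoint sets: its positive and its negative part. Oriented matroids
  are given by the signed circuit axioms.\<close>

type_synonym 'a signed_set = "'a set \<times> 'a set"

definition supp :: "'a signed_set \<Rightarrow> 'a set" where
  "supp X = fst X \<union> snd X"

definition opp :: "'a signed_set \<Rightarrow> 'a signed_set" where
  "opp X = (snd X, fst X)"

locale oriented_matroid =
  fixes E :: "'a set" and \<C> :: "'a signed_set set"
  assumes finite_E: "finite E"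
    and signed_subset: "X \<in> \<C> \<Longrightarrow> supp X \<subseteq> E \<and> fst X \<inter> snd X = {}"
    and nonempty: "({}, {}) \<notin> \<C>"
    and symmetric: "X \<in> \<C> \<Longrightarrow> opp X \<in> \<C>"
    and incomparable: "\<lbrakk>X \<in> \<C>; Y \<in> \<C>; supp X \<subseteq> supp Y\<rbrakk> \<Longrightarrow> X = Y \<or> X = opp Y"
    and elimination: "\<lbrakk>X \<in> \<C>; Y \<in> \<C>; X \<noteq> opp Y; e \<in> fst X \<inter> snd Y\<rbrakk>
      \<Longrightarrow> \<exists>Z \<in> \<C>. fst Z \<subseteq> (fst X \<union> fst Y) - {e} \<and> snd Z \<subseteq> (snd X \<union> snd Y) - {e}"

text \<open>The underlying matroid of an oriented matroid is the one whose circuits are the supports of the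
  signed circuits; a matroid is determined by its ground set and its circuits.\<close>

definition orientable :: "'a matroid_data \<Rightarrow> bool" where
  "orientable M \<longleftrightarrow> (\<exists>\<C>. oriented_matroid (ground M) \<C> \<and> circuits M = supp ` \<C>)"

definition char_poly :: "'a matroid_data \<Rightarrow> int poly" where
  "char_poly M =
    (\<Sum>S \<in> Pow (ground M). monom ((- 1) ^ card S) (rank M (ground M) - rank M S))"

definition wt :: "'a matroid_data \<Rightarrow> ('a \<Rightarrow> nat) \<Rightarrow> nat" where
  "wt M w = Max ((\<lambda>B. \<Sum>e\<in>B. w e) ` bases M)"

definition initial_matroid :: "'a matroid_data \<Rightarrow> ('a \<Rightarrow> nat) \<Rightarrow> 'a matroid_data" where
  "initial_matroid M w =
    \<lparr>ground = ground M, bases = {B \<in> bases M. (\<Sum>e\<in>B. w e) = wt M w}\<rparr>"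

text \<open>The weight vectors \<open>w\<close> with \<open>|w| = d\<close>, as extensional functions on the ground set.\<close>

definition weights :: "'a matroid_data \<Rightarrow> nat \<Rightarrow> ('a \<Rightarrow> nat) set" where
  "weights M d = {w \<in> ground M \<rightarrow>\<^sub>E UNIV. (\<Sum>e\<in>ground M. w e) = d}"

text \<open>The power series in \<open>T\<close> obtained from \<open>Z\<^sub>M(x, T)\<close> by substituting a nonzero element \<open>x\<close> of a
  field for the first variable.\<close>

definition motivic_zeta :: "'a matroid_data \<Rightarrow> 'k::field \<Rightarrow> 'k fps" where
  "motivic_zeta M x = Abs_fps (\<lambda>d. \<Sum>w \<in> weights M d.
     poly (map_poly of_int (char_poly (initial_matroid M w))) x
       * x powi (- int (rank M (ground M)) - int (wt M w)))"

definition magnitude_series :: "'a matroid_data \<Rightarrow> real fps" where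
  "magnitude_series M = motivic_zeta M (- 1)"

text \<open>The value at \<open>q\<close> of the rational function whose expansion at \<open>0\<close> is \<open>F\<close>, provided there is one
  and \<open>q\<close> is not a pole of it.\<close>

definition rational_value :: "'k::field fps \<Rightarrow> 'k \<Rightarrow> 'k" where
  "rational_value F q = (THE v. \<exists>P Q. poly Q q \<noteq> 0 \<and>
     F * fps_of_poly Q = fps_of_poly P \<and> v = poly P q / poly Q q)"

lemma rational_value_eqI:
  fixes F :: "'k::field fps"
  assumes Q: "poly Q q \<noteq> 0" and F: "F * fps_of_poly Q = fps_of_poly P"
  shows "rational_value F q = poly P q / poly Q q"
  unfolding rational_value_def
proof (rule the_equality)
  show "\<exists>P' Q'. poly Q' q \<noteq> 0 \<and> F * fps_of_poly Q' = fps_of_poly P' \<and>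
      poly P q / poly Q q = poly P' q / poly Q' q"
    using assms by blast
next
  fix v
  assume "\<exists>P' Q'. poly Q' q \<noteq> 0 \<and> F * fps_of_poly Q' = fps_of_poly P' \<and> v = poly P' q / poly Q' q"
  then obtain P' Q' where Q': "poly Q' q \<noteq> 0" and F': "F * fps_of_poly Q' = fps_of_poly P'"
    and v: "v = poly P' q / poly Q' q" by blast
  have "fps_of_poly (P' * Q) = fps_of_poly (P * Q')"
    unfolding fps_of_poly_mult F[symmetric] F'[symmetric] by (simp add: mult_ac)
  hence "P' * Q = P * Q'" by simp
  hence "poly P' q * poly Q q = poly P q * poly Q' q" by (metis poly_mult)
  thus "v = poly P q / poly Q q" using Q Q' by (simp add: v field_simps)
qed

definition magnitude :: "'a matroid_data \<Rightarrow> real \<Rightarrow> real" where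
  "magnitude M q = rational_value (magnitude_series M) q"

end

theory Submission imports Defs
begin

text \<open>By Zaslavsky's theorem the value of the characteristic polynomial of \<open>M\<^sub>w\<close> at \<open>-1\<close> counts, up to sign, the
  topes of the initial oriented matroid, and these are exactly the topes \<open>T\<close> of \<open>M\<close> for which the
  restrictions of \<open>T\<close> to the sets \<open>w < j\<close>, extended by zero, are all covectors. Hence the magnitude is a
  sum over topes \<open>T\<close> of series \<open>u T\<close> that count chains of faces of \<open>T\<close>. The Euler characteristic of open
  cells shows that \<open>u\<close> solves the linear system \<open>(\<Sum>T. q ^ d S T * u T) = 1\<close>, where \<open>d\<close> is the number of
  separating elements: the magnitude of the matroid is the magnitude of the metric space of topes.
  The matrix \<open>q ^ d S T\<close> is positive semidefinite, so the magnitude is at least that of any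
  subspace. In a simple oriented matroid a gallery from a tope to its opposite and the
  opposite gallery form an isometric cycle of length \<open>2 * n\<close>, whose magnitude is the
  stated bound; equality holds if there are no further topes.\<close>

section \<open>Rank and circuits\<close>

text \<open>Orientability is stated with signed circuits, while topes and cells live on the dual
  side. Covectors are therefore defined as the sign vectors orthogonal to all signed circuits. The
  obstacle is their elimination property: it needs enough cocircuits, and the signs of a cocircuit
  must be shown not to depend on the circuits from which they are read off. The Euler
  characteristics are then computed from the axioms of \<open>covector_system\<close>, in which the
  rank is a parameter, so that they serve \<open>M\<close> and every initial matroid alike. The
  value at \<open>q\<close> is that of a rational function, so the recurrences between series have
  to be carried over to values; the denominators met are \<open>1 - \<alpha>\<close> with
  \<open>\<alpha>\<close> equal to \<open>q ^ k\<close> up to sign and \<open>k > 0\<close>, nonzero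
  because \<open>-1 < q < 1\<close>. Only one solution \<open>u\<close> of the tope system enters.
  On the cycle all row sums are \<open>R = (1 + q) * (\<Sum>k<n. q ^ k)\<close>, so the constant
  \<open>1 / R\<close> is its weighting; nonnegativity of the quadratic form at the difference of
  \<open>u\<close> and this weighting says that the sum of \<open>u\<close> is at least
  \<open>2 * n / R\<close>, which is the stated bound.\<close>

context matroid
begin

lemma bases_finite: "B \<in> bases M \<Longrightarrow> finite B"
  using bases_subset finite_ground finite_subset by blast

lemma finite_bases: "finite (bases M)"
  by (rule finite_subset[of _ "Pow (ground M)"]) (use bases_subset finite_ground in auto)

lemma indep_basis: "B \<in> bases M \<Longrightarrow> indep M B"
  by (auto simp: indep_def)

lemma indep_subset: "indep M I \<Longrightarrow> J \<subseteq> I \<Longrightarrow> indep M J"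
  by (auto simp: indep_def)

lemma indep_empty: "indep M {}"
  using bases_nonempty by (auto simp: indep_def)

lemma indep_ground: "indep M I \<Longrightarrow> I \<subseteq> ground M"
  using bases_subset by (auto simp: indep_def)

lemma indep_finite: "indep M I \<Longrightarrow> finite I"
  using bases_finite by (auto simp: indep_def intro: finite_subset)

lemma card_basis:
  assumes "B1 \<in> bases M" "B2 \<in> bases M"
  shows "card B1 = card B2"
  using assms
proof (induction "card (B1 - B2)" arbitrary: B1 rule: less_induct)
  case less
  show ?case
  proof (cases "B1 \<subseteq> B2")
    case True
    have "B2 - B1 = {}"
      using basis_exchange[OF less.prems(2,1)] True by fastforce
    thus ?thesis using True by (metis Diff_eq_empty_iff subset_antisym)
  next
    case False
    then obtain x where x: "x \<in> B1 - B2" by blast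
    from basis_exchange[OF less.prems x] obtain y where
      y: "y \<in> B2 - B1" "insert y (B1 - {x}) \<in> bases M" by blast
    have fin: "finite B1" using less.prems bases_finite by blast
    have "insert y (B1 - {x}) - B2 = (B1 - B2) - {x}" using y by auto
    hence "card (insert y (B1 - {x}) - B2) < card (B1 - B2)"
      using x fin by (metis card_Diff1_less finite_Diff)
    from less.hyps[OF this y(2) less.prems(2)] have "card (insert y (B1 - {x})) = card B2" .
    moreover have "card (insert y (B1 - {x})) = Suc (card (B1 - {x}))" using y fin by auto
    moreover have "card B1 = Suc (card (B1 - {x}))" using x fin by (metis DiffD1 card_Suc_Diff1)
    ultimately show ?thesis by simp
  qed
qed

text \<open>Let \<open>B2\<close> be a basis containing \<open>J\<close>. Among the bases containing
  \<open>I\<close>, one with fewest elements outside \<open>I \<union> B2\<close> has none there, by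
  exchange with \<open>B2\<close>. If no element of \<open>J\<close> could be added to
  \<open>I\<close>, this basis would lie in \<open>I \<union> (B2 - J)\<close>, which is too
  small.\<close>

lemma augment:
  assumes I: "indep M I" and J: "indep M J" and lt: "card I < card J"
  shows "\<exists>x \<in> J - I. indep M (insert x I)"
proof (rule ccontr)
  assume no: "\<not> ?thesis"
  from J obtain B2 where B2: "B2 \<in> bases M" "J \<subseteq> B2" by (auto simp: indep_def)
  define P where "P B \<longleftrightarrow> B \<in> bases M \<and> I \<subseteq> B" for B
  have "\<exists>B. P B" using I by (auto simp: indep_def P_def)
  then obtain B1 where B1: "P B1"
    and min: "\<And>B. P B \<Longrightarrow> card (B1 - (I \<union> B2)) \<le> card (B - (I \<union> B2))"
    using ex_has_least_nat[of P _ "\<lambda>B. card (B - (I \<union> B2))"] by blast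
  have fin: "finite B1" "finite B2" "finite I" "finite J"
    using B1 B2 bases_finite I J indep_finite by (auto simp: P_def)
  have sub: "B1 \<subseteq> I \<union> B2"
  proof
    fix x assume x: "x \<in> B1"
    show "x \<in> I \<union> B2"
    proof (rule ccontr)
      assume nx: "x \<notin> I \<union> B2"
      with x obtain y where y: "y \<in> B2 - B1" "insert y (B1 - {x}) \<in> bases M"
        using basis_exchange[of B1 B2 x] B1 B2 by (auto simp: P_def)
      have "P (insert y (B1 - {x}))" using y B1 nx by (auto simp: P_def)
      from min[OF this] have "card (B1 - (I \<union> B2)) \<le> card ((B1 - (I \<union> B2)) - {x})"
        using y by (simp add: insert_Diff_if) (metis Diff_insert Diff_insert2)
      moreover have "card ((B1 - (I \<union> B2)) - {x}) < card (B1 - (I \<union> B2))"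
        using x nx fin by (intro card_Diff1_less) auto
      ultimately show False by simp
    qed
  qed
  have "x \<notin> J - I" if "x \<in> B1" for x
    using no that B1 unfolding P_def indep_def by blast
  hence "B1 \<subseteq> I \<union> (B2 - J)" using sub by blast
  hence "card B1 \<le> card I + card (B2 - J)"
    by (meson card_Un_le card_mono fin finite_Diff finite_UnI order_trans)
  also have "card (B2 - J) = card B2 - card J" using B2 fin by (intro card_Diff_subset) auto
  finally show False
    using card_basis[of B1 B2] B1 B2 lt card_mono[OF fin(2) B2(2)] by (auto simp: P_def)
qed

lemma finite_indep_subsets: "finite {I. I \<subseteq> S \<and> indep M I}"
  by (rule finite_subset[of _ "Pow (ground M)"]) (use indep_ground finite_ground in auto)

lemma card_le_rank: "I \<subseteq> S \<Longrightarrow> indep M I \<Longrightarrow> card I \<le> rank M S"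
  unfolding rank_def using finite_indep_subsets[of S] by (intro Max_ge) auto

lemma rank_witness: "\<exists>I \<subseteq> S. indep M I \<and> card I = rank M S"
proof -
  have "rank M S \<in> card ` {I. I \<subseteq> S \<and> indep M I}"
    unfolding rank_def using finite_indep_subsets[of S] indep_empty by (intro Max_in) auto
  thus ?thesis by auto
qed

lemma extend_indep:
  assumes "I \<subseteq> S" "indep M I"
  shows "\<exists>J. I \<subseteq> J \<and> J \<subseteq> S \<and> indep M J \<and> card J = rank M S"
  using assms
proof (induction "rank M S - card I" arbitrary: I rule: less_induct)
  case less
  show ?case
  proof (cases "card I = rank M S")
    case False
    then have lt: "card I < rank M S" using card_le_rank less.prems by (simp add: le_neq_implies_less)
    obtain K where K: "K \<subseteq> S" "indep M K" "card K = rank M S" using rank_witness by blast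
    with augment[of I K] lt less.prems obtain x where x: "x \<in> K - I" "indep M (insert x I)" by auto
    have "card (insert x I) = Suc (card I)" using x less.prems indep_finite by simp
    moreover have "insert x I \<subseteq> S" using x K less.prems by blast
    moreover from calculation lt have "rank M S - card (insert x I) < rank M S - card I" by linarith
    ultimately show ?thesis using less.hyps[of "insert x I"] x(2) by blast
  qed (use less.prems in blast)
qed

lemma rank_mono: "S \<subseteq> S' \<Longrightarrow> rank M S \<le> rank M S'"
proof -
  assume "S \<subseteq> S'"
  moreover obtain I where "I \<subseteq> S" "indep M I" "card I = rank M S" using rank_witness by blast
  ultimately show ?thesis using card_le_rank[of I S'] by auto
qed

lemma rank_le_insert: "rank M S \<le> rank M (insert x S)"
  by (rule rank_mono) auto

lemma rank_indep: "indep M I \<Longrightarrow> rank M I = card I"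
proof -
  assume I: "indep M I"
  obtain J where "J \<subseteq> I" "indep M J" "card J = rank M I" using rank_witness by blast
  thus ?thesis using card_le_rank[of I I] card_mono[of I J] indep_finite I by auto
qed

lemma rank_empty: "rank M {} = 0"
  using rank_indep indep_empty by simp

lemma rank_insert_le: "rank M (insert x S) \<le> Suc (rank M S)"
proof -
  obtain I where I: "I \<subseteq> insert x S" "indep M I" "card I = rank M (insert x S)"
    using rank_witness by blast
  have "card (I - {x}) \<le> rank M S"
    using I indep_subset by (intro card_le_rank) auto
  moreover have "card I \<le> Suc (card (I - {x}))"
    by (cases "x \<in> I") (simp_all add: card_Diff_singleton_if)
  ultimately show ?thesis using I by simp
qed

abbreviation spans :: "'a set \<Rightarrow> 'a \<Rightarrow> bool" where
  "spans S x \<equiv> rank M (insert x S) = rank M S"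

lemma rank_insert: "rank M (insert x S) = (if spans S x then rank M S else Suc (rank M S))"
  using rank_insert_le[of x S] rank_le_insert[of S x] by auto

text \<open>Extend a maximal independent set \<open>I\<close> of \<open>S\<close> within
  \<open>S'\<close> and then within \<open>insert x S'\<close>. If \<open>x\<close> raised the rank
  of \<open>S'\<close>, the second extension would pick up \<open>x\<close>, so
  \<open>insert x I\<close> would be independent and \<open>x\<close> would raise the rank of
  \<open>S\<close> as well.\<close>

lemma spans_mono:
  assumes sp: "spans S x" and sub: "S \<subseteq> S'"
  shows "spans S' x"
proof (rule ccontr)
  assume ns: "\<not> ?thesis"
  hence xS: "x \<notin> S'" by (metis insert_absorb)
  obtain I where I: "I \<subseteq> S" "indep M I" "card I = rank M S" using rank_witness by blast
  obtain J where J: "I \<subseteq> J" "J \<subseteq> S'" "indep M J" "card J = rank M S'"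
    using extend_indep[of I S'] I sub by blast
  obtain K where K: "J \<subseteq> K" "K \<subseteq> insert x S'" "indep M K" "card K = rank M (insert x S')"
    using extend_indep[of J "insert x S'"] J by blast
  have "\<not> K \<subseteq> S'" using K card_le_rank[of K S'] ns rank_le_insert[of S' x] by auto
  hence "insert x I \<subseteq> K" using K J by blast
  hence "indep M (insert x I)" using K indep_subset by blast
  hence "card (insert x I) \<le> rank M (insert x S)" using I by (intro card_le_rank) auto
  moreover have "card (insert x I) = Suc (card I)"
    using I xS sub indep_finite by (intro card_insert_disjoint) auto
  ultimately show False using sp I by simp
qed

lemma circuitD: "C \<in> circuits M \<Longrightarrow> C \<subseteq> ground M \<and> \<not> indep M C \<and> finite C"
  unfolding circuits_def using finite_ground finite_subset by auto

lemma circuit_proper: "C \<in> circuits M \<Longrightarrow> D \<subset> C \<Longrightarrow> indep M D"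
  unfolding circuits_def by auto

lemma circuit_exists:
  assumes "S \<subseteq> ground M" "\<not> indep M S"
  shows "\<exists>C \<in> circuits M. C \<subseteq> S"
proof -
  have "finite S" using assms finite_ground finite_subset by blast
  from this assms show ?thesis
  proof (induction S rule: finite_psubset_induct)
    case (psubset S)
    show ?case
    proof (cases "\<forall>D. D \<subset> S \<longrightarrow> indep M D")
      case True
      thus ?thesis using psubset.prems by (auto simp: circuits_def)
    next
      case False
      then obtain D where "D \<subset> S" "\<not> indep M D" by blast
      thus ?thesis using psubset.IH[of D] psubset.prems by blast
    qed
  qed
qed

lemma indep_insert_not_spans:
  "I \<subseteq> S \<Longrightarrow> indep M I \<Longrightarrow> card I = rank M S \<Longrightarrow> x \<notin> I \<Longrightarrow>
     indep M (insert x I) \<longleftrightarrow> \<not> spans S x"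
proof
  assume I: "I \<subseteq> S" "indep M I" "card I = rank M S" "x \<notin> I"
  { assume "indep M (insert x I)"
    hence "card (insert x I) \<le> rank M (insert x S)" using I by (intro card_le_rank) auto
    thus "\<not> spans S x" using I indep_finite by auto }
  { assume ns: "\<not> spans S x"
    obtain J where J: "I \<subseteq> J" "J \<subseteq> insert x S" "indep M J" "card J = rank M (insert x S)"
      using extend_indep[of I "insert x S"] I by blast
    have "\<not> J \<subseteq> S" using J card_le_rank[of J S] ns rank_le_insert[of S x] by auto
    hence "insert x I \<subseteq> J" using J by blast
    thus "indep M (insert x I)" using J indep_subset by blast }
qed

text \<open>The circuit through \<open>x\<close> is found in \<open>insert x I\<close> for a maximal
  independent subset \<open>I\<close> of \<open>S\<close>. This turns rank conditions into circuits,
  the objects that carry signs.\<close>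

lemma spans_iff_circuit:
  assumes x: "x \<in> ground M" "x \<notin> S" and S: "S \<subseteq> ground M"
  shows "spans S x \<longleftrightarrow> (\<exists>C \<in> circuits M. x \<in> C \<and> C \<subseteq> insert x S)"
proof
  assume sp: "spans S x"
  obtain I where I: "I \<subseteq> S" "indep M I" "card I = rank M S" using rank_witness by blast
  have "\<not> indep M (insert x I)" using indep_insert_not_spans[OF I] sp x I by auto
  then obtain C where C: "C \<in> circuits M" "C \<subseteq> insert x I"
    using circuit_exists[of "insert x I"] x S I by blast
  have "x \<in> C" using C I circuitD indep_subset by blast
  thus "\<exists>C \<in> circuits M. x \<in> C \<and> C \<subseteq> insert x S" using C I by blast
next
  assume "\<exists>C \<in> circuits M. x \<in> C \<and> C \<subseteq> insert x S"
  then obtain C where C: "C \<in> circuits M" "x \<in> C" "C \<subseteq> insert x S" by blast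
  have "indep M (C - {x})" using C circuit_proper by blast
  then obtain I where I: "C - {x} \<subseteq> I" "I \<subseteq> S" "indep M I" "card I = rank M S"
    using extend_indep[of "C - {x}" S] C by blast
  have "C \<subseteq> insert x I" using I by blast
  hence "\<not> indep M (insert x I)" using C circuitD indep_subset by blast
  thus "spans S x" using indep_insert_not_spans[OF I(2-4)] x I by auto
qed

lemma circuit_antimono: "C \<in> circuits M \<Longrightarrow> D \<in> circuits M \<Longrightarrow> C \<subseteq> D \<Longrightarrow> C = D"
  using circuitD circuit_proper by (metis psubsetI)

text \<open>If \<open>y\<close> lies in \<open>C\<close> but not in \<open>D\<close>, then
  \<open>C - {y}\<close> extends to a maximal independent subset of \<open>insert x I\<close>. It
  has at least \<open>card I\<close> elements and misses \<open>y\<close>, so it equals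
  \<open>insert x I - {y}\<close> and contains the dependent set \<open>D\<close>.\<close>

lemma circuit_unique:
  assumes I: "indep M I" and C: "C \<in> circuits M" "C \<subseteq> insert x I"
    and D: "D \<in> circuits M" "D \<subseteq> insert x I"
  shows "C = D"
proof (rule ccontr)
  assume "C \<noteq> D"
  then obtain y where y: "y \<in> C" "y \<notin> D" using circuit_antimono[OF C(1) D(1)] by blast
  have xI: "x \<notin> I" using C I circuitD indep_subset by (metis insert_absorb)
  have fin: "finite I" using I indep_finite by simp
  have nind: "\<not> indep M (insert x I)" using C circuitD indep_subset by blast
  have "indep M (C - {y})" using C y circuit_proper by blast
  then obtain J where J: "C - {y} \<subseteq> J" "J \<subseteq> insert x I" "indep M J" "card J = rank M (insert x I)"
    using extend_indep[of "C - {y}" "insert x I"] C by blast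
  have "card I \<le> card J" using J I card_le_rank[of I "insert x I"] by auto
  moreover have "y \<notin> J" using J C y circuitD indep_subset by (metis insert_Diff insert_subset)
  moreover have "card (insert x I - {y}) = card I" using y C xI fin by auto
  ultimately have "J = insert x I - {y}"
    using J fin by (intro card_seteq) auto
  hence "D \<subseteq> J" using D y by blast
  thus False using D J circuitD indep_subset by blast
qed

end

section \<open>Weights and initial matroids\<close>

definition upper :: "'a set \<Rightarrow> ('a \<Rightarrow> nat) \<Rightarrow> nat \<Rightarrow> 'a set" where
  "upper E u c = {e \<in> E. c < u e}"

lemma upper_antimono: "c \<le> d \<Longrightarrow> upper E u d \<subseteq> upper E u c"
  by (auto simp: upper_def)

text \<open>Layer-cake summation: an element \<open>e\<close> of \<open>E\<close> belongs to
  \<open>upper E u c\<close> for exactly \<open>u e\<close> values of \<open>c\<close>.\<close>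

lemma sum_eq_sum_card_upper:
  assumes "finite B" "B \<subseteq> E" "\<And>e. e \<in> E \<Longrightarrow> u e \<le> N"
  shows "(\<Sum>e\<in>B. u e) = (\<Sum>c<N. card (B \<inter> upper E u c))"
proof -
  have "(\<Sum>e\<in>B. u e) = (\<Sum>e\<in>B. \<Sum>c<N. if c < u e then 1 else 0)"
  proof (rule sum.cong[OF refl])
    fix e assume "e \<in> B"
    hence "{..<N} \<inter> {c. c < u e} = {..<u e}" using assms by fastforce
    thus "u e = (\<Sum>c<N. if c < u e then 1 else 0)" by (simp add: sum.If_cases)
  qed
  also have "\<dots> = (\<Sum>c<N. \<Sum>e\<in>B. if c < u e then 1 else 0)" by (rule sum.swap)
  also have "\<dots> = (\<Sum>c<N. card (B \<inter> upper E u c))"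
  proof (rule sum.cong[OF refl])
    fix c
    have "B \<inter> {e. c < u e} = B \<inter> upper E u c" using assms by (auto simp: upper_def)
    thus "(\<Sum>e\<in>B. if c < u e then 1 else 0) = card (B \<inter> upper E u c)"
      using assms(1) by (simp add: sum.If_cases)
  qed
  finally show ?thesis .
qed

context matroid
begin

abbreviation "E \<equiv> ground M"

lemma weight_bound: "\<exists>N. \<forall>e\<in>E. (u e :: nat) \<le> N"
  using finite_ground by (meson finite_nat_set_iff_bounded_le finite_imageI imageI)

lemma card_basis_Int_le:
  assumes "B \<in> bases M"
  shows "card (B \<inter> S) \<le> rank M S"
  using indep_subset[OF indep_basis[OF assms], of "B \<inter> S"] by (intro card_le_rank) auto

text \<open>The greedy algorithm: an independent set is enlarged from the highest superlevel set
  downwards, each time to a maximal one. The result is optimal for all superlevel sets at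
  once.\<close>

lemma greedy_basis:
  "\<exists>B \<in> bases M. \<forall>c. card (B \<inter> upper E u c) = rank M (upper E u c)"
proof -
  obtain N where N: "\<And>e. e \<in> E \<Longrightarrow> u e \<le> N" using weight_bound by blast
  \<comment> \<open>The induction on \<open>k\<close> lowers the threshold: at stage
    \<open>k\<close> all \<open>c \<ge> N - k\<close> are settled, starting from
    \<open>c \<ge> N\<close>, where the superlevel sets are empty.\<close>
  have "\<exists>I. indep M I \<and> (\<forall>c\<ge>N-k. card (I \<inter> upper E u c) = rank M (upper E u c)) \<and> I \<subseteq> upper E u (N-k)"
    if "k \<le> N" for k
    using that
  proof (induction k)
    case 0
    have "upper E u c = {}" if "c \<ge> N" for c using N that by (fastforce simp: upper_def)
    thus ?case using indep_empty rank_empty by (intro exI[of _ "{}"]) auto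
  next
    case (Suc k)
    define m where "m = N - Suc k"
    have m: "N - k = Suc m" using Suc.prems by (auto simp: m_def)
    from Suc m obtain I where I: "indep M I" "\<And>c. c \<ge> Suc m \<Longrightarrow> card (I \<inter> upper E u c) = rank M (upper E u c)"
      "I \<subseteq> upper E u (Suc m)" by auto
    obtain J where J: "I \<subseteq> J" "J \<subseteq> upper E u m" "indep M J" "card J = rank M (upper E u m)"
      using extend_indep[of I "upper E u m"] I upper_antimono[of m "Suc m" E u] by auto
    have "card (J \<inter> upper E u c) = rank M (upper E u c)" if "c \<ge> m" for c
    proof (cases "c = m")
      case True
      thus ?thesis using J by (simp add: Int_absorb2)
    next
      case False
      have "card (I \<inter> upper E u c) \<le> card (J \<inter> upper E u c)"
        using J indep_finite by (intro card_mono) auto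
      moreover have "card (J \<inter> upper E u c) \<le> rank M (upper E u c)"
        using indep_subset[OF J(3), of "J \<inter> upper E u c"] by (intro card_le_rank) auto
      ultimately show ?thesis using I(2)[of c] False that by auto
    qed
    thus ?case using J unfolding m_def by blast
  qed
  from this[of N] obtain I where I: "indep M I" "\<And>c. card (I \<inter> upper E u c) = rank M (upper E u c)"
    by auto
  from I obtain B where B: "B \<in> bases M" "I \<subseteq> B" by (auto simp: indep_def)
  have "card (B \<inter> upper E u c) = rank M (upper E u c)" for c
  proof (rule antisym[OF card_basis_Int_le[OF B(1)]])
    have "card (I \<inter> upper E u c) \<le> card (B \<inter> upper E u c)"
      using B bases_finite by (intro card_mono) auto
    thus "rank M (upper E u c) \<le> card (B \<inter> upper E u c)" using I by simp
  qed
  thus ?thesis using B by blast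
qed

lemma basis_weight_le_wt: "B \<in> bases M \<Longrightarrow> (\<Sum>e\<in>B. u e) \<le> wt M u"
  unfolding wt_def using finite_bases by (intro Max_ge) auto

lemma wt_eqI:
  assumes "B \<in> bases M" "(\<Sum>e\<in>B. u e) = n" "\<And>B. B \<in> bases M \<Longrightarrow> (\<Sum>e\<in>B. u e) \<le> n"
  shows "wt M u = n"
  unfolding wt_def using assms finite_bases by (intro Max_eqI) auto

lemma greedy_weight:
  assumes N: "\<And>e. e \<in> E \<Longrightarrow> u e \<le> N" and B: "B \<in> bases M"
    and gr: "\<forall>c. card (B \<inter> upper E u c) = rank M (upper E u c)"
  shows "(\<Sum>e\<in>B. u e) = (\<Sum>c<N. rank M (upper E u c))"
  using sum_eq_sum_card_upper[of B E u N] assms bases_finite[OF B] bases_subset[OF B] by simp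

text \<open>In the layer-cake sum every basis satisfies
  \<open>card (B \<inter> S) \<le> rank M S\<close> term by term, and the greedy basis attains all
  these bounds simultaneously.\<close>

lemma wt_eq_sum_rank:
  assumes N: "\<And>e. e \<in> E \<Longrightarrow> u e \<le> N"
  shows "wt M u = (\<Sum>c<N. rank M (upper E u c))"
proof -
  obtain B where B: "B \<in> bases M" "\<forall>c. card (B \<inter> upper E u c) = rank M (upper E u c)"
    using greedy_basis by blast
  show ?thesis
  proof (rule wt_eqI[OF B(1) greedy_weight[OF N B]])
    fix B assume B: "B \<in> bases M"
    show "(\<Sum>e\<in>B. u e) \<le> (\<Sum>c<N. rank M (upper E u c))"
      using sum_eq_sum_card_upper[of B E u N] N card_basis_Int_le[OF B] bases_finite[OF B]
        bases_subset[OF B] by (simp add: sum_mono)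
  qed
qed

lemma greedy_wt:
  assumes B: "B \<in> bases M" and gr: "\<forall>c. card (B \<inter> upper E u c) = rank M (upper E u c)"
  shows "(\<Sum>e\<in>B. u e) = wt M u"
proof -
  obtain N where N: "\<And>e. e \<in> E \<Longrightarrow> u e \<le> N" using weight_bound by blast
  show ?thesis using greedy_weight[OF N B gr] wt_eq_sum_rank[OF N] by simp
qed

text \<open>Raising \<open>u e\<close> by one changes a single superlevel set, the one at
  \<open>c = u e\<close>, which gains \<open>e\<close>.\<close>

lemma wt_increment:
  assumes e: "e \<in> E"
  shows "wt M (u(e := Suc (u e))) + rank M (upper E u (u e))
    = wt M u + rank M (insert e (upper E u (u e)))"
proof -
  let ?u = "u(e := Suc (u e))"
  obtain N where N: "\<And>e. e \<in> E \<Longrightarrow> u e \<le> N" using weight_bound by blast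
  have up: "upper E ?u c = upper E u c" if "c \<noteq> u e" for c using that by (auto simp: upper_def)
  have upe: "upper E ?u (u e) = insert e (upper E u (u e))" using e by (auto simp: upper_def)
  have m: "u e \<in> {..<Suc N}" using N e by (simp add: le_imp_less_Suc)
  have "?u a \<le> Suc N" if "a \<in> E" for a using N[OF that] N[OF e] by auto
  hence "wt M ?u = (\<Sum>c<Suc N. rank M (upper E ?u c))" by (rule wt_eq_sum_rank)
  also have "\<dots> = rank M (upper E ?u (u e)) + (\<Sum>c\<in>{..<Suc N} - {u e}. rank M (upper E ?u c))"
    by (rule sum.remove) (use m in auto)
  also have "(\<Sum>c\<in>{..<Suc N} - {u e}. rank M (upper E ?u c)) = (\<Sum>c\<in>{..<Suc N} - {u e}. rank M (upper E u c))"
    by (rule sum.cong) (use up in auto)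
  finally have 1: "wt M ?u = rank M (insert e (upper E u (u e))) + (\<Sum>c\<in>{..<Suc N} - {u e}. rank M (upper E u c))"
    unfolding upe .
  have "wt M u = (\<Sum>c<Suc N. rank M (upper E u c))"
    by (rule wt_eq_sum_rank) (use N in \<open>simp add: le_SucI\<close>)
  also have "\<dots> = rank M (upper E u (u e)) + (\<Sum>c\<in>{..<Suc N} - {u e}. rank M (upper E u c))"
    by (rule sum.remove) (use m in auto)
  finally show ?thesis using 1 by simp
qed

text \<open>Breaking the ties of \<open>w\<close> in favour of \<open>S\<close> turns the rank in the initial matroid into a
  difference of two weights of \<open>M\<close>.\<close>

lemma rank_initial_matroid:
  fixes w :: "'a \<Rightarrow> nat"
  assumes S: "S \<subseteq> E"
  defines "u \<equiv> \<lambda>e. 2 * w e + of_bool (e \<in> S)"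
  shows "rank (initial_matroid M w) S + 2 * wt M w = wt M u"
proof -
  let ?M = "initial_matroid M w"
  have u: "(\<Sum>e\<in>B. u e) = 2 * (\<Sum>e\<in>B. w e) + card (B \<inter> S)" if "B \<in> bases M" for B
    using bases_finite[OF that] by (simp add: u_def sum.distrib sum_distrib_left Int_def)
  obtain B where B: "B \<in> bases M" "\<forall>c. card (B \<inter> upper E u c) = rank M (upper E u c)"
    using greedy_basis by blast
  have "upper E w c = upper E u (2 * c + 1)" for c by (auto simp: upper_def u_def)
  hence "\<forall>c. card (B \<inter> upper E w c) = rank M (upper E w c)" using B by simp
  hence Bw: "(\<Sum>e\<in>B. w e) = wt M w" using greedy_wt B by blast
  have Bu: "card (B \<inter> S) + 2 * wt M w = wt M u" using u[OF B(1)] greedy_wt[OF B] Bw by simp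
  have up: "card I + 2 * wt M w \<le> wt M u" if I: "I \<subseteq> S" "indep ?M I" for I
  proof -
    from I obtain D where D: "D \<in> bases M" "(\<Sum>e\<in>D. w e) = wt M w" "I \<subseteq> D"
      by (auto simp: indep_def initial_matroid_def)
    have "card I \<le> card (D \<inter> S)" using I D bases_finite by (intro card_mono) auto
    thus ?thesis using u[OF D(1)] basis_weight_le_wt[OF D(1), of u] D by simp
  qed
  have "finite S" using S finite_ground finite_subset by blast
  hence fin: "finite {I. I \<subseteq> S \<and> indep ?M I}" by simp
  have "indep ?M (B \<inter> S)" using B Bw by (auto simp: indep_def initial_matroid_def)
  moreover have "card I \<le> card (B \<inter> S)" if "I \<subseteq> S" "indep ?M I" for I
    using up[OF that] Bu by simp
  ultimately have "rank ?M S = card (B \<inter> S)"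
    unfolding rank_def using fin by (intro Max_eqI) auto
  thus ?thesis using Bu by simp
qed

text \<open>With \<open>S\<close> empty, \<open>rank_initial_matroid\<close> compares the weights
  \<open>2 * w\<close> and \<open>w\<close>, and doubling a weight doubles
  \<open>wt\<close>.\<close>

lemma rank_initial_matroid_empty: "rank (initial_matroid M w) {} = 0"
proof -
  have "{I. I \<subseteq> {} \<and> indep (initial_matroid M w) I} = {{}} \<or> {I. I \<subseteq> {} \<and> indep (initial_matroid M w) I} = {}"
    by auto
  moreover have "rank (initial_matroid M w) {} + 2 * wt M w = wt M (\<lambda>e. 2 * w e)"
    using rank_initial_matroid[of "{}" w] by simp
  moreover have "wt M (\<lambda>e. 2 * w e) = 2 * wt M w"
  proof -
    obtain B where B: "B \<in> bases M" "\<forall>c. card (B \<inter> upper E w c) = rank M (upper E w c)"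
      using greedy_basis by blast
    show ?thesis
      by (rule wt_eqI[OF B(1)]) (use greedy_wt[OF B] basis_weight_le_wt[of _ w] in
        \<open>auto simp: sum_distrib_left[symmetric]\<close>)
  qed
  ultimately show ?thesis by simp
qed

text \<open>The initial matroid is the direct sum, over the levels of \<open>w\<close>, of the
  minors of \<open>M\<close> that delete the lower levels and contract the higher ones. So whether
  \<open>e\<close> is spanned depends only on the higher levels and on the part of \<open>S\<close>
  on the level of \<open>e\<close>, which together form \<open>F\<close>.\<close>

lemma rank_initial_matroid_insert:
  fixes w :: "'a \<Rightarrow> nat"
  assumes S: "S \<subseteq> E" and e: "e \<in> E - S"
  defines "F \<equiv> upper E w (w e) \<union> {f \<in> S. w f = w e}"
  shows "rank (initial_matroid M w) (insert e S) =
    (if spans F e then rank (initial_matroid M w) S else Suc (rank (initial_matroid M w) S))"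
proof -
  define u where "u = (\<lambda>f. 2 * w f + of_bool (f \<in> S))"
  have u': "(\<lambda>f. 2 * w f + of_bool (f \<in> insert e S)) = u(e := Suc (u e))"
    using e by (auto simp: u_def)
  \<comment> \<open>As \<open>e\<close> is not in \<open>S\<close>, the threshold is
    \<open>u e = 2 * w e\<close>; on the level of \<open>e\<close> the tie-breaking term lifts
    exactly the elements of \<open>S\<close> above it.\<close>
  have F: "upper E u (u e) = F" using e S by (auto simp: upper_def u_def F_def of_bool_def)
  have 1: "rank (initial_matroid M w) S + 2 * wt M w = wt M u"
    using rank_initial_matroid[OF S, of w] by (simp add: u_def)
  have 2: "rank (initial_matroid M w) (insert e S) + 2 * wt M w = wt M (u(e := Suc (u e)))"
    using rank_initial_matroid[of "insert e S" w] S e u' by auto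
  have 3: "wt M (u(e := Suc (u e))) + rank M F = wt M u + rank M (insert e F)"
    using wt_increment[of e u] e F by simp
  show ?thesis using rank_insert[of e F] 1 2 3 by (auto split: if_splits)
qed

lemma rank_initial_matroid_ground: "rank (initial_matroid M w) E = rank M E"
proof -
  have "card I \<le> rank M E" if "indep (initial_matroid M w) I" for I
  proof (rule card_le_rank)
    show "indep M I" using that by (auto simp: indep_def initial_matroid_def)
    thus "I \<subseteq> E" by (rule indep_ground)
  qed
  moreover obtain B where B: "B \<in> bases M" "\<forall>c. card (B \<inter> upper E w c) = rank M (upper E w c)"
    using greedy_basis by blast
  have "indep (initial_matroid M w) B" using B greedy_wt[OF B] by (auto simp: indep_def initial_matroid_def)
  moreover have "card B = rank M E"
  proof -
    obtain I where I: "I \<subseteq> E" "indep M I" "card I = rank M E" using rank_witness by blast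
    then obtain B' where B': "B' \<in> bases M" "I \<subseteq> B'" by (auto simp: indep_def)
    hence "rank M E \<le> card B'" using I bases_finite card_mono by metis
    moreover have "card B' = card B" using B' B card_basis by blast
    moreover have "card B \<le> rank M E" using B indep_basis bases_subset by (intro card_le_rank) auto
    ultimately show ?thesis by simp
  qed
  moreover have "finite {I. I \<subseteq> E \<and> indep (initial_matroid M w) I}"
    using finite_ground by simp
  ultimately show ?thesis
    unfolding rank_def[of "initial_matroid M w"] using bases_subset[OF B(1)]
    by (intro Max_eqI) (auto intro!: image_eqI[of _ card B])
qed

end

section \<open>Covectors from signed circuits\<close>

text \<open>Signed circuits are functions into \<open>{-1, 0, 1}\<close>, so that orthogonality can
  be read off products of values and the inclusions in the elimination axiom become
  \<open>Z f \<in> {0, C f, D f}\<close>.\<close>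

locale signed_circuits = matroid M for M :: "'a matroid_data" +
  fixes \<S> :: "('a \<Rightarrow> int) set"
  assumes sign: "C \<in> \<S> \<Longrightarrow> C e \<in> {-1, 0, 1}"
    and circuit: "C \<in> \<S> \<Longrightarrow> {e. C e \<noteq> 0} \<in> circuits M"
    and lift: "K \<in> circuits M \<Longrightarrow> \<exists>C \<in> \<S>. {e. C e \<noteq> 0} = K"
    and minus: "C \<in> \<S> \<Longrightarrow> (\<lambda>e. - C e) \<in> \<S>"
    and support_unique: "\<lbrakk>C \<in> \<S>; D \<in> \<S>; \<And>e. C e \<noteq> 0 \<longleftrightarrow> D e \<noteq> 0\<rbrakk> \<Longrightarrow> C = D \<or> C = (\<lambda>e. - D e)"
    and eliminate_pos: "\<lbrakk>C \<in> \<S>; D \<in> \<S>; C \<noteq> (\<lambda>e. - D e); C e = 1; D e = -1\<rbrakk>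
      \<Longrightarrow> \<exists>Z \<in> \<S>. Z e = 0 \<and> (\<forall>f. Z f \<in> {0, C f, D f})"
begin

lemma eliminate:
  assumes C: "C \<in> \<S>" and D: "D \<in> \<S>" and ne: "C f \<noteq> - D f" and e: "C e = - D e" "C e \<noteq> 0"
  shows "\<exists>Z \<in> \<S>. Z e = 0 \<and> (\<forall>f. Z f \<in> {0, C f, D f})"
proof -
  have "C \<noteq> (\<lambda>e. - D e)" "D \<noteq> (\<lambda>e. - C e)" using ne by auto
  moreover have "C e = 1 \<and> D e = -1 \<or> C e = -1 \<and> D e = 1" using sign[OF C, of e] e by auto
  ultimately show ?thesis using eliminate_pos[OF C D, of e] eliminate_pos[OF D C, of e] by blast
qed

text \<open>Orthogonality to every signed circuit: where the supports meet, products of both signs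
  occur. The other implication follows because \<open>\<S>\<close> is closed under negation.\<close>

definition covectors :: "('a \<Rightarrow> int) set" where
  "covectors = {X. (\<forall>e. X e \<in> {-1, 0, 1}) \<and> (\<forall>e. e \<notin> E \<longrightarrow> X e = 0) \<and>
     (\<forall>C \<in> \<S>. (\<exists>e. X e * C e > 0) \<longrightarrow> (\<exists>e. X e * C e < 0))}"

lemma signed_circuit_ground: "C \<in> \<S> \<Longrightarrow> C e \<noteq> 0 \<Longrightarrow> e \<in> E"
  using circuit circuitD by blast

lemma signed_circuit_not_indep:
  assumes "C \<in> \<S>" "\<And>e. C e \<noteq> 0 \<Longrightarrow> e \<in> I"
  shows "\<not> indep M I"
proof -
  have "{e. C e \<noteq> 0} \<subseteq> I" using assms by auto
  thus ?thesis using circuitD[OF circuit[OF assms(1)]] indep_subset by blast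
qed

lemma signed_circuit_unique:
  assumes I: "indep M I" and C: "C \<in> \<S>" "\<And>e. C e \<noteq> 0 \<Longrightarrow> e \<in> insert x I"
    and D: "D \<in> \<S>" "\<And>e. D e \<noteq> 0 \<Longrightarrow> e \<in> insert x I"
  shows "C = D \<or> C = (\<lambda>e. - D e)"
proof -
  have "{e. C e \<noteq> 0} = {e. D e \<noteq> 0}"
    by (rule circuit_unique[OF I circuit[OF C(1)] _ circuit[OF D(1)]]) (use C D in auto)
  thus ?thesis using support_unique[OF C(1) D(1)] by blast
qed

lemma sign_square: "C \<in> \<S> \<Longrightarrow> C e \<noteq> 0 \<Longrightarrow> C e * C e = 1"
  using sign[of C e] by auto

end

text \<open>\<open>H\<close> is a hyperplane of the span of \<open>insert e H\<close>; the signs of the cocircuit supported on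
  its complement are read off the circuits that meet the complement in two elements.\<close>

locale signed_hyperplane = signed_circuits +
  fixes H :: "'a set" and e :: 'a
  assumes H: "H \<subseteq> E" and e: "e \<in> E" and not_spans: "\<not> spans H e"
    and maximal: "\<And>f. f \<in> E - H \<Longrightarrow> spans (insert f H) e"
begin

definition base :: "'a set \<Rightarrow> bool" where
  "base I \<longleftrightarrow> I \<subseteq> H \<and> indep M I \<and> card I = rank M H"

lemma e_notin: "e \<notin> H"
  using not_spans by (metis insert_absorb)

lemma rank_insert_outside:
  assumes f: "f \<in> E - H"
  shows "rank M (insert f H) = Suc (rank M H)" and "spans (insert e H) f"
proof -
  have 1: "rank M (insert e (insert f H)) = rank M (insert f H)" using maximal[OF f] .
  have 2: "rank M (insert e H) = Suc (rank M H)" using rank_insert[of e H] not_spans by simp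
  have 3: "rank M (insert f H) \<le> Suc (rank M H)" by (rule rank_insert_le)
  have 4: "rank M (insert e H) \<le> rank M (insert f (insert e H))" by (rule rank_le_insert)
  have c: "insert f (insert e H) = insert e (insert f H)" by auto
  show "rank M (insert f H) = Suc (rank M H)" "spans (insert e H) f" using 1 2 3 4 unfolding c by linarith+
qed

lemma not_spans_outside: "f \<in> E - H \<Longrightarrow> \<not> spans H f"
  using rank_insert_outside(1) by simp

lemma indep_insert_outside: "base I \<Longrightarrow> f \<in> E - H \<Longrightarrow> indep M (insert f I)"
  using indep_insert_not_spans[of I H f] not_spans_outside by (auto simp: base_def)

lemma dep_insert2_outside:
  assumes I: "base I" and f: "f \<in> E - H" and g: "g \<in> E - H" and ne: "f \<noteq> g"
  shows "\<not> indep M (insert f (insert g I))"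
proof
  assume i: "indep M (insert f (insert g I))"
  have "insert f (insert g I) \<subseteq> insert g (insert f (insert e H))" using I by (auto simp: base_def)
  hence "card (insert f (insert g I)) \<le> rank M (insert g (insert f (insert e H)))"
    using card_le_rank i by blast
  also have "\<dots> = rank M (insert f (insert e H))"
    using spans_mono[OF rank_insert_outside(2)[OF g], of "insert f (insert e H)"] by auto
  also have "\<dots> = rank M (insert e H)" using rank_insert_outside(2)[OF f] .
  also have "\<dots> \<le> Suc (rank M H)" by (rule rank_insert_le)
  finally have "card (insert f (insert g I)) \<le> Suc (card I)" using I by (simp add: base_def)
  moreover have "finite I" "f \<notin> I" "g \<notin> I" using I f g indep_finite by (auto simp: base_def)
  ultimately show False using ne by simp
qed

text \<open>The unsigned half of the orthogonality of circuits and cocircuits: if only one element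
  of a circuit were outside \<open>H\<close>, it would be spanned by \<open>H\<close>.\<close>

lemma two_outside:
  assumes C: "C \<in> \<S>" and f: "f \<in> E - H" "C f \<noteq> 0"
  shows "\<exists>g \<in> E - H. g \<noteq> f \<and> C g \<noteq> 0"
proof (rule ccontr)
  assume no: "\<not> ?thesis"
  have "{x. C x \<noteq> 0} \<subseteq> insert f H" using no signed_circuit_ground[OF C] by blast
  moreover have "f \<in> {x. C x \<noteq> 0}" using f by simp
  ultimately have "\<exists>D \<in> circuits M. f \<in> D \<and> D \<subseteq> insert f H" using circuit[OF C] by (rule_tac bexI) simp_all
  hence "spans H f" using spans_iff_circuit[of f H] f H by simp
  thus False using not_spans_outside f by blast
qed

text \<open>The set \<open>insert f (insert g I)\<close> is dependent but becomes independent when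
  \<open>f\<close> or \<open>g\<close> is omitted, so its circuit uses both. With the value at
  \<open>f\<close> normalised to 1, the value at \<open>g\<close> will be minus the relative sign of
  \<open>f\<close> and \<open>g\<close> in the cocircuit.\<close>

lemma circuit_two_outside:
  assumes I: "base I" and f: "f \<in> E - H" and g: "g \<in> E - H" and ne: "f \<noteq> g"
  shows "\<exists>C \<in> \<S>. (\<forall>x. C x \<noteq> 0 \<longrightarrow> x \<in> insert f (insert g I)) \<and> C f = 1 \<and> C g \<noteq> 0"
proof -
  have IH: "I \<subseteq> H" using I by (auto simp: base_def)
  have "insert f (insert g I) \<subseteq> E" using IH H f g by auto
  from circuit_exists[OF this dep_insert2_outside[OF assms]] obtain D
    where D: "D \<in> circuits M" "D \<subseteq> insert f (insert g I)" by blast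
  then obtain C where C: "C \<in> \<S>" "{x. C x \<noteq> 0} = D" using lift by blast
  have CI: "\<And>x. C x \<noteq> 0 \<Longrightarrow> x \<in> insert f (insert g I)" using C D by auto
  have "C f \<noteq> 0" using signed_circuit_not_indep[OF C(1), of "insert g I"] CI indep_insert_outside[OF I g] by blast
  moreover have "C g \<noteq> 0" using signed_circuit_not_indep[OF C(1), of "insert f I"] CI indep_insert_outside[OF I f] by blast
  moreover have "C f = 1 \<or> C f = -1" using sign[OF C(1), of f] \<open>C f \<noteq> 0\<close> by auto
  ultimately show ?thesis
    using C(1) CI minus[OF C(1)] bexI[of _ C] bexI[of _ "\<lambda>x. - C x"] by (elim disjE) auto
qed

text \<open>If the signs at \<open>g\<close> differed, one could eliminate \<open>g\<close> from
  \<open>C\<close> and \<open>D\<close>, and \<open>f\<close> from \<open>C\<close> and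
  \<open>- D\<close>. By \<open>two_outside\<close> both results avoid \<open>f\<close> and
  \<open>g\<close> altogether, so they lie in \<open>insert b I\<close> and agree up to sign. But
  both carry the sign of \<open>C\<close> at \<open>a\<close>, while at \<open>b\<close> one has the
  sign of \<open>D\<close> and the other its negative.\<close>

lemma sign_product_adjacent:
  assumes I: "base I" and a: "a \<in> I" and b: "b \<in> H - I" and I': "base (insert b (I - {a}))"
    and f: "f \<in> E - H" and g: "g \<in> E - H" and ne: "f \<noteq> g"
    and C: "C \<in> \<S>" "\<And>x. C x \<noteq> 0 \<Longrightarrow> x \<in> insert f (insert g I)" "C f = 1" "C g \<noteq> 0"
    and D: "D \<in> \<S>" "\<And>x. D x \<noteq> 0 \<Longrightarrow> x \<in> insert f (insert g (insert b (I - {a})))" "D f = 1" "D g \<noteq> 0"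
  shows "C g = D g"
proof (rule ccontr)
  assume neg: "C g \<noteq> D g"
  have IH: "I \<subseteq> H" using I by (auto simp: base_def)
  have signs: "C g \<in> {-1, 1}" "D g \<in> {-1, 1}" using sign[OF C(1), of g] sign[OF D(1), of g] C D by auto
  have Cb: "C b = 0" using C(2)[of b] b f g by auto
  have Da: "D a = 0" using D(2)[of a] a b f g IH by auto
  have opp: "C g = - D g" using signs neg by auto
  obtain Z where Z: "Z \<in> \<S>" "Z g = 0" "\<And>x. Z x \<in> {0, C x, D x}"
    using eliminate[OF C(1) D(1), of f g] C D opp by auto
  obtain Z' where Z': "Z' \<in> \<S>" "Z' f = 0" "\<And>x. Z' x \<in> {0, C x, - D x}"
    using eliminate[OF C(1) minus[OF D(1)], of g f] C D opp by auto
  have sZ: "x \<in> insert f (insert b I)" if "Z x \<noteq> 0" for x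
    using Z(3)[of x] Z(2) that C(2)[of x] D(2)[of x] by auto
  have sZ': "x \<in> insert g (insert b I)" if "Z' x \<noteq> 0" for x
    using Z'(3)[of x] Z'(2) that C(2)[of x] D(2)[of x] by auto
  have Zf: "Z f = 0" using two_outside[OF Z(1) f] sZ IH b by (metis Diff_iff insertE subsetD)
  have Zg: "Z' g = 0" using two_outside[OF Z'(1) g] sZ' IH b by (metis Diff_iff insertE subsetD)
  have sZ: "x \<in> insert b I" if "Z x \<noteq> 0" for x using sZ[OF that] Zf that by auto
  have sZ': "x \<in> insert b I" if "Z' x \<noteq> 0" for x using sZ'[OF that] Zg that by auto
  have eq: "Z = Z' \<or> Z = (\<lambda>x. - Z' x)"
    by (rule signed_circuit_unique[of I]) (use I sZ sZ' Z Z' in \<open>auto simp: base_def\<close>)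
  have Zb: "Z b \<noteq> 0"
    using signed_circuit_not_indep[OF Z(1), of I] sZ I by (auto simp: base_def)
  have Za: "Z a \<noteq> 0"
  proof
    assume "Z a = 0"
    hence "x \<in> insert b (I - {a})" if "Z x \<noteq> 0" for x using sZ[OF that] that by auto
    thus False using signed_circuit_not_indep[OF Z(1)] I' by (auto simp: base_def)
  qed
  have "Z' a \<noteq> 0" "Z' b \<noteq> 0" using eq Za Zb by auto
  hence "Z a = C a" "Z' a = C a" "Z b = D b" "Z' b = - D b"
    using Za Zb Z(3)[of a] Z(3)[of b] Z'(3)[of a] Z'(3)[of b] Cb Da by auto
  thus False using eq Za Zb by (auto dest: fun_cong[of _ _ a] fun_cong[of _ _ b])
qed

text \<open>Any two bases of \<open>H\<close> are joined by exchanges of single elements, and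
  \<open>sign_product_adjacent\<close> keeps the sign along each of them. For equal bases the two
  circuits agree up to sign, and the value at \<open>f\<close> decides.\<close>

lemma sign_product_base:
  assumes "base I" "base J" and f: "f \<in> E - H" and g: "g \<in> E - H" and ne: "f \<noteq> g"
    and C: "C \<in> \<S>" "\<And>x. C x \<noteq> 0 \<Longrightarrow> x \<in> insert f (insert g I)" "C f = 1" "C g \<noteq> 0"
    and D: "D \<in> \<S>" "\<And>x. D x \<noteq> 0 \<Longrightarrow> x \<in> insert f (insert g J)" "D f = 1" "D g \<noteq> 0"
  shows "C g = D g"
  using assms(1) C
proof (induction "card (I - J)" arbitrary: I C rule: less_induct)
  case (less I C)
  note I = less.prems(1) and C = less.prems(2-5)
  have fin: "finite I" "finite J" "card I = card J" using I assms(2) indep_finite by (auto simp: base_def)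
  show ?case
  proof (cases "I \<subseteq> J")
    case True
    hence "I = J" using fin by (simp add: card_subset_eq)
    hence "C = D \<or> C = (\<lambda>x. - D x)"
      using C D indep_insert_outside[OF I g] by (intro signed_circuit_unique[of "insert g I" C f]) auto
    thus ?thesis using C D by (auto dest: fun_cong[of _ _ f])
  next
    case False
    then obtain a where a: "a \<in> I" "a \<notin> J" by blast
    have "card (I - {a}) < card J" using a fin by (metis card_Diff1_less)
    moreover have "indep M (I - {a})" "indep M J" using I assms(2) indep_subset by (auto simp: base_def)
    ultimately obtain b where b: "b \<in> J - (I - {a})" "indep M (insert b (I - {a}))" using augment by blast
    have bI: "b \<notin> I" using a b by auto
    have "card (insert b (I - {a})) = card I" using a bI fin
      by (metis Diff_iff card_Suc_Diff1 card_insert_disjoint finite_Diff)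
    hence base': "base (insert b (I - {a}))" using I assms(2) b by (auto simp: base_def)
    have "insert b (I - {a}) - J = (I - J) - {a}" using b by auto
    hence lt: "card (insert b (I - {a}) - J) < card (I - J)"
      using a fin by (metis DiffI card_Diff1_less finite_Diff)
    obtain C' where C': "C' \<in> \<S>" "\<And>x. C' x \<noteq> 0 \<Longrightarrow> x \<in> insert f (insert g (insert b (I - {a})))"
      "C' f = 1" "C' g \<noteq> 0" using circuit_two_outside[OF base' f g ne] by blast
    have "C g = C' g"
      using sign_product_adjacent[OF I a(1) _ base' f g ne C C'] b bI assms(2) by (auto simp: base_def)
    also have "C' g = D g" by (rule less.hyps[OF lt base' C'])
    finally show ?thesis .
  qed
qed

lemma base_extends:
  assumes "I \<subseteq> H" "indep M I"
  shows "\<exists>J. I \<subseteq> J \<and> base J"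
  using extend_indep[OF assms] by (auto simp: base_def)

text \<open>With \<open>X e = 1\<close>, orthogonality to the circuit through \<open>e\<close> and
  \<open>f\<close> over one fixed base \<open>I0\<close> forces the value \<open>X f\<close>. The
  content is consistency: the same rule holds for every pair \<open>f\<close>, \<open>g\<close> and
  for every base.\<close>

lemma exists_cocircuit_signs:
  "\<exists>X. X e = 1 \<and> (\<forall>f. X f \<in> {-1, 0, 1}) \<and> (\<forall>f. f \<notin> E - H \<longrightarrow> X f = 0) \<and>
     (\<forall>f g I C. f \<in> E - H \<longrightarrow> g \<in> E - H \<longrightarrow> f \<noteq> g \<longrightarrow> base I \<longrightarrow> C \<in> \<S> \<longrightarrow>
       (\<forall>x. C x \<noteq> 0 \<longrightarrow> x \<in> insert f (insert g I)) \<longrightarrow> C f = 1 \<longrightarrow> C g \<noteq> 0 \<longrightarrow> X g = - X f * C g \<and> X f \<noteq> 0)"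
proof -
  obtain I0 where I0: "base I0" using base_extends[of "{}"] indep_empty by auto
  have eD: "e \<in> E - H" using e e_notin by blast
  have "\<exists>C. \<forall>f \<in> E - H - {e}. C f \<in> \<S> \<and> (\<forall>x. C f x \<noteq> 0 \<longrightarrow> x \<in> insert e (insert f I0)) \<and> C f e = 1 \<and> C f f \<noteq> 0"
    using circuit_two_outside[OF I0 eD] by (intro bchoice) auto
  then obtain K where K: "\<And>f. f \<in> E - H - {e} \<Longrightarrow> K f \<in> \<S>"
    "\<And>f x. f \<in> E - H - {e} \<Longrightarrow> K f x \<noteq> 0 \<Longrightarrow> x \<in> insert e (insert f I0)"
    "\<And>f. f \<in> E - H - {e} \<Longrightarrow> K f e = 1" "\<And>f. f \<in> E - H - {e} \<Longrightarrow> K f f \<noteq> 0" by blast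
  define X where "X f = (if f = e then 1 else if f \<in> E - H then - K f f else 0)" for f
  have rel: "\<exists>C \<in> \<S>. (\<forall>x. C x \<noteq> 0 \<longrightarrow> x \<in> insert f (insert g I0)) \<and> C f = 1 \<and> C g \<noteq> 0 \<and> X g = - X f * C g \<and> X f \<noteq> 0"
    if f: "f \<in> E - H" and g: "g \<in> E - H" and ne: "f \<noteq> g" for f g
  proof -
    consider "f = e" | "g = e" "f \<noteq> e" | "f \<noteq> e" "g \<noteq> e" by blast
    thus ?thesis
    proof cases
      case 1
      thus ?thesis using K[of g] g ne by (intro bexI[of _ "K g"]) (auto simp: X_def)
    next
      case 2
      define s where "s = K f f"
      have s: "s \<in> {-1, 1}" "s * s = 1" using K[of f] f 2 sign[of "K f" f] by (auto simp: s_def)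
      have "(\<lambda>x. s * K f x) \<in> \<S>" using s K(1)[of f] minus[OF K(1)[of f]] f 2 by auto
      thus ?thesis using K[of f] f 2 s by (intro bexI[of _ "\<lambda>x. s * K f x"]) (auto simp: X_def s_def)
    next
      case 3
      have fK: "K f \<in> \<S>" and gK: "K g \<in> \<S>" using K(1) f g 3 by auto
      have I0H: "I0 \<subseteq> H" using I0 by (auto simp: base_def)
      have Kgf: "K g f = 0" and Kfg: "K f g = 0"
        using K(2)[of g f] K(2)[of f g] 3 f g ne I0H by auto
      define s where "s = K f f"
      have s: "s \<in> {-1, 1}" "s * s = 1" using K[of f] f 3 sign[of "K f" f] by (auto simp: s_def)
      \<comment> \<open>Both \<open>K f\<close> and \<open>K g\<close> take the value 1 at
        \<open>e\<close>, so \<open>e\<close> can be eliminated from \<open>K f\<close> and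
        \<open>- K g\<close>. The result passes through \<open>f\<close> and \<open>g\<close>, and
        each of these values comes from one of the two circuits only, since the other vanishes
        there.\<close>
      obtain Z where Z: "Z \<in> \<S>" "Z e = 0" "\<And>x. Z x \<in> {0, K f x, - K g x}"
        using eliminate[OF fK minus[OF gK], of f e] K(3,4)[of f] K(3)[of g] 3 f g Kgf by auto
      have sZ: "x \<in> insert f (insert g I0)" if "Z x \<noteq> 0" for x
        using Z(3)[of x] Z(2) that K(2)[of f x] K(2)[of g x] f g 3 by auto
      have Zf: "Z f \<noteq> 0" using signed_circuit_not_indep[OF Z(1), of "insert g I0"] sZ indep_insert_outside[OF I0 g] by blast
      have Zg: "Z g \<noteq> 0" using signed_circuit_not_indep[OF Z(1), of "insert f I0"] sZ indep_insert_outside[OF I0 f] by blast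
      have Zfg: "Z f = s" "Z g = - K g g" using Zf Zg Z(3)[of f] Z(3)[of g] Kgf Kfg by (auto simp: s_def)
      have "(\<lambda>x. s * Z x) \<in> \<S>" using s Z(1) minus[OF Z(1)] by auto
      thus ?thesis using sZ Zfg Zg s f g 3 K(4)[of g]
        by (intro bexI[of _ "\<lambda>x. s * Z x"]) (auto simp: X_def s_def[symmetric])
    qed
  qed
  have "X g = - X f * C g \<and> X f \<noteq> 0" if f: "f \<in> E - H" and g: "g \<in> E - H" and ne: "f \<noteq> g" and I: "base I"
    and C: "C \<in> \<S>" "\<And>x. C x \<noteq> 0 \<Longrightarrow> x \<in> insert f (insert g I)" "C f = 1" "C g \<noteq> 0" for f g I C
  proof -
    obtain D where D: "D \<in> \<S>" "\<And>x. D x \<noteq> 0 \<Longrightarrow> x \<in> insert f (insert g I0)" "D f = 1" "D g \<noteq> 0"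
      "X g = - X f * D g" "X f \<noteq> 0" using rel[OF f g ne] by blast
    have "C g = D g" by (rule sign_product_base[OF I I0 f g ne C D(1-4)])
    thus ?thesis using D by simp
  qed
  moreover have "X f \<in> {-1, 0, 1}" for f using K(1)[of f] sign[of "K f" f] by (auto simp: X_def)
  moreover have "X f = 0" if "f \<notin> E - H" for f using that eD by (auto simp: X_def)
  ultimately show ?thesis by (intro exI[of _ X]) (auto simp: X_def)
qed

text \<open>Suppose that all products of \<open>X\<close> and \<open>C\<close> are nonnegative and
  \<open>C\<close> has an element \<open>f\<close> outside \<open>H\<close>. Eliminating
  \<open>f\<close> by a circuit that meets the complement of \<open>H\<close> only in
  \<open>f\<close> and \<open>g\<close> keeps the products nonnegative and leaves fewer elements
  outside \<open>H\<close>. By induction none are left, and the remaining circuit lies in an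
  independent set, a contradiction.\<close>

lemma exists_cocircuit: "\<exists>X \<in> covectors. X e = 1 \<and> (\<forall>f \<in> H. X f = 0)"
proof -
  obtain X where X: "X e = 1" "\<And>f. X f \<in> {-1, 0, 1}" "\<And>f. f \<notin> E - H \<Longrightarrow> X f = 0"
    and rel: "\<And>f g I C. \<lbrakk>f \<in> E - H; g \<in> E - H; f \<noteq> g; base I; C \<in> \<S>;
       \<And>x. C x \<noteq> 0 \<Longrightarrow> x \<in> insert f (insert g I); C f = 1; C g \<noteq> 0\<rbrakk> \<Longrightarrow> X g = - X f * C g \<and> X f \<noteq> 0"
    using exists_cocircuit_signs by blast
  have no: "(\<forall>x. X x * C x \<ge> 0) \<Longrightarrow> C \<in> \<S> \<Longrightarrow> f \<in> E - H \<Longrightarrow> C f = 0" for C f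
  proof (induction "card {x \<in> E - H. C x \<noteq> 0}" arbitrary: C f rule: less_induct)
    case (less C f)
    note C = less.prems(2) and f = less.prems(3) and ge = less.prems(1)[rule_format]
    show ?case
    proof (rule ccontr)
      assume Cf: "C f \<noteq> 0"
      obtain g where g: "g \<in> E - H" "g \<noteq> f" "C g \<noteq> 0" using two_outside[OF C f Cf] by blast
      have "{x. C x \<noteq> 0} \<inter> H \<subset> {x. C x \<noteq> 0}" using Cf f by auto
      hence "indep M ({x. C x \<noteq> 0} \<inter> H)" using circuit_proper[OF circuit[OF C]] by blast
      then obtain I where I: "{x. C x \<noteq> 0} \<inter> H \<subseteq> I" "base I" using base_extends by blast
      have IH: "I \<subseteq> H" using I by (auto simp: base_def)
      obtain D where D: "D \<in> \<S>" "\<And>x. D x \<noteq> 0 \<Longrightarrow> x \<in> insert f (insert g I)" "D f = 1" "D g \<noteq> 0"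
        using circuit_two_outside[OF I(2) f g(1)] g(2) by blast
      have XD: "X g = - X f * D g" "X f \<noteq> 0" using rel[OF f g(1) _ I(2) D] g(2) by auto
      have Dg: "D g * D g = 1" using sign_square[OF D(1,4)] .
      define s where "s = - C f"
      have s: "s \<in> {-1, 1}" using sign[OF C, of f] Cf by (auto simp: s_def)
      \<comment> \<open>The scaling gives \<open>D' f = - C f\<close>; the relative sign prescribed
        by \<open>X\<close> then yields \<open>D' g = X g = C g\<close>, so the sign at
        \<open>g\<close> does no harm in the elimination.\<close>
      define D' where "D' = (\<lambda>x. s * D x)"
      have D': "D' \<in> \<S>" using s D(1) minus[OF D(1)] by (auto simp: D'_def)
      have D'f: "D' f = - C f" using D by (simp add: D'_def s_def)
      have XCf: "X f = C f" using ge[of f] XD X(2)[of f] sign[OF C, of f] Cf by auto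
      have "X g \<noteq> 0" using XD D by auto
      hence XCg: "X g = C g" using ge[of g] X(2)[of g] sign[OF C, of g] g by auto
      have XDg: "D' g = X g" using XD XCf by (simp add: D'_def s_def)
      obtain Z where Z: "Z \<in> \<S>" "Z f = 0" "\<And>x. Z x \<in> {0, C x, D' x}"
        using eliminate[OF C D', of g f] D'f XDg XCg Cf g by auto
      have XZ: "X x * Z x \<ge> 0" for x
      proof (cases "Z x = C x \<or> Z x = 0 \<or> x = f \<or> x = g")
        case True
        thus ?thesis using ge[of x] Z(2) Z(3)[of g] XDg XCg X(2)[of g] by auto
      next
        case False
        hence "D' x \<noteq> 0" using Z(3)[of x] by auto
        hence "x \<in> I" using D(2)[of x] False by (auto simp: D'_def)
        thus ?thesis using X(3)[of x] IH by auto
      qed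
      have sZ: "x \<in> I" if "Z x \<noteq> 0" "x \<in> H" for x
        using Z(3)[of x] that I(1) D(2)[of x] f g by (auto simp: D'_def)
      have sub: "{x \<in> E - H. Z x \<noteq> 0} \<subseteq> {x \<in> E - H. C x \<noteq> 0} - {f}"
        using Z D(2) Cf g IH by (fastforce simp: D'_def)
      have "finite {x \<in> E - H. C x \<noteq> 0}" using finite_ground by simp
      hence "card {x \<in> E - H. Z x \<noteq> 0} < card {x \<in> E - H. C x \<noteq> 0}"
        using sub f Cf by (intro psubset_card_mono) auto
      from less.hyps[OF this _ Z(1)] XZ have "\<And>x. x \<in> E - H \<Longrightarrow> Z x = 0" by blast
      hence "\<And>x. Z x \<noteq> 0 \<Longrightarrow> x \<in> I" using sZ signed_circuit_ground[OF Z(1)] by blast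
      thus False using signed_circuit_not_indep[OF Z(1)] I(2) by (auto simp: base_def)
    qed
  qed
  have "\<exists>x. X x * C x < 0" if C: "C \<in> \<S>" and f: "X f * C f > 0" for C f
  proof (rule ccontr)
    assume "\<not> ?thesis"
    hence "\<forall>x. X x * C x \<ge> 0" by (auto simp: not_less)
    hence "C f = 0" if "f \<in> E - H" using no[OF _ C that] by blast
    thus False using X(3)[of f] f by (cases "f \<in> E - H") auto
  qed
  hence "X \<in> covectors" using X by (auto simp: covectors_def)
  thus ?thesis using X(1,3) by blast
qed

end

section \<open>Covector axioms and their derivation from the signed circuits\<close>

definition sign_comp :: "('a \<Rightarrow> int) \<Rightarrow> ('a \<Rightarrow> int) \<Rightarrow> 'a \<Rightarrow> int" where
  "sign_comp X Y = (\<lambda>e. if X e = 0 then Y e else X e)"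

text \<open>Elimination prescribes \<open>Z\<close> off the separation set of \<open>X\<close> and
  \<open>Y\<close>. The rank is tied to \<open>L\<close> through \<open>r_insert\<close>:
  \<open>S\<close> spans \<open>e\<close> if and only if every covector that vanishes on
  \<open>S\<close> vanishes at \<open>e\<close>.\<close>

locale covector_system =
  fixes E :: "'a set" and L :: "('a \<Rightarrow> int) set" and r :: "'a set \<Rightarrow> nat"
  assumes finite_E: "finite E"
    and sign: "X \<in> L \<Longrightarrow> X e \<in> {-1, 0, 1}"
    and outside: "X \<in> L \<Longrightarrow> e \<notin> E \<Longrightarrow> X e = 0"
    and zero: "(\<lambda>_. 0) \<in> L"
    and minus: "X \<in> L \<Longrightarrow> (\<lambda>e. - X e) \<in> L"
    and comp: "X \<in> L \<Longrightarrow> Y \<in> L \<Longrightarrow> sign_comp X Y \<in> L"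
    and elim: "\<lbrakk>X \<in> L; Y \<in> L; X e = - Y e; X e \<noteq> 0\<rbrakk> \<Longrightarrow>
      \<exists>Z \<in> L. Z e = 0 \<and> (\<forall>f. X f = 0 \<or> X f \<noteq> - Y f \<longrightarrow> Z f = sign_comp X Y f)"
    and r_empty: "r {} = 0"
    and r_insert: "\<lbrakk>S \<subseteq> E; e \<in> E - S\<rbrakk> \<Longrightarrow>
      r (insert e S) = (if \<forall>X \<in> L. (\<forall>f \<in> S. X f = 0) \<longrightarrow> X e = 0 then r S else Suc (r S))"

context signed_circuits
begin

lemma covectorD:
  assumes "X \<in> covectors"
  shows "X e \<in> {-1, 0, 1}" "e \<notin> E \<Longrightarrow> X e = 0"
    "C \<in> \<S> \<Longrightarrow> X e * C e > 0 \<Longrightarrow> \<exists>f. X f * C f < 0"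
    "C \<in> \<S> \<Longrightarrow> X e * C e < 0 \<Longrightarrow> \<exists>f. X f * C f > 0"
proof -
  show "X e \<in> {-1, 0, 1}" "e \<notin> E \<Longrightarrow> X e = 0"
    "C \<in> \<S> \<Longrightarrow> X e * C e > 0 \<Longrightarrow> \<exists>f. X f * C f < 0"
    using assms by (auto simp: covectors_def)
  show "\<exists>f. X f * C f > 0" if C: "C \<in> \<S>" and "X e * C e < 0"
  proof -
    have "X e * (- C e) > 0" using that by simp
    hence "\<exists>f. X f * (- C f) < 0" using assms bspec[OF _ minus[OF C]] unfolding covectors_def by blast
    thus ?thesis by simp
  qed
qed

lemma uminus_covectors:
  assumes X: "X \<in> covectors"
  shows "(\<lambda>e. - X e) \<in> covectors"
proof -
  have "- X e \<in> {-1, 0, 1}" "e \<notin> E \<Longrightarrow> - X e = 0" for e using covectorD(1,2)[OF X, of e] by auto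
  moreover have "\<exists>e. - X e * C e < 0" if "C \<in> \<S>" "- X e * C e > 0" for C e
    using covectorD(4)[OF X that(1), of e] that(2) by simp
  ultimately show ?thesis unfolding covectors_def by blast
qed

text \<open>A circuit through \<open>e\<close> inside \<open>insert e S\<close> is not orthogonal to
  a sign vector that vanishes on \<open>S\<close> but not at \<open>e\<close>. Conversely, a maximal
  set containing \<open>S\<close> and not spanning \<open>e\<close> is a hyperplane for which
  \<open>exists_cocircuit\<close> supplies the covector.\<close>

lemma spans_iff_covectors:
  assumes S: "S \<subseteq> E" and e: "e \<in> E - S"
  shows "spans S e \<longleftrightarrow> (\<forall>X \<in> covectors. (\<forall>f \<in> S. X f = 0) \<longrightarrow> X e = 0)"
proof
  assume "spans S e"
  then obtain D where D: "D \<in> circuits M" "e \<in> D" "D \<subseteq> insert e S"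
    using spans_iff_circuit[of e S] S e by blast
  then obtain C where C: "C \<in> \<S>" "{e. C e \<noteq> 0} = D" using lift by blast
  show "\<forall>X \<in> covectors. (\<forall>f \<in> S. X f = 0) \<longrightarrow> X e = 0"
  proof (intro ballI impI, rule ccontr)
    fix X assume X: "X \<in> covectors" "\<forall>f \<in> S. X f = 0" "X e \<noteq> 0"
    have z: "X f * C f = 0" if "f \<noteq> e" for f using that C D X(2) by auto
    have "X e * C e \<noteq> 0" using X(3) C D by auto
    then consider "X e * C e > 0" | "X e * C e < 0" by linarith
    thus False
    proof cases
      case 1
      thus False using covectorD(3)[OF X(1) C(1) 1] z by (metis less_irrefl not_less_iff_gr_or_eq)
    next
      case 2
      thus False using covectorD(4)[OF X(1) C(1) 2] z by (metis less_irrefl not_less_iff_gr_or_eq)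
    qed
  qed
next
  assume all: "\<forall>X \<in> covectors. (\<forall>f \<in> S. X f = 0) \<longrightarrow> X e = 0"
  show "spans S e"
  proof (rule ccontr)
    assume ns: "\<not> spans S e"
    define F where "F = {H. S \<subseteq> H \<and> H \<subseteq> E \<and> \<not> spans H e}"
    have "finite F" unfolding F_def using finite_ground by simp
    moreover have "S \<in> F" using ns S by (simp add: F_def)
    ultimately obtain H where H: "H \<in> F" "\<And>G. G \<in> F \<Longrightarrow> H \<subseteq> G \<Longrightarrow> H = G"
      using finite_has_maximal[of F] by blast
    have SH: "S \<subseteq> H" using H(1) by (simp add: F_def)
    interpret signed_hyperplane M \<S> H e
    proof unfold_locales
      show "spans (insert f H) e" if "f \<in> E - H" for f
      proof (rule ccontr)
        assume "\<not> spans (insert f H) e"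
        hence "insert f H \<in> F" using H(1) that by (auto simp: F_def)
        from H(2)[OF this] that show False by auto
      qed
    qed (use H e in \<open>auto simp: F_def\<close>)
    from exists_cocircuit obtain X where X: "X \<in> covectors" "X e = 1" "\<forall>f\<in>H. X f = 0" by blast
    hence "X e = 0" using all SH by blast
    thus False using X by simp
  qed
qed

text \<open>A form of Minty's painting lemma: \<open>B\<close> collects the elements where the covector must vanish,
  \<open>P\<close> those where the sign is prescribed by \<open>\<tau>\<close>. The induction moves an element of \<open>P\<close>
  either to \<open>B\<close> or out of both sets; the two exceptional answers would not be orthogonal.\<close>

lemma painting:
  assumes "finite P" and e: "e \<in> E" "e \<notin> B" "e \<notin> P" and BE: "B \<subseteq> E" "B \<inter> P = {}"
    and \<tau>: "\<And>f. f \<in> insert e P \<Longrightarrow> \<tau> f \<in> {-1, 1 :: int}"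
  shows "(\<exists>X \<in> covectors. X e = \<tau> e \<and> (\<forall>f\<in>B. X f = 0) \<and> (\<forall>f\<in>P. \<tau> f * X f \<ge> 0)) \<or>
    (\<exists>C \<in> \<S>. C e = \<tau> e \<and> (\<forall>f\<in>P. \<tau> f * C f \<ge> 0) \<and> (\<forall>f. C f \<noteq> 0 \<longrightarrow> f = e \<or> f \<in> B \<or> f \<in> P))"
  using assms(1,3-7)
proof (induction P arbitrary: B rule: finite_induct)
  case empty
  have te: "\<tau> e \<in> {-1, 1}" using empty by auto
  show ?case
  proof (cases "spans B e")
    case True
    then obtain D where D: "D \<in> circuits M" "e \<in> D" "D \<subseteq> insert e B"
      using spans_iff_circuit[of e B] e empty by blast
    then obtain C where C: "C \<in> \<S>" "{e. C e \<noteq> 0} = D" using lift by blast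
    have "C e = \<tau> e \<or> - C e = \<tau> e" using te sign[OF C(1), of e] C D by auto
    then obtain C' where C': "C' \<in> \<S>" "C' e = \<tau> e" "\<And>f. C' f \<noteq> 0 \<longleftrightarrow> C f \<noteq> 0"
    proof (elim disjE)
      assume "- C e = \<tau> e"
      thus thesis using that[OF minus[OF C(1)]] by simp
    qed (use that[OF C(1)] in blast)
    have "f = e \<or> f \<in> B" if "C' f \<noteq> 0" for f using that C' C D by blast
    thus ?thesis using C'(1,2) by blast
  next
    case False
    then obtain X where X: "X \<in> covectors" "\<forall>f\<in>B. X f = 0" "X e \<noteq> 0"
      using spans_iff_covectors[of B e] empty e by blast
    have "X e = \<tau> e \<or> - X e = \<tau> e" using te covectorD(1)[OF X(1), of e] X(3) by auto
    thus ?thesis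
    proof
      assume "- X e = \<tau> e"
      thus ?thesis using X(2) uminus_covectors[OF X(1)] by (intro disjI1 bexI[of _ "\<lambda>x. - X x"]) simp_all
    qed (use X in blast)
  qed
next
  case (insert p P)
  have tp: "\<tau> p \<in> {-1, 1}" "\<tau> p * \<tau> p = 1" using insert.prems(5)[of p] by auto
  have p: "p \<noteq> e" using insert by auto
  have IH1: "(\<exists>X \<in> covectors. X e = \<tau> e \<and> (\<forall>f\<in>B. X f = 0) \<and> (\<forall>f\<in>P. \<tau> f * X f \<ge> 0)) \<or>
    (\<exists>C \<in> \<S>. C e = \<tau> e \<and> (\<forall>f\<in>P. \<tau> f * C f \<ge> 0) \<and> (\<forall>f. C f \<noteq> 0 \<longrightarrow> f = e \<or> f \<in> B \<or> f \<in> P))"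
    by (rule insert.IH) (use insert.prems in auto)
  show ?case
  proof (cases "p \<in> E")
    case False
    have X0: "X p = 0" if "X \<in> covectors" for X using that False covectorD(2) by blast
    have C0: "C p = 0" if "C \<in> \<S>" for C using that False signed_circuit_ground by blast
    from IH1 show ?thesis
    proof (elim disjE bexE conjE)
      fix X assume "X \<in> covectors" "X e = \<tau> e" "\<forall>f\<in>B. X f = 0" "\<forall>f\<in>P. \<tau> f * X f \<ge> 0"
      thus ?thesis using X0[of X] by (intro disjI1 bexI[of _ X]) simp_all
    next
      fix C assume "C \<in> \<S>" "C e = \<tau> e" "\<forall>f\<in>P. \<tau> f * C f \<ge> 0" "\<forall>f. C f \<noteq> 0 \<longrightarrow> f = e \<or> f \<in> B \<or> f \<in> P"
      thus ?thesis using C0[of C] by (intro disjI2 bexI[of _ C]) auto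
    qed
  next
    case True
    have IH2: "(\<exists>X \<in> covectors. X e = \<tau> e \<and> (\<forall>f\<in>insert p B. X f = 0) \<and> (\<forall>f\<in>P. \<tau> f * X f \<ge> 0)) \<or>
      (\<exists>C \<in> \<S>. C e = \<tau> e \<and> (\<forall>f\<in>P. \<tau> f * C f \<ge> 0) \<and> (\<forall>f. C f \<noteq> 0 \<longrightarrow> f = e \<or> f \<in> insert p B \<or> f \<in> P))"
      by (rule insert.IH) (use insert.prems insert.hyps p True in auto)
    show ?thesis
    proof (rule ccontr)
      assume no: "\<not> ?thesis"
      have nX: "\<not> \<tau> p * X p \<ge> 0" if "X \<in> covectors" "X e = \<tau> e" "\<forall>f\<in>B. X f = 0" "\<forall>f\<in>P. \<tau> f * X f \<ge> 0" for X
        using no that by blast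
      have nC: "\<not> \<tau> p * C p \<ge> 0" if "C \<in> \<S>" "C e = \<tau> e" "\<forall>f\<in>P. \<tau> f * C f \<ge> 0"
        "\<forall>f. C f \<noteq> 0 \<longrightarrow> f = e \<or> f \<in> insert p B \<or> f \<in> P" for C
        using no that by blast
      have False if "X \<in> covectors" "X e = \<tau> e" "\<forall>f\<in>insert p B. X f = 0" "\<forall>f\<in>P. \<tau> f * X f \<ge> 0" for X
        using nX[of X] that by simp
      then obtain C where C: "C \<in> \<S>" "C e = \<tau> e" "\<And>f. f\<in>P \<Longrightarrow> \<tau> f * C f \<ge> 0"
        "\<And>f. C f \<noteq> 0 \<Longrightarrow> f = e \<or> f \<in> insert p B \<or> f \<in> P" using IH2 by blast
      have False if "C \<in> \<S>" "C e = \<tau> e" "\<forall>f\<in>P. \<tau> f * C f \<ge> 0" "\<forall>f. C f \<noteq> 0 \<longrightarrow> f = e \<or> f \<in> B \<or> f \<in> P" for C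
        proof (cases "C p = 0")
        case False
        moreover have "p \<notin> B" using insert.prems by blast
        ultimately show False using that(4) p insert.hyps(2) by blast
      qed (use nC[OF that(1-3)] that(4) in auto)
      then obtain X where X: "X \<in> covectors" "X e = \<tau> e" "\<And>f. f\<in>B \<Longrightarrow> X f = 0"
        "\<And>f. f\<in>P \<Longrightarrow> \<tau> f * X f \<ge> 0" using IH1 by blast
      have "\<tau> p * X p < 0" "\<tau> p * C p < 0" using nX[of X] nC[of C] X C by force+
      hence "X p * C p > 0" using tp by (auto simp: zero_less_mult_iff mult_less_0_iff)
      from covectorD(3)[OF X(1) C(1) this] obtain f where f: "X f * C f < 0" by blast
      have tf: "\<tau> f \<in> {-1, 1}" if "f \<in> P" using insert.prems(5)[of f] that by auto
      have "C f \<noteq> 0" "X f \<noteq> 0" using f by auto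
      hence "f = e \<or> f = p \<or> f \<in> P" using C(4)[of f] X(3)[of f] by auto
      moreover have "X e * C e \<ge> 0" using X C by simp
      moreover have "X f * C f \<ge> 0" if "f \<in> P"
        using X(4)[OF that] C(3)[OF that] tf[OF that] by (auto simp: zero_le_mult_iff)
      ultimately show False using f \<open>X p * C p > 0\<close> by auto
    qed
  qed
qed

lemma compose_covectors:
  assumes X: "X \<in> covectors" and Y: "Y \<in> covectors"
  shows "sign_comp X Y \<in> covectors"
proof -
  have "\<exists>f. sign_comp X Y f * C f < 0" if C: "C \<in> \<S>" and e: "sign_comp X Y e * C e > 0" for C e
  proof (cases "\<exists>g. X g * C g \<noteq> 0")
    case True
    then obtain g where "X g * C g \<noteq> 0" by blast
    hence "\<exists>f. X f * C f < 0" using covectorD(3)[OF X C] by (metis linorder_neqE_linordered_idom)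
    then obtain f where "X f * C f < 0" by blast
    thus ?thesis by (intro exI[of _ f]) (auto simp: sign_comp_def)
  next
    case False
    hence z: "X f = 0 \<or> C f = 0" for f by auto
    hence eq: "sign_comp X Y f * C f = Y f * C f" for f by (metis sign_comp_def mult_zero_right)
    show ?thesis using covectorD(3)[OF Y C, of e] e unfolding eq by blast
  qed
  moreover have "sign_comp X Y f \<in> {-1, 0, 1}" "f \<notin> E \<Longrightarrow> sign_comp X Y f = 0" for f
    using covectorD(1,2)[OF X, of f] covectorD(1,2)[OF Y, of f] by (auto simp: sign_comp_def)
  ultimately show ?thesis unfolding covectors_def by blast
qed

text \<open>Apply \<open>painting\<close> at \<open>f\<close>, asking for zeros at \<open>e\<close>
  and at the common zeros, and for the signs of \<open>sign_comp X Y\<close> on the rest of the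
  complement of the separation set. A circuit \<open>C\<close> as in the second alternative has
  nonnegative products with \<open>X\<close> and \<open>Y\<close> off \<open>e\<close>, so
  orthogonality makes both products at \<open>e\<close> nonpositive. Being opposite they vanish, and
  then \<open>X\<close> and \<open>Y\<close> both vanish at \<open>f\<close>, contrary to the choice
  of \<open>f\<close>.\<close>

lemma eliminate_covectors_at:
  assumes X: "X \<in> covectors" and Y: "Y \<in> covectors" and e: "X e = - Y e" "X e \<noteq> 0"
    and f: "X f = 0 \<or> X f \<noteq> - Y f" "sign_comp X Y f \<noteq> 0"
  shows "\<exists>Z \<in> covectors. Z e = 0 \<and> Z f = sign_comp X Y f \<and>
    (\<forall>g. X g = 0 \<or> X g \<noteq> - Y g \<longrightarrow> Z g = 0 \<or> Z g = sign_comp X Y g)"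
proof -
  let ?\<tau> = "sign_comp X Y"
  define P where "P = {g \<in> E. g \<noteq> f \<and> (X g = 0 \<or> X g \<noteq> - Y g) \<and> ?\<tau> g \<noteq> 0}"
  define B where "B = insert e {g \<in> E. X g = 0 \<and> Y g = 0}"
  have xy: "sign_comp X Y \<in> covectors" by (rule compose_covectors[OF X Y])
  have eE: "e \<in> E" and fE: "f \<in> E" using covectorD(2)[OF X, of e] covectorD(2)[OF xy, of f] e f by auto
  have tau: "?\<tau> g \<in> {-1, 1}" if "?\<tau> g \<noteq> 0" for g using covectorD(1)[OF xy, of g] that by auto
  have Xt: "X g = 0 \<or> X g = ?\<tau> g" "Y g = 0 \<or> Y g = ?\<tau> g"
    if "X g = 0 \<or> X g \<noteq> - Y g" for g
    using that covectorD(1)[OF X, of g] covectorD(1)[OF Y, of g] by (auto simp: sign_comp_def)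
  have "(\<exists>Z \<in> covectors. Z f = ?\<tau> f \<and> (\<forall>g\<in>B. Z g = 0) \<and> (\<forall>g\<in>P. ?\<tau> g * Z g \<ge> 0)) \<or>
    (\<exists>C \<in> \<S>. C f = ?\<tau> f \<and> (\<forall>g\<in>P. ?\<tau> g * C g \<ge> 0) \<and> (\<forall>g. C g \<noteq> 0 \<longrightarrow> g = f \<or> g \<in> B \<or> g \<in> P))"
  proof (rule painting)
    show "B \<inter> P = {}" using e by (auto simp: B_def P_def sign_comp_def)
    show "f \<notin> B" using f e by (auto simp: B_def sign_comp_def split: if_splits)
  qed (use finite_ground eE fE tau f in \<open>auto simp: P_def B_def\<close>)
  thus ?thesis
  proof (elim disjE bexE conjE)
    fix Z assume Z: "Z \<in> covectors" "Z f = ?\<tau> f" "\<forall>g\<in>B. Z g = 0" "\<forall>g\<in>P. ?\<tau> g * Z g \<ge> 0"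
    have "Z g = 0 \<or> Z g = ?\<tau> g" if g: "X g = 0 \<or> X g \<noteq> - Y g" for g
    proof (cases "g \<in> E \<and> g \<noteq> f \<and> ?\<tau> g \<noteq> 0")
      case True
      hence "?\<tau> g * Z g \<ge> 0" using Z(4) g by (simp add: P_def)
      thus ?thesis using tau[of g] True covectorD(1)[OF Z(1), of g] by auto
    next
      case False
      moreover have "Z g = 0" if "?\<tau> g = 0" "g \<in> E"
        using Z(3) that by (auto simp: B_def sign_comp_def split: if_splits)
      ultimately show ?thesis using Z(2) covectorD(2)[OF Z(1), of g] by blast
    qed
    thus ?thesis using Z by (intro bexI[of _ Z]) (auto simp: B_def)
  next
    fix C assume C: "C \<in> \<S>" "C f = ?\<tau> f" "\<forall>g\<in>P. ?\<tau> g * C g \<ge> 0"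
      "\<forall>g. C g \<noteq> 0 \<longrightarrow> g = f \<or> g \<in> B \<or> g \<in> P"
    have ge: "V g * C g \<ge> 0" if V: "V = X \<or> V = Y" and g: "g \<noteq> e" for V g
    proof (cases "C g = 0")
      case False
      hence "g = f \<or> g \<in> B \<or> g \<in> P" using C(4) by blast
      hence "g = f \<or> (X g = 0 \<and> Y g = 0) \<or> g \<in> P" using g by (auto simp: B_def)
      moreover have "V g * C g \<ge> 0" if "g = f" using V Xt[OF f(1)] C(2) that by auto
      moreover have "V g * C g \<ge> 0" if gP: "g \<in> P"
      proof -
        have "V g = 0 \<or> V g = ?\<tau> g" using V Xt[of g] gP by (auto simp: P_def)
        thus ?thesis using C(3) gP by auto
      qed
      ultimately show ?thesis using V by auto
    qed auto
    have no: "V e * C e < 0 \<or> (V e * C e = 0 \<and> (V f = 0 \<or> f = e))" if V: "V = X \<or> V = Y" for V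
    proof -
      have Vc: "V \<in> covectors" using V X Y by auto
      have "\<not> (V e * C e > 0)"
      proof
        assume pos: "V e * C e > 0"
        from covectorD(3)[OF Vc C(1) pos] obtain g where "V g * C g < 0" by blast
        thus False using ge[OF V, of g] pos by (cases "g = e") auto
      qed
      moreover have "V f = 0 \<or> f = e" if z: "V e * C e = 0"
      proof (rule ccontr)
        assume nf: "\<not> ?thesis"
        hence "V f = ?\<tau> f" using V Xt[OF f(1)] by auto
        hence "V f * C f > 0" using C(2) tau[OF f(2)] by auto
        from covectorD(3)[OF Vc C(1) this] obtain g where "V g * C g < 0" by blast
        thus False using ge[OF V, of g] z by (cases "g = e") auto
      qed
      ultimately show ?thesis by linarith
    qed
    have fe: "f \<noteq> e" using f e by auto
    have "X e * C e = - (Y e * C e)" using e by simp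
    hence "X f = 0 \<and> Y f = 0" using no[of X] no[of Y] fe by auto
    thus ?thesis using f(2) by (simp add: sign_comp_def)
  qed
qed

text \<open>The covectors found for the single positions never contradict
  \<open>sign_comp X Y\<close> off the separation set. Composing them over all positions therefore
  fills in missing signs without spoiling those already correct, and keeps the zero at
  \<open>e\<close>.\<close>

lemma eliminate_covectors:
  assumes X: "X \<in> covectors" and Y: "Y \<in> covectors" and e: "X e = - Y e" "X e \<noteq> 0"
  shows "\<exists>Z \<in> covectors. Z e = 0 \<and> (\<forall>f. X f = 0 \<or> X f \<noteq> - Y f \<longrightarrow> Z f = sign_comp X Y f)"
proof -
  have "\<exists>Z \<in> covectors. Z e = 0 \<and>
      (\<forall>g. X g = 0 \<or> X g \<noteq> - Y g \<longrightarrow> Z g = 0 \<or> Z g = sign_comp X Y g) \<and>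
      (\<forall>g \<in> G. X g = 0 \<or> X g \<noteq> - Y g \<longrightarrow> Z g = sign_comp X Y g)" if "finite G" for G
    using that
  proof (induction G rule: finite_induct)
    case empty
    have "(\<lambda>_. 0) \<in> covectors" by (auto simp: covectors_def)
    thus ?case by (intro bexI[of _ "\<lambda>_. 0"]) auto
  next
    case (insert f G)
    then obtain Z where Z: "Z \<in> covectors" "Z e = 0"
      "\<And>g. X g = 0 \<or> X g \<noteq> - Y g \<Longrightarrow> Z g = 0 \<or> Z g = sign_comp X Y g"
      "\<And>g. g \<in> G \<Longrightarrow> X g = 0 \<or> X g \<noteq> - Y g \<Longrightarrow> Z g = sign_comp X Y g" by blast
    show ?case
    proof (cases "(X f = 0 \<or> X f \<noteq> - Y f) \<and> sign_comp X Y f \<noteq> 0")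
      case True
      with eliminate_covectors_at[OF X Y e, of f] obtain W where W: "W \<in> covectors" "W e = 0"
        "W f = sign_comp X Y f" "\<And>g. X g = 0 \<or> X g \<noteq> - Y g \<Longrightarrow> W g = 0 \<or> W g = sign_comp X Y g" by blast
      have eq: "sign_comp Z W g = (if Z g = 0 then W g else Z g)" for g by (simp add: sign_comp_def)
      show ?thesis
      proof (intro bexI[of _ "sign_comp Z W"] conjI allI ballI impI)
        show "sign_comp Z W \<in> covectors" by (rule compose_covectors[OF Z(1) W(1)])
        show "sign_comp Z W e = 0" using Z W by (simp add: eq)
        show "sign_comp Z W g = 0 \<or> sign_comp Z W g = sign_comp X Y g" if "X g = 0 \<or> X g \<noteq> - Y g" for g
          unfolding eq using Z(3)[OF that] W(4)[OF that] by auto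
        show "sign_comp Z W g = sign_comp X Y g" if "g \<in> insert f G" "X g = 0 \<or> X g \<noteq> - Y g" for g
          unfolding eq using Z(3)[OF that(2)] Z(4)[OF _ that(2)] W(3) W(4)[OF that(2)] that(1) by auto
      qed
    next
      case False
      hence "X f = 0 \<or> X f \<noteq> - Y f \<Longrightarrow> Z f = sign_comp X Y f" using Z(3)[of f] by auto
      thus ?thesis using Z by (intro bexI[of _ Z]) auto
    qed
  qed
  from this[OF finite_ground] obtain Z where Z: "Z \<in> covectors" "Z e = 0"
    "\<And>g. g \<in> E \<Longrightarrow> X g = 0 \<or> X g \<noteq> - Y g \<Longrightarrow> Z g = sign_comp X Y g" by blast
  have "Z g = sign_comp X Y g" if "g \<notin> E" for g
    using that covectorD(2)[OF Z(1)] covectorD(2)[OF X] covectorD(2)[OF Y] by (simp add: sign_comp_def)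
  thus ?thesis using Z by blast
qed

lemma covector_system: "covector_system E covectors (rank M)"
proof
  show "rank M (insert e S) = (if \<forall>X \<in> covectors. (\<forall>f \<in> S. X f = 0) \<longrightarrow> X e = 0 then rank M S else Suc (rank M S))"
    if "S \<subseteq> E" "e \<in> E - S" for S e
    using rank_insert[of e S] spans_iff_covectors[OF that] by simp
  show "(\<lambda>_. 0) \<in> covectors" by (auto simp: covectors_def)
  show "finite E" by (rule finite_ground)
  show "rank M {} = 0" by (rule rank_empty)
  show "X e \<in> {-1, 0, 1}" "e \<notin> E \<Longrightarrow> X e = 0" "(\<lambda>e. - X e) \<in> covectors" if "X \<in> covectors" for X e
    using covectorD(1,2)[OF that] uminus_covectors[OF that] by blast+
qed (rule compose_covectors eliminate_covectors; assumption)+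

end

section \<open>Euler characteristics of cells\<close>

lemma alternating_sum_Pow:
  "finite A \<Longrightarrow> (\<Sum>S\<in>Pow A. (-1) ^ card S) = (if A = {} then 1 else 0 :: int)"
  using prod_add[of A "\<lambda>_. -1 :: int" "\<lambda>_. 1"] by (simp add: power_0_left)

context covector_system
begin

lemma finite_L: "finite L"
proof (rule finite_subset)
  show "L \<subseteq> {X. \<forall>e. (e \<in> E \<longrightarrow> X e \<in> {-1, 0, 1}) \<and> (e \<notin> E \<longrightarrow> X e = 0)}"
    using sign outside by blast
  show "finite {X :: 'a \<Rightarrow> int. \<forall>e. (e \<in> E \<longrightarrow> X e \<in> {-1, 0, 1}) \<and> (e \<notin> E \<longrightarrow> X e = 0)}"
    using finite_E by (intro finite_set_of_finite_funs) auto
qed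

definition zeros :: "('a \<Rightarrow> int) \<Rightarrow> 'a set" where
  "zeros X = {e \<in> E. X e = 0}"

lemma zeros_subset: "zeros X \<subseteq> E" and finite_zeros: "finite (zeros X)"
  using finite_E by (auto simp: zeros_def)

definition cell :: "'a set \<Rightarrow> 'a set \<Rightarrow> ('a \<Rightarrow> int) \<Rightarrow> ('a \<Rightarrow> int) set" where
  "cell A B \<sigma> = {X \<in> L. (\<forall>e\<in>A. X e = \<sigma> e) \<and> (\<forall>e\<in>B. X e = 0)}"

text \<open>The parity of the codimension of the cell of \<open>X\<close> in a realised arrangement,
  hence its compactly supported Euler characteristic up to the global sign
  \<open>(-1) ^ r E\<close>.\<close>

definition euler_sign :: "('a \<Rightarrow> int) \<Rightarrow> int" where
  "euler_sign X = (-1) ^ r (zeros X)"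

text \<open>The covectors in an open cell are cut by an element outside the span of \<open>B\<close> into at most two
  open cells and a wall, whose contributions are \<open>1\<close>, \<open>1\<close> and \<open>-1\<close>.\<close>

lemma euler_cell:
  assumes "A \<subseteq> E" "B \<subseteq> E" "\<And>e. e \<in> A \<Longrightarrow> \<sigma> e \<noteq> 0" "cell A B \<sigma> \<noteq> {}"
  shows "(\<Sum>X\<in>cell A B \<sigma>. euler_sign X) = (-1) ^ r B"
  using assms
proof (induction "card (E - (A \<union> B))" arbitrary: A B \<sigma> rule: less_induct)
  case (less A B \<sigma>)
  have fin: "finite (E - (A \<union> B))" using finite_E by simp
  have finc: "finite (cell A B \<sigma>)" for A B \<sigma> using finite_L by (simp add: cell_def)
  show ?case
  proof (cases "E \<subseteq> A \<union> B")
    case True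
    obtain X where X: "X \<in> cell A B \<sigma>" using less.prems by blast
    have "Y = X" if Y: "Y \<in> cell A B \<sigma>" for Y
    proof
      fix e show "Y e = X e"
        using X Y True outside[of X e] outside[of Y e]
        by (cases "e \<in> A"; cases "e \<in> B"; cases "e \<in> E") (auto simp: cell_def)
    qed
    hence "cell A B \<sigma> = {X}" using X by blast
    moreover have "zeros X = B" using X True less.prems by (auto simp: zeros_def cell_def)
    ultimately show ?thesis by (simp add: euler_sign_def)
  next
    case False
    then obtain e where e: "e \<in> E" "e \<notin> A" "e \<notin> B" by blast
    have ltA: "card (E - (insert e A \<union> B)) < card (E - (A \<union> B))"
      using e fin by (intro psubset_card_mono) auto
    have ltB: "card (E - (A \<union> insert e B)) < card (E - (A \<union> B))"
      using e fin by (intro psubset_card_mono) auto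
    show ?thesis
    proof (cases "\<forall>X \<in> L. (\<forall>f \<in> B. X f = 0) \<longrightarrow> X e = 0")
      case True
      hence eq: "cell A (insert e B) \<sigma> = cell A B \<sigma>" by (auto simp: cell_def)
      have "r (insert e B) = r B" using r_insert[of B e] less.prems e True by simp
      thus ?thesis using less.hyps[OF ltB, of \<sigma>] less.prems e eq by simp
    next
      case False
      then obtain Y where Y: "Y \<in> L" "\<forall>f\<in>B. Y f = 0" "Y e \<noteq> 0" by blast
      define \<tau> where "\<tau> s = \<sigma>(e := s)" for s :: int
      let ?K = "\<lambda>s. cell (insert e A) B (\<tau> s)"
      have Ks: "?K s = {X \<in> cell A B \<sigma>. X e = s}" for s using e by (auto simp: cell_def \<tau>_def)
      have K0: "cell A (insert e B) \<sigma> = {X \<in> cell A B \<sigma>. X e = 0}" by (auto simp: cell_def)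
      have rB: "r (insert e B) = Suc (r B)" using r_insert[of B e] less.prems e False by auto
      have S: "(\<Sum>X\<in>?K s. euler_sign X) = (-1) ^ r B" if "?K s \<noteq> {}" "s \<noteq> 0" for s
        by (rule less.hyps) (use that ltA less.prems e in \<open>auto simp: \<tau>_def\<close>)
      have S0: "(\<Sum>X\<in>cell A (insert e B) \<sigma>. euler_sign X) = - ((-1) ^ r B)" if "cell A (insert e B) \<sigma> \<noteq> {}"
        using less.hyps[OF ltB, of \<sigma>] that less.prems e rB by simp
      have "cell A B \<sigma> = ?K 1 \<union> ?K (-1) \<union> cell A (insert e B) \<sigma>"
        unfolding Ks K0 using sign[of _ e] by (auto simp: cell_def)
      moreover have "?K 1 \<inter> ?K (-1) = {}" "(?K 1 \<union> ?K (-1)) \<inter> cell A (insert e B) \<sigma> = {}"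
        unfolding Ks K0 by auto
      ultimately have sum: "(\<Sum>X\<in>cell A B \<sigma>. euler_sign X) =
          (\<Sum>X\<in>?K 1. euler_sign X) + (\<Sum>X\<in>?K (-1). euler_sign X) + (\<Sum>X\<in>cell A (insert e B) \<sigma>. euler_sign X)"
        by (metis (no_types, lifting) finc finite_UnI sum.union_disjoint)
      have inK: "sign_comp X V \<in> cell A B \<sigma>" if "X \<in> cell A B \<sigma>" "V \<in> L" "\<forall>f\<in>B. V f = 0" for X V
        using that less.prems(3) comp by (auto simp: cell_def sign_comp_def)
      \<comment> \<open>A covector on the wall is pushed to either side by composing it with
        \<open>Y\<close> or its negative, and elimination between the two sides leads back to the
        wall. So either all three pieces are nonempty or exactly one side is.\<close>
      have both: "?K 1 \<noteq> {} \<and> ?K (-1) \<noteq> {}" if ne: "cell A (insert e B) \<sigma> \<noteq> {}"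
      proof -
        obtain X where X: "X \<in> cell A B \<sigma>" "X e = 0" using ne K0 by blast
        have 1: "sign_comp X Y \<in> cell A B \<sigma>" "sign_comp X Y e = Y e" using inK[OF X(1)] Y X by (auto simp: sign_comp_def)
        have 2: "sign_comp X (\<lambda>f. - Y f) \<in> cell A B \<sigma>" "sign_comp X (\<lambda>f. - Y f) e = - Y e"
          using inK[OF X(1) minus[OF Y(1)]] Y X by (auto simp: sign_comp_def)
        have "Y e = 1 \<or> Y e = -1" using Y sign[of Y e] by auto
        thus ?thesis
        proof
          assume "Y e = 1"
          hence "sign_comp X Y \<in> ?K 1" "sign_comp X (\<lambda>f. - Y f) \<in> ?K (-1)" unfolding Ks using 1 2 by simp_all
          thus ?thesis by blast
        next
          assume "Y e = -1"
          hence "sign_comp X (\<lambda>f. - Y f) \<in> ?K 1" "sign_comp X Y \<in> ?K (-1)" unfolding Ks using 1 2 by simp_all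
          thus ?thesis by blast
        qed
      qed
      have wall: "cell A (insert e B) \<sigma> \<noteq> {}" if ne: "?K 1 \<noteq> {}" "?K (-1) \<noteq> {}"
      proof -
        obtain X where X: "X \<in> cell A B \<sigma>" "X e = 1" using ne(1) unfolding Ks by blast
        obtain X' where X': "X' \<in> cell A B \<sigma>" "X' e = -1" using ne(2) unfolding Ks by blast
        obtain Z where Z: "Z \<in> L" "Z e = 0" "\<And>f. X f = 0 \<or> X f \<noteq> - X' f \<Longrightarrow> Z f = sign_comp X X' f"
          using elim[of X X' e] X X' by (auto simp: cell_def)
        have "Z f = \<sigma> f" if "f \<in> A" for f
          using Z(3)[of f] X X' that less.prems(3)[OF that] by (auto simp: cell_def sign_comp_def)
        moreover have "Z f = 0" if "f \<in> B" for f
          using Z(3)[of f] X X' that by (auto simp: cell_def sign_comp_def)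
        ultimately have "Z \<in> cell A (insert e B) \<sigma>" using Z by (auto simp: cell_def)
        thus ?thesis by blast
      qed
      have some: "?K 1 \<noteq> {} \<or> ?K (-1) \<noteq> {}"
      proof (rule ccontr)
        assume no: "\<not> ?thesis"
        hence "cell A (insert e B) \<sigma> = {}" using both by blast
        thus False using no less.prems(4) \<open>cell A B \<sigma> = _\<close> by auto
      qed
      show ?thesis
        unfolding sum using some wall both S[of 1] S[of "-1"] S0
        by (cases "?K 1 = {}"; cases "?K (-1) = {}"; cases "cell A (insert e B) \<sigma> = {}") auto
    qed
  qed
qed

section \<open>Topes, their number and the weighted Euler characteristic\<close>

definition topes :: "('a \<Rightarrow> int) set" where
  "topes = {X \<in> L. \<forall>e\<in>E. X e \<noteq> 0}"

lemma topes_L: "X \<in> topes \<Longrightarrow> X \<in> L" and finite_topes: "finite topes"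
  using finite_L by (auto simp: topes_def)

lemma tope_sign: "X \<in> topes \<Longrightarrow> e \<in> E \<Longrightarrow> X e \<in> {-1, 1}"
  using sign[of X e] by (auto simp: topes_def)

text \<open>Zaslavsky's theorem. By \<open>euler_cell\<close> the factor \<open>(-1) ^ r S\<close> is a sum over the covectors that vanish
  on \<open>S\<close>, and after exchanging the sums only the topes survive.\<close>

lemma card_topes: "int (card topes) = (\<Sum>S\<in>Pow E. (-1) ^ (card S + r S))"
proof -
  have "(\<Sum>S\<in>Pow E. (-1) ^ (card S + r S)) = (\<Sum>S\<in>Pow E. (-1) ^ card S * (\<Sum>X\<in>cell {} S (\<lambda>_. 1). euler_sign X))"
  proof (rule sum.cong[OF refl])
    fix S assume S: "S \<in> Pow E"
    have "(\<lambda>_. 0) \<in> cell {} S (\<lambda>_. 1)" using zero by (auto simp: cell_def)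
    hence "(\<Sum>X\<in>cell {} S (\<lambda>_. 1). euler_sign X) = (-1) ^ r S" using S by (intro euler_cell) auto
    thus "(-1) ^ (card S + r S) = (-1) ^ card S * (\<Sum>X\<in>cell {} S (\<lambda>_. 1). euler_sign X)"
      by (simp add: power_add)
  qed
  also have "\<dots> = (\<Sum>S\<in>Pow E. \<Sum>X\<in>L. if S \<subseteq> zeros X then (-1) ^ card S * euler_sign X else 0)"
  proof (rule sum.cong[OF refl])
    fix S assume S: "S \<in> Pow E"
    have "cell {} S (\<lambda>_. 1) = {X \<in> L. S \<subseteq> zeros X}" using S by (auto simp: cell_def zeros_def)
    thus "(-1) ^ card S * (\<Sum>X\<in>cell {} S (\<lambda>_. 1). euler_sign X) = (\<Sum>X\<in>L. if S \<subseteq> zeros X then (-1) ^ card S * euler_sign X else 0)"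
      using finite_L by (simp add: sum_distrib_left sum.inter_filter if_distrib cong: if_cong)
  qed
  also have "\<dots> = (\<Sum>X\<in>L. \<Sum>S\<in>Pow E. if S \<subseteq> zeros X then (-1) ^ card S * euler_sign X else 0)"
    by (rule sum.swap)
  also have "\<dots> = (\<Sum>X\<in>L. if zeros X = {} then 1 else 0)"
  proof (rule sum.cong[OF refl])
    fix X
    have "{S \<in> Pow E. S \<subseteq> zeros X} = Pow (zeros X)" using zeros_subset by auto
    hence "(\<Sum>S\<in>Pow E. if S \<subseteq> zeros X then (-1) ^ card S * euler_sign X else 0) = (\<Sum>S\<in>Pow (zeros X). (-1) ^ card S) * euler_sign X"
      using finite_E by (simp add: sum.inter_filter[symmetric] sum_distrib_right)
    also have "\<dots> = (if zeros X = {} then 1 else 0)"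
      using alternating_sum_Pow[OF finite_zeros] r_empty by (simp add: euler_sign_def)
    finally show "(\<Sum>S\<in>Pow E. if S \<subseteq> zeros X then (-1) ^ card S * euler_sign X else 0) = (if zeros X = {} then 1 else 0)" .
  qed
  also have "\<dots> = int (card {X \<in> L. zeros X = {}})" using finite_L by (simp add: sum.inter_filter[symmetric])
  also have "{X \<in> L. zeros X = {}} = topes" by (auto simp: topes_def zeros_def)
  finally show ?thesis by simp
qed

text \<open>The covectors that have \<open>X\<close> as a face.\<close>

definition above :: "('a \<Rightarrow> int) \<Rightarrow> ('a \<Rightarrow> int) set" where
  "above X = {Y \<in> L. \<forall>e. X e \<noteq> 0 \<longrightarrow> Y e = X e}"

definition disagree :: "'a set \<Rightarrow> ('a \<Rightarrow> int) \<Rightarrow> ('a \<Rightarrow> int) \<Rightarrow> nat" where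
  "disagree A S Y = card {e \<in> A. Y e \<noteq> S e}"

text \<open>At each zero of \<open>X\<close> the factor is 1 or \<open>q\<close>, that is
  \<open>of_bool (Y e = S e) * (1 - q) + q\<close>; a zero of \<open>Y\<close> counts as a
  disagreement. Expanding over subsets \<open>A\<close>, the covectors above \<open>X\<close> that
  agree with \<open>S\<close> on \<open>A\<close> form an open cell, whose contribution is 1, and
  the remaining sum is a power of \<open>(1 - q) + q\<close>.\<close>

lemma weighted_euler:
  fixes q :: real
  assumes X: "X \<in> L" and S: "S \<in> topes"
  shows "(\<Sum>Y\<in>above X. of_int (euler_sign Y) * q ^ disagree (zeros X) S Y) = 1"
proof -
  have power: "q ^ disagree (zeros X) S Y = (\<Sum>A\<in>Pow (zeros X). if \<forall>e\<in>A. Y e = S e then (1 - q) ^ card A * q ^ (card (zeros X - A)) else 0)" for Y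
  proof -
    have "q ^ disagree (zeros X) S Y = (\<Prod>e\<in>zeros X. of_bool (Y e = S e) * (1 - q) + q)"
    proof -
      have "(\<Prod>e\<in>zeros X. of_bool (Y e = S e) * (1 - q) + q) = (\<Prod>e\<in>zeros X. if Y e \<noteq> S e then q else 1)"
        by (rule prod.cong) auto
      also have "\<dots> = q ^ disagree (zeros X) S Y"
        using finite_zeros[of X] by (simp add: disagree_def prod.If_cases Int_def)
      finally show ?thesis by simp
    qed
    also have "\<dots> = (\<Sum>A\<in>Pow (zeros X). (\<Prod>e\<in>A. of_bool (Y e = S e) * (1 - q)) * (\<Prod>e\<in>zeros X - A. q))"
      by (rule prod_add[OF finite_zeros])
    also have "\<dots> = (\<Sum>A\<in>Pow (zeros X). if \<forall>e\<in>A. Y e = S e then (1 - q) ^ card A * q ^ (card (zeros X - A)) else 0)"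
    proof (rule sum.cong[OF refl])
      fix A assume "A \<in> Pow (zeros X)"
      hence "finite A" using finite_zeros finite_subset by auto
      hence "(\<Prod>e\<in>A. of_bool (Y e = S e) * (1 - q)) = (if \<forall>e\<in>A. Y e = S e then (1 - q) ^ card A else 0)"
        by (auto intro: prod_zero)
      thus "(\<Prod>e\<in>A. of_bool (Y e = S e) * (1 - q)) * (\<Prod>e\<in>zeros X - A. q) =
        (if \<forall>e\<in>A. Y e = S e then (1 - q) ^ card A * q ^ (card (zeros X - A)) else 0)" by simp
    qed
    finally show ?thesis .
  qed
  have fin: "finite (above X)" using finite_L by (simp add: above_def)
  have "(\<Sum>Y\<in>above X. of_int (euler_sign Y) * q ^ disagree (zeros X) S Y) =
    (\<Sum>Y\<in>above X. \<Sum>A\<in>Pow (zeros X). if \<forall>e\<in>A. Y e = S e then (1 - q) ^ card A * q ^ (card (zeros X - A)) * of_int (euler_sign Y) else 0)"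
    unfolding power sum_distrib_left by (intro sum.cong) auto
  also have "\<dots> = (\<Sum>A\<in>Pow (zeros X). \<Sum>Y\<in>above X. if \<forall>e\<in>A. Y e = S e then (1 - q) ^ card A * q ^ (card (zeros X - A)) * of_int (euler_sign Y) else 0)"
    by (rule sum.swap)
  also have "\<dots> = (\<Sum>A\<in>Pow (zeros X). (1 - q) ^ card A * q ^ (card (zeros X - A)))"
  proof (rule sum.cong[OF refl])
    fix A assume A: "A \<in> Pow (zeros X)"
    define \<sigma> where "\<sigma> = sign_comp X S"
    define B where "B = A \<union> (E - zeros X)"
    have eq: "{Y \<in> above X. \<forall>e\<in>A. Y e = S e} = cell B {} \<sigma>"
    proof (intro equalityI subsetI)
      fix Y assume Y: "Y \<in> {Y \<in> above X. \<forall>e\<in>A. Y e = S e}"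
      hence "Y e = \<sigma> e" if "e \<in> B" for e
        using that A unfolding above_def B_def \<sigma>_def sign_comp_def zeros_def by auto
      thus "Y \<in> cell B {} \<sigma>" using Y by (auto simp: cell_def above_def)
    next
      fix Y assume Y: "Y \<in> cell B {} \<sigma>"
      have "Y e = S e" if "e \<in> A" for e using Y that A by (auto simp: cell_def B_def \<sigma>_def sign_comp_def zeros_def)
      moreover have "Y e = X e" if "X e \<noteq> 0" for e
      proof -
        have "e \<in> E" using outside[OF X, of e] that by blast
        thus ?thesis using Y that by (auto simp: cell_def B_def \<sigma>_def sign_comp_def zeros_def)
      qed
      ultimately show "Y \<in> {Y \<in> above X. \<forall>e\<in>A. Y e = S e}" using Y by (auto simp: cell_def above_def)
    qed
    have SL: "S \<in> L" using S topes_L by blast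
    \<comment> \<open>The composition of \<open>X\<close> with \<open>S\<close> witnesses that the
      cell is nonempty, for every \<open>A\<close>.\<close>
    have "\<sigma> \<in> cell B {} \<sigma>" using comp[OF X SL] by (simp add: cell_def \<sigma>_def)
    moreover have BE: "B \<subseteq> E" using A zeros_subset by (auto simp: B_def)
    moreover have "\<sigma> e \<noteq> 0" if "e \<in> B" for e
      using that BE S by (auto simp: \<sigma>_def sign_comp_def topes_def)
    ultimately have "(\<Sum>Y\<in>cell B {} \<sigma>. euler_sign Y) = (-1) ^ r {}" by (intro euler_cell) auto
    hence one: "(\<Sum>Y\<in>cell B {} \<sigma>. of_int (euler_sign Y) :: real) = 1" using r_empty by (simp flip: of_int_sum)
    have "(\<Sum>Y\<in>above X. if \<forall>e\<in>A. Y e = S e then (1 - q) ^ card A * q ^ (card (zeros X - A)) * of_int (euler_sign Y) else 0)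
      = (\<Sum>Y\<in>cell B {} \<sigma>. (1 - q) ^ card A * q ^ (card (zeros X - A)) * of_int (euler_sign Y))"
      unfolding eq[symmetric] using fin by (simp add: sum.inter_filter)
    also have "\<dots> = (1 - q) ^ card A * q ^ (card (zeros X - A))"
      using one by (simp flip: sum_distrib_left)
    finally show "(\<Sum>Y\<in>above X. if \<forall>e\<in>A. Y e = S e then (1 - q) ^ card A * q ^ (card (zeros X - A)) * of_int (euler_sign Y) else 0)
      = (1 - q) ^ card A * q ^ (card (zeros X - A))" .
  qed
  also have "\<dots> = 1"
    using prod_add[of "zeros X" "\<lambda>_. 1 - q" "\<lambda>_. q"] finite_zeros by simp
  finally show ?thesis .
qed

end

section \<open>The linear system of the topes\<close>

text \<open>The power series is the expansion of a rational function without a pole at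
  \<open>q\<close>. Only then does the definite description in \<open>rational_value\<close> denote,
  and sums and products may be evaluated termwise.\<close>

definition regular_at :: "'k::field \<Rightarrow> 'k fps \<Rightarrow> bool" where
  "regular_at q F \<longleftrightarrow> (\<exists>P Q. poly Q q \<noteq> 0 \<and> F * fps_of_poly Q = fps_of_poly P)"

lemma regular_atE:
  assumes "regular_at q F"
  obtains P Q where "poly Q q \<noteq> 0" "F * fps_of_poly Q = fps_of_poly P" "rational_value F q = poly P q / poly Q q"
  using assms rational_value_eqI unfolding regular_at_def by metis

lemma regular_at_poly: "regular_at q (fps_of_poly P)" "rational_value (fps_of_poly P) q = poly P q"
proof -
  have 1: "poly 1 q \<noteq> 0" "fps_of_poly P * fps_of_poly 1 = fps_of_poly P" by simp_all
  show "regular_at q (fps_of_poly P)" unfolding regular_at_def using 1 by blast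
  show "rational_value (fps_of_poly P) q = poly P q" using rational_value_eqI[OF 1] by simp
qed

lemma regular_at_add:
  assumes "regular_at q F" "regular_at q G"
  shows "regular_at q (F + G)" "rational_value (F + G) q = rational_value F q + rational_value G q"
proof -
  obtain P Q where F: "poly Q q \<noteq> 0" "F * fps_of_poly Q = fps_of_poly P" "rational_value F q = poly P q / poly Q q"
    using regular_atE[OF assms(1)] .
  obtain R S where G: "poly S q \<noteq> 0" "G * fps_of_poly S = fps_of_poly R" "rational_value G q = poly R q / poly S q"
    using regular_atE[OF assms(2)] .
  have ne: "poly (Q * S) q \<noteq> 0" using F G by simp
  have "(F + G) * fps_of_poly (Q * S) = (F * fps_of_poly Q) * fps_of_poly S + (G * fps_of_poly S) * fps_of_poly Q"
    by (simp add: fps_of_poly_mult algebra_simps)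
  also have "\<dots> = fps_of_poly (P * S + R * Q)" by (simp add: F G fps_of_poly_mult fps_of_poly_add)
  finally have eq: "(F + G) * fps_of_poly (Q * S) = fps_of_poly (P * S + R * Q)" .
  show "regular_at q (F + G)" using ne eq unfolding regular_at_def by blast
  show "rational_value (F + G) q = rational_value F q + rational_value G q"
    using rational_value_eqI[OF ne eq] F(1) G(1) by (simp add: F(3) G(3) add_frac_eq)
qed

lemma regular_at_mult:
  assumes "regular_at q F" "regular_at q G"
  shows "regular_at q (F * G)" "rational_value (F * G) q = rational_value F q * rational_value G q"
proof -
  obtain P Q where F: "poly Q q \<noteq> 0" "F * fps_of_poly Q = fps_of_poly P" "rational_value F q = poly P q / poly Q q"
    using regular_atE[OF assms(1)] .
  obtain R S where G: "poly S q \<noteq> 0" "G * fps_of_poly S = fps_of_poly R" "rational_value G q = poly R q / poly S q"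
    using regular_atE[OF assms(2)] .
  have ne: "poly (Q * S) q \<noteq> 0" using F G by simp
  have "(F * G) * fps_of_poly (Q * S) = (F * fps_of_poly Q) * (G * fps_of_poly S)"
    by (simp add: fps_of_poly_mult algebra_simps)
  also have "\<dots> = fps_of_poly (P * R)" by (simp add: F G fps_of_poly_mult)
  finally have eq: "(F * G) * fps_of_poly (Q * S) = fps_of_poly (P * R)" .
  show "regular_at q (F * G)" using ne eq unfolding regular_at_def by blast
  show "rational_value (F * G) q = rational_value F q * rational_value G q"
    using rational_value_eqI[OF ne eq] F(1) G(1) by (simp add: F(3) G(3) add_frac_eq)
qed

lemma regular_at_sum:
  assumes "finite A" "\<And>a. a \<in> A \<Longrightarrow> regular_at q (F a)"
  shows "regular_at q (\<Sum>a\<in>A. F a) \<and> rational_value (\<Sum>a\<in>A. F a) q = (\<Sum>a\<in>A. rational_value (F a) q)"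
  using assms
proof (induction A rule: finite_induct)
  case empty
  show ?case using regular_at_poly(1)[of q 0] regular_at_poly(2)[of 0 q] by simp
next
  case (insert a A)
  thus ?case using regular_at_add[of q "F a" "\<Sum>a\<in>A. F a"] by simp
qed

lemma regular_at_div:
  assumes G: "regular_at q G" and eq: "fps_of_poly D * F = G" and ne: "poly D q \<noteq> 0"
  shows "regular_at q F"
proof -
  obtain P Q where PQ: "poly Q q \<noteq> 0" "G * fps_of_poly Q = fps_of_poly P" using regular_atE[OF G] by metis
  have "F * fps_of_poly (D * Q) = fps_of_poly P"
    using PQ(2) unfolding eq[symmetric] by (simp add: fps_of_poly_mult mult_ac)
  moreover have "poly (D * Q) q \<noteq> 0" using PQ ne by simp
  ultimately show ?thesis unfolding regular_at_def by blast
qed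

context covector_system
begin

text \<open>For a tope \<open>T\<close> the cuts grow from the zero vector at \<open>j = 0\<close>
  to \<open>T\<close> itself once \<open>j\<close> exceeds all weights. If all are covectors, they
  form a chain of faces of \<open>T\<close>.\<close>

definition cut :: "('a \<Rightarrow> int) \<Rightarrow> ('a \<Rightarrow> nat) \<Rightarrow> nat \<Rightarrow> 'a \<Rightarrow> int" where
  "cut T w j = (\<lambda>e. if w e < j then T e else 0)"

text \<open>The condition on the cuts says that \<open>T\<close> is a tope of the initial matroid of \<open>w\<close>, see
  \<open>initial_topes\<close> below.\<close>

definition compatible :: "('a \<Rightarrow> int) \<Rightarrow> ('a \<Rightarrow> int) \<Rightarrow> nat \<Rightarrow> ('a \<Rightarrow> nat) set" where
  "compatible X T d = {w \<in> E \<rightarrow>\<^sub>E UNIV. (\<Sum>e\<in>E. w e) = d \<and> (\<forall>e\<in>E. X e \<noteq> 0 \<longrightarrow> w e = 0) \<and> (\<forall>j. cut T w j \<in> L)}"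

text \<open>For the rank of \<open>M\<close> this is \<open>wt M w\<close>, by
  \<open>wt_eq_sum_rank\<close>; the thresholds \<open>c < d\<close> are enough when
  \<open>d\<close> is the total weight.\<close>

definition weight :: "('a \<Rightarrow> nat) \<Rightarrow> nat \<Rightarrow> nat" where
  "weight w d = (\<Sum>c<d. r (upper E w c))"

definition series :: "('a \<Rightarrow> int) \<Rightarrow> ('a \<Rightarrow> int) \<Rightarrow> real fps" where
  "series X T = Abs_fps (\<lambda>d. \<Sum>w\<in>compatible X T d. (-1) ^ weight w d)"

lemma weight_le: "(\<Sum>e\<in>E. w e) = d \<Longrightarrow> e \<in> E \<Longrightarrow> w e \<le> (d :: nat)"
  using member_le_sum[of e E w] finite_E by auto

lemma finite_weights_sum: "finite {w \<in> E \<rightarrow>\<^sub>E UNIV. (\<Sum>e\<in>E. w e) = (d :: nat)}"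
proof (rule finite_subset)
  show "{w \<in> E \<rightarrow>\<^sub>E UNIV. (\<Sum>e\<in>E. w e) = d} \<subseteq> E \<rightarrow>\<^sub>E {..d}"
    using weight_le by (auto simp: PiE_iff extensional_def)
  show "finite (E \<rightarrow>\<^sub>E {..d})" using finite_E by (intro finite_PiE) auto
qed

lemma finite_compatible: "finite (compatible X T d)"
  by (rule finite_subset[OF _ finite_weights_sum[of d]]) (auto simp: compatible_def)

lemma weight_extend:
  assumes "(\<Sum>e\<in>E. w e) = d" "d \<le> N"
  shows "(\<Sum>c<N. r (upper E w c)) = weight w d"
  unfolding weight_def
proof (rule sum.mono_neutral_right)
  show "\<forall>c\<in>{..<N} - {..<d}. r (upper E w c) = 0"
  proof
    fix c assume "c \<in> {..<N} - {..<d}"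
    hence "upper E w c = {}" using weight_le[OF assms(1)] by (fastforce simp: upper_def)
    thus "r (upper E w c) = 0" using r_empty by simp
  qed
qed (use assms in auto)

definition lower_weight :: "('a \<Rightarrow> nat) \<Rightarrow> 'a \<Rightarrow> nat" where
  "lower_weight w = restrict (\<lambda>e. w e - 1) E"

definition raise_weight :: "('a \<Rightarrow> int) \<Rightarrow> ('a \<Rightarrow> nat) \<Rightarrow> 'a \<Rightarrow> nat" where
  "raise_weight Y w = restrict (\<lambda>e. if Y e = 0 then Suc (w e) else 0) E"

lemma cut_cong: "T \<in> L \<Longrightarrow> (\<And>e. e \<in> E \<Longrightarrow> w e < j \<longleftrightarrow> w' e < j') \<Longrightarrow> cut T w j = cut T w' j'"
  using outside[of T] by (fastforce simp: cut_def)

text \<open>\<open>Y\<close> keeps the signs of \<open>T\<close> at the elements of weight 0, so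
  \<open>zeros Y\<close> is the bottom superlevel set. Lowering the positive weights removes it from
  the layer-cake sum and shifts the others down, which explains the summand
  \<open>r (zeros Y)\<close> and the drop of the degree by \<open>card (zeros Y)\<close>.\<close>

lemma compatible_lower:
  assumes T: "T \<in> topes" "T \<in> above X" and X: "X \<in> L"
    and w: "w \<in> compatible X T d" and Y: "cut T w 1 = Y"
  shows "Y \<in> above X" "T \<in> above Y" "card (zeros Y) \<le> d"
    "lower_weight w \<in> compatible Y T (d - card (zeros Y))" "raise_weight Y (lower_weight w) = w"
    "weight w d = r (zeros Y) + weight (lower_weight w) (d - card (zeros Y))"
proof -
  have TL: "T \<in> L" using T topes_L by blast
  have w': "w \<in> E \<rightarrow>\<^sub>E UNIV" "(\<Sum>e\<in>E. w e) = d" "\<And>e. e \<in> E \<Longrightarrow> X e \<noteq> 0 \<Longrightarrow> w e = 0" "\<And>j. cut T w j \<in> L"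
    using w by (auto simp: compatible_def)
  have YL: "Y \<in> L" using w'(4)[of 1] Y by simp
  have Ye: "Y e = (if w e = 0 then T e else 0)" for e using Y by (auto simp: cut_def)
  have Y0: "Y e = 0 \<longleftrightarrow> w e \<noteq> 0" if "e \<in> E" for e using Ye T that by (auto simp: topes_def)
  have "Y e = X e" if "X e \<noteq> 0" for e
    using w'(3)[of e] outside[OF X, of e] that T(2) Ye by (auto simp: above_def)
  thus "Y \<in> above X" using YL by (auto simp: above_def)
  show "T \<in> above Y" using TL Ye by (auto simp: above_def)
  define w1 where "w1 = lower_weight w"
  have w1: "w1 e = w e - 1" if "e \<in> E" for e using that by (simp add: w1_def lower_weight_def)
  have wz: "w e = w1 e + of_bool (e \<in> zeros Y)" if "e \<in> E" for e
    using Y0[OF that] w1[OF that] that by (auto simp: zeros_def)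
  have "(\<Sum>e\<in>E. of_bool (e \<in> zeros Y)) = card (zeros Y)"
    using finite_E by (simp add: Int_def zeros_def)
  hence d: "d = (\<Sum>e\<in>E. w1 e) + card (zeros Y)"
    using w'(2) wz by (simp add: sum.distrib)
  show k: "card (zeros Y) \<le> d" using d by simp
  have cut1: "cut T w1 j \<in> L" for j
  proof (cases j)
    case 0
    thus ?thesis using zero by (simp add: cut_def)
  next
    case (Suc i)
    \<comment> \<open>For positive \<open>j\<close> the truncated subtraction is harmless:
      \<open>w e - 1 < j\<close> is equivalent to \<open>w e < Suc j\<close>. At
      \<open>j = 0\<close> this fails, hence the separate case.\<close>
    have "cut T w1 j = cut T w (Suc j)" by (rule cut_cong[OF TL]) (use w1 Suc in auto)
    thus ?thesis using w'(4) by simp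
  qed
  have dd: "(\<Sum>e\<in>E. w1 e) = d - card (zeros Y)" using d by simp
  have "w1 \<in> compatible Y T (d - card (zeros Y))"
    unfolding compatible_def using dd cut1 w1 Y0 by (auto simp: w1_def lower_weight_def)
  thus "lower_weight w \<in> compatible Y T (d - card (zeros Y))" by (simp add: w1_def)
  show "raise_weight Y (lower_weight w) = w"
  proof
    fix e show "raise_weight Y (lower_weight w) e = w e"
      using w'(1) Y0[of e] by (cases "e \<in> E") (auto simp: raise_weight_def lower_weight_def)
  qed
  have up0: "upper E w 0 = zeros Y" using Y0 by (auto simp: upper_def zeros_def)
  have upS: "upper E w (Suc c) = upper E w1 c" for c using w1 by (auto simp: upper_def)
  have "weight w d = (\<Sum>c<Suc d. r (upper E w c))" using weight_extend[OF w'(2), of "Suc d"] by simp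
  also have "\<dots> = r (upper E w 0) + (\<Sum>c<d. r (upper E w (Suc c)))" by (rule sum.lessThan_Suc_shift)
  also have "\<dots> = r (zeros Y) + (\<Sum>c<d. r (upper E w1 c))" unfolding up0 upS ..
  also have "(\<Sum>c<d. r (upper E w1 c)) = weight w1 (d - card (zeros Y))"
    by (rule weight_extend[OF dd]) simp
  finally show "weight w d = r (zeros Y) + weight (lower_weight w) (d - card (zeros Y))" by (simp add: w1_def)
qed

lemma compatible_raise:
  assumes T: "T \<in> topes" and X: "X \<in> L" and Y: "Y \<in> above X" "T \<in> above Y"
    and w: "w \<in> compatible Y T d"
  shows "raise_weight Y w \<in> compatible X T (d + card (zeros Y))" "cut T (raise_weight Y w) 1 = Y"
    "lower_weight (raise_weight Y w) = w"
proof -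
  have TL: "T \<in> L" using T topes_L by blast
  have YL: "Y \<in> L" using Y by (simp add: above_def)
  have w': "w \<in> E \<rightarrow>\<^sub>E UNIV" "(\<Sum>e\<in>E. w e) = d" "\<And>e. e \<in> E \<Longrightarrow> Y e \<noteq> 0 \<Longrightarrow> w e = 0" "\<And>j. cut T w j \<in> L"
    using w by (auto simp: compatible_def)
  define v where "v = raise_weight Y w"
  have v: "v e = (if Y e = 0 then Suc (w e) else 0)" if "e \<in> E" for e using that by (simp add: v_def raise_weight_def)
  have vE: "v \<in> E \<rightarrow>\<^sub>E UNIV" by (auto simp: v_def raise_weight_def)
  have vw: "v e = w e + of_bool (e \<in> zeros Y)" if "e \<in> E" for e
    using v[OF that] w'(3)[OF that] that by (auto simp: zeros_def)
  have "(\<Sum>e\<in>E. of_bool (e \<in> zeros Y)) = card (zeros Y)"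
    using finite_E by (simp add: Int_def zeros_def)
  hence sum: "(\<Sum>e\<in>E. v e) = d + card (zeros Y)" using w'(2) vw by (simp add: sum.distrib)
  have c1: "cut T v 1 = Y"
  proof
    fix e show "cut T v 1 e = Y e"
      using v[of e] Y(2) outside[OF TL, of e] outside[OF YL, of e] by (cases "e \<in> E") (auto simp: cut_def above_def)
  qed
  thus "cut T (raise_weight Y w) 1 = Y" by (simp add: v_def)
  have "cut T v j \<in> L" for j
  proof -
    consider "j = 0" | "j = 1" | i where "j = Suc (Suc i)" by (metis One_nat_def not0_implies_Suc)
    thus ?thesis
    proof cases
      case 1
      thus ?thesis using zero by (simp add: cut_def)
    next
      case 2
      thus ?thesis using c1 YL by simp
    next
      case 3
      have "cut T v j = cut T w (Suc i)" by (rule cut_cong[OF TL]) (use v w'(3) 3 in auto)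
      thus ?thesis using w'(4) by simp
    qed
  qed
  moreover have "v e = 0" if "e \<in> E" "X e \<noteq> 0" for e using v[of e] that Y(1) by (auto simp: above_def)
  ultimately show "raise_weight Y w \<in> compatible X T (d + card (zeros Y))"
    using vE sum by (auto simp: compatible_def v_def)
  show "lower_weight (raise_weight Y w) = w"
  proof
    fix e show "lower_weight (raise_weight Y w) e = w e"
      using w'(1) w'(3)[of e] by (cases "e \<in> E") (auto simp: raise_weight_def lower_weight_def)
  qed
qed

abbreviation monomial :: "('a \<Rightarrow> int) \<Rightarrow> real poly" where
  "monomial Y \<equiv> monom (of_int (euler_sign Y)) (card (zeros Y))"

text \<open>The summand \<open>Y\<close> collects the weights whose support is the set of zeros of \<open>Y\<close>; subtracting \<open>1\<close> on
  the support leaves a weight compatible with \<open>T\<close> above \<open>Y\<close>.\<close>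

lemma series_recurrence:
  assumes T: "T \<in> topes" "T \<in> above X" and X: "X \<in> L"
  shows "series X T = (\<Sum>Y | Y \<in> above X \<and> T \<in> above Y. fps_of_poly (monomial Y) * series Y T)"
proof (rule fps_ext)
  fix d
  define Ys where "Ys = {Y. Y \<in> above X \<and> T \<in> above Y}"
  have finY: "finite Ys" using finite_L by (auto simp: Ys_def above_def)
  have coeff: "(fps_of_poly (monomial Y) * series Y T) $ d = (\<Sum>w | w \<in> compatible X T d \<and> cut T w 1 = Y. (-1) ^ weight w d)"
    if Y: "Y \<in> Ys" for Y
  proof -
    let ?k = "card (zeros Y)"
    let ?W = "{w. w \<in> compatible X T d \<and> cut T w 1 = Y}"
    have Y': "Y \<in> above X" "T \<in> above Y" using Y by (auto simp: Ys_def)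
    have "(fps_of_poly (monomial Y) * series Y T) $ d = (fps_X ^ ?k * (fps_const (of_int (euler_sign Y)) * series Y T)) $ d"
      by (simp add: fps_of_poly_monom mult_ac)
    also have "\<dots> = (if d < ?k then 0 else of_int (euler_sign Y) * series Y T $ (d - ?k))"
      by (subst fps_X_power_mult_nth) simp
    also have "\<dots> = (\<Sum>w\<in>?W. (-1) ^ weight w d)"
    proof (cases "d < ?k")
      case True
      have "?W = {}" using compatible_lower(3)[OF T X] True by fastforce
      thus ?thesis unfolding \<open>?W = {}\<close> using True by simp
    next
      case False
      have "(\<Sum>w\<in>?W. (-1) ^ weight w d :: real) = (\<Sum>w\<in>compatible Y T (d - ?k). of_int (euler_sign Y) * (-1) ^ weight w (d - ?k))"
      proof (rule sum.reindex_bij_witness[of _ "raise_weight Y" lower_weight])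
        fix w assume w: "w \<in> ?W"
        hence w': "w \<in> compatible X T d" "cut T w 1 = Y" by auto
        note low = compatible_lower[OF T X w']
        show "raise_weight Y (lower_weight w) = w" "lower_weight w \<in> compatible Y T (d - ?k)"
          using low by blast+
        show "of_int (euler_sign Y) * (-1) ^ weight (lower_weight w) (d - ?k) = (-1 :: real) ^ weight w d"
          using low(6) by (simp add: euler_sign_def power_add)
      next
        fix w assume w: "w \<in> compatible Y T (d - ?k)"
        note up = compatible_raise[OF T(1) X Y' w]
        show "lower_weight (raise_weight Y w) = w" "raise_weight Y w \<in> ?W"
          using up False by auto
      qed
      thus ?thesis using False by (simp add: series_def sum_distrib_left)
    qed
    finally show ?thesis .
  qed
  have "series X T $ d = (\<Sum>w\<in>compatible X T d. (-1) ^ weight w d)" by (simp add: series_def)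
  also have "\<dots> = (\<Sum>Y\<in>Ys. \<Sum>w | w \<in> compatible X T d \<and> cut T w 1 = Y. (-1) ^ weight w d)"
    by (rule sum.group[symmetric]) (use finite_compatible finY compatible_lower(1,2)[OF T X] in \<open>auto simp: Ys_def\<close>)
  also have "\<dots> = (\<Sum>Y\<in>Ys. fps_of_poly (monomial Y) * series Y T) $ d"
    using coeff by (simp add: fps_sum_nth)
  finally show "series X T $ d = (\<Sum>Y | Y \<in> above X \<and> T \<in> above Y. fps_of_poly (monomial Y) * series Y T) $ d"
    by (simp add: Ys_def)
qed

lemma series_tope:
  assumes T: "T \<in> topes"
  shows "series T T = 1"
proof (rule fps_ext)
  fix d
  have TL: "T \<in> L" using T topes_L by blast
  define z where "z = restrict (\<lambda>_. 0 :: nat) E"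
  have "cut T z j \<in> L" for j
  proof (cases j)
    case 0
    thus ?thesis using zero by (simp add: cut_def)
  next
    case (Suc i)
    have "cut T z j = T" using outside[OF TL] Suc by (fastforce simp: cut_def z_def)
    thus ?thesis using TL by simp
  qed
  hence z: "z \<in> compatible T T 0" by (auto simp: compatible_def z_def)
  have wz: "w = z \<and> d = 0" if "w \<in> compatible T T d" for w
  proof -
    have w0: "w e = 0" if "e \<in> E" for e using \<open>w \<in> _\<close> that T by (auto simp: compatible_def topes_def)
    have w: "w \<in> extensional E" "(\<Sum>e\<in>E. w e) = d" using that by (auto simp: compatible_def PiE_def)
    have "w e = z e" for e using w0 extensional_arb[OF w(1)] by (simp add: z_def restrict_def)
    thus ?thesis using w w0 by auto
  qed
  have "compatible T T d = (if d = 0 then {z} else {})"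
  proof (cases "d = 0")
    case True
    hence "compatible T T d = {z}" using z wz by blast
    thus ?thesis using True by simp
  next
    case False
    hence "compatible T T d = {}" using wz by blast
    thus ?thesis using False by simp
  qed
  thus "series T T $ d = (1 :: real fps) $ d" by (simp add: series_def weight_def)
qed

lemma zeros_psubset:
  assumes "X \<in> L" "Y \<in> above X" "Y \<noteq> X"
  shows "zeros Y \<subset> zeros X"
proof
  have Y: "Y \<in> L" "\<And>e. X e \<noteq> 0 \<Longrightarrow> Y e = X e" using assms by (auto simp: above_def)
  show "zeros Y \<subseteq> zeros X" using Y(2) by (fastforce simp: zeros_def)
  show "zeros Y \<noteq> zeros X"
  proof
    assume eq: "zeros Y = zeros X"
    have "Y e = X e" for e
    proof (cases "X e = 0")
      case True
      have "e \<notin> zeros X" if "e \<in> E" "Y e \<noteq> 0" using that eq by (auto simp: zeros_def)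
      thus ?thesis using True outside[OF Y(1), of e] by (auto simp: zeros_def)
    qed (rule Y(2))
    thus False using assms(3) by auto
  qed
qed

lemma above_self: "X \<in> L \<Longrightarrow> X \<in> above X" by (simp add: above_def)

lemma above_trans: "Y \<in> above X \<Longrightarrow> Z \<in> above Y \<Longrightarrow> Z \<in> above X"
  by (auto simp: above_def)

lemma finite_above: "finite (above X)" using finite_L by (simp add: above_def)

section \<open>Values of the series at \<open>q\<close> and the tope equations\<close>

context
  fixes q :: real
  assumes q: "-1 < q" "q < 1"
begin

abbreviation "\<alpha> Y \<equiv> of_int (euler_sign Y) * q ^ card (zeros Y)"

lemma alpha_neq_1: "zeros Y \<noteq> {} \<Longrightarrow> \<alpha> Y \<noteq> 1"
proof
  assume "zeros Y \<noteq> {}" and one: "\<alpha> Y = 1"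
  hence "card (zeros Y) \<noteq> 0" using finite_zeros by simp
  hence "\<bar>q\<bar> ^ card (zeros Y) < 1" using q by (intro power_less_one_iff[THEN iffD2]) auto
  moreover have "\<bar>\<alpha> Y\<bar> = \<bar>q\<bar> ^ card (zeros Y)" by (simp add: euler_sign_def abs_mult power_abs)
  ultimately show False using one by simp
qed

text \<open>The summand \<open>Y = X\<close> of the recurrence contains \<open>series X T\<close>
  itself; moved to the left it produces the factor \<open>1 - monomial X\<close>, the denominator in
  the induction.\<close>

lemma series_split:
  assumes T: "T \<in> topes" "T \<in> above X" and X: "X \<in> L"
  shows "fps_of_poly (1 - monomial X) * series X T =
    (\<Sum>Y | Y \<in> above X \<and> T \<in> above Y \<and> Y \<noteq> X. fps_of_poly (monomial Y) * series Y T)"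
proof -
  have "series X T = fps_of_poly (monomial X) * series X T + (\<Sum>Y\<in>{Y. Y \<in> above X \<and> T \<in> above Y} - {X}. fps_of_poly (monomial Y) * series Y T)"
    using series_recurrence[OF T X] sum.remove[of "{Y. Y \<in> above X \<and> T \<in> above Y}" X "\<lambda>Y. fps_of_poly (monomial Y) * series Y T"]
      finite_above[of X] above_self[OF X] T by simp
  moreover have "{Y. Y \<in> above X \<and> T \<in> above Y} - {X} = {Y. Y \<in> above X \<and> T \<in> above Y \<and> Y \<noteq> X}" by auto
  ultimately show ?thesis by (simp add: fps_of_poly_diff algebra_simps)
qed

lemma regular_series:
  assumes "T \<in> topes" "T \<in> above X" "X \<in> L"
  shows "regular_at q (series X T)"
  using assms
proof (induction "card (zeros X)" arbitrary: X rule: less_induct)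
  case (less X)
  note T = less.prems(1,2) and X = less.prems(3)
  show ?case
  proof (cases "zeros X = {}")
    case True
    hence "T = X" using zeros_psubset[OF X T(2)] by auto
    thus ?thesis using series_tope[OF T(1)] regular_at_poly(1)[of q 1] by simp
  next
    case False
    have reg: "regular_at q (\<Sum>Y | Y \<in> above X \<and> T \<in> above Y \<and> Y \<noteq> X. fps_of_poly (monomial Y) * series Y T)"
    proof (rule regular_at_sum[THEN conjunct1])
      show "finite {Y. Y \<in> above X \<and> T \<in> above Y \<and> Y \<noteq> X}" using finite_above[of X] by simp
      fix Y assume Y: "Y \<in> {Y. Y \<in> above X \<and> T \<in> above Y \<and> Y \<noteq> X}"
      have "card (zeros Y) < card (zeros X)"
        using Y by (intro psubset_card_mono finite_zeros zeros_psubset[OF X]) auto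
      hence "regular_at q (series Y T)" using Y T by (intro less.hyps) (auto simp: above_def)
      thus "regular_at q (fps_of_poly (monomial Y) * series Y T)" by (intro regular_at_mult regular_at_poly)
    qed
    have "poly (1 - monomial X) q \<noteq> 0" using alpha_neq_1[OF False] by (simp add: poly_monom)
    thus ?thesis by (rule regular_at_div[OF reg series_split[OF T X]])
  qed
qed

abbreviation "val X T \<equiv> rational_value (series X T) q"

lemma val_recurrence:
  assumes T: "T \<in> topes" "T \<in> above X" and X: "X \<in> L"
  shows "(1 - \<alpha> X) * val X T = (\<Sum>Y | Y \<in> above X \<and> T \<in> above Y \<and> Y \<noteq> X. \<alpha> Y * val Y T)"
proof -
  have reg: "regular_at q (series Y T)" if "Y \<in> above X \<and> T \<in> above Y" for Y
    using that T by (intro regular_series) (auto simp: above_def)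
  have "(1 - \<alpha> X) * val X T = rational_value (fps_of_poly (1 - monomial X) * series X T) q"
    using regular_at_mult(2)[OF regular_at_poly(1) regular_series[OF T X], of "1 - monomial X"]
      regular_at_poly(2)[of "1 - monomial X" q] by (simp add: poly_monom)
  also have "\<dots> = rational_value (\<Sum>Y | Y \<in> above X \<and> T \<in> above Y \<and> Y \<noteq> X. fps_of_poly (monomial Y) * series Y T) q"
    unfolding series_split[OF T X] ..
  also have "\<dots> = (\<Sum>Y | Y \<in> above X \<and> T \<in> above Y \<and> Y \<noteq> X. rational_value (fps_of_poly (monomial Y) * series Y T) q)"
  proof (rule regular_at_sum[THEN conjunct2])
    show "finite {Y. Y \<in> above X \<and> T \<in> above Y \<and> Y \<noteq> X}" using finite_above[of X] by simp
  qed (use reg in \<open>auto intro!: regular_at_mult regular_at_poly\<close>)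
  also have "\<dots> = (\<Sum>Y | Y \<in> above X \<and> T \<in> above Y \<and> Y \<noteq> X. \<alpha> Y * val Y T)"
  proof (rule sum.cong[OF refl])
    fix Y assume "Y \<in> {Y. Y \<in> above X \<and> T \<in> above Y \<and> Y \<noteq> X}"
    hence "regular_at q (series Y T)" using reg by simp
    thus "rational_value (fps_of_poly (monomial Y) * series Y T) q = \<alpha> Y * val Y T"
      using regular_at_mult(2)[OF regular_at_poly(1), of q "series Y T" "monomial Y"] regular_at_poly(2)[of "monomial Y" q]
      by (simp add: poly_monom)
  qed
  finally show ?thesis .
qed

text \<open>\<open>T\<close> agrees with \<open>Y\<close> off \<open>zeros Y\<close>, and every zero
  of \<open>Y\<close> counts as a disagreement with the tope \<open>S\<close>. The distances
  therefore split along \<open>zeros Y\<close>.\<close>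

lemma disagree_split:
  assumes X: "X \<in> L" and Y: "Y \<in> above X" and T: "T \<in> above Y" and S: "S \<in> topes"
  shows "card (zeros Y) + disagree (zeros X - zeros Y) S T = disagree (zeros X) S Y"
    "disagree (zeros X) S T = disagree (zeros X - zeros Y) S T + disagree (zeros Y) S T"
proof -
  have sub: "zeros Y \<subseteq> zeros X" using Y by (fastforce simp: zeros_def above_def)
  have TY: "T e = Y e" if "e \<in> E - zeros Y" for e using T that by (auto simp: above_def zeros_def)
  have "{e \<in> zeros X. Y e \<noteq> S e} = zeros Y \<union> {e \<in> zeros X - zeros Y. T e \<noteq> S e}"
    using sub TY S zeros_subset[of X] by (auto simp: zeros_def topes_def)
  moreover have "zeros Y \<inter> {e \<in> zeros X - zeros Y. T e \<noteq> S e} = {}" by auto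
  ultimately show "card (zeros Y) + disagree (zeros X - zeros Y) S T = disagree (zeros X) S Y"
    unfolding disagree_def using finite_zeros by (simp add: card_Un_disjoint)
  have "{e \<in> zeros X. T e \<noteq> S e} = {e \<in> zeros X - zeros Y. T e \<noteq> S e} \<union> {e \<in> zeros Y. T e \<noteq> S e}"
    using sub by auto
  moreover have "{e \<in> zeros X - zeros Y. T e \<noteq> S e} \<inter> {e \<in> zeros Y. T e \<noteq> S e} = {}" by auto
  ultimately show "disagree (zeros X) S T = disagree (zeros X - zeros Y) S T + disagree (zeros Y) S T"
    unfolding disagree_def using finite_zeros by (simp add: card_Un_disjoint)
qed

text \<open>Multiply by \<open>1 - \<alpha> X\<close>, insert the recurrence and exchange the sums.
  By \<open>disagree_split\<close> the inner sum over the topes above \<open>Y\<close> is an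
  instance of the claim for the smaller set \<open>zeros Y\<close>, so it is 1. What remains is the
  weighted Euler characteristic above \<open>X\<close> without its term at \<open>X\<close>.\<close>

lemma tope_equation_above:
  assumes S: "S \<in> topes" and "X \<in> L"
  shows "(\<Sum>T\<in>topes \<inter> above X. q ^ disagree (zeros X) S T * val X T) = 1"
  using assms(2)
proof (induction "card (zeros X)" arbitrary: X rule: less_induct)
  case (less X)
  note X = less.prems
  show ?case
  proof (cases "zeros X = {}")
    case True
    hence XT: "X \<in> topes" using X by (auto simp: topes_def zeros_def)
    have "topes \<inter> above X = {X}" using zeros_psubset[OF X] above_self[OF X] XT True by blast
    thus ?thesis using True series_tope[OF XT] regular_at_poly(2)[of 1 q] by (simp add: disagree_def)
  next
    case False
    let ?R = "\<lambda>Y T. Y \<in> above X \<and> T \<in> above Y \<and> Y \<noteq> X"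
    have IH: "(\<Sum>T\<in>topes \<inter> above Y. q ^ disagree (zeros Y) S T * val Y T) = 1" if "Y \<in> above X - {X}" for Y
    proof (rule less.hyps)
      show "card (zeros Y) < card (zeros X)" using that X by (intro psubset_card_mono finite_zeros zeros_psubset) auto
    qed (use that in \<open>auto simp: above_def\<close>)
    have "(1 - \<alpha> X) * (\<Sum>T\<in>topes \<inter> above X. q ^ disagree (zeros X) S T * val X T) =
      (\<Sum>T\<in>topes \<inter> above X. q ^ disagree (zeros X) S T * ((1 - \<alpha> X) * val X T))"
      by (simp add: sum_distrib_left mult_ac)
    also have "\<dots> = (\<Sum>T\<in>topes \<inter> above X. \<Sum>Y\<in>above X - {X}. if T \<in> above Y then q ^ disagree (zeros X) S T * (\<alpha> Y * val Y T) else 0)"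
    proof (rule sum.cong[OF refl])
      fix T assume T: "T \<in> topes \<inter> above X"
      have "(\<Sum>Y | ?R Y T. \<alpha> Y * val Y T) = (\<Sum>Y\<in>{Y \<in> above X - {X}. T \<in> above Y}. \<alpha> Y * val Y T)"
        by (rule sum.cong) auto
      also have "\<dots> = (\<Sum>Y\<in>above X - {X}. if T \<in> above Y then \<alpha> Y * val Y T else 0)"
        by (rule sum.inter_filter) (simp add: finite_above)
      finally have "(\<Sum>Y | ?R Y T. \<alpha> Y * val Y T) = (\<Sum>Y\<in>above X - {X}. if T \<in> above Y then \<alpha> Y * val Y T else 0)" .
      thus "q ^ disagree (zeros X) S T * ((1 - \<alpha> X) * val X T) =
        (\<Sum>Y\<in>above X - {X}. if T \<in> above Y then q ^ disagree (zeros X) S T * (\<alpha> Y * val Y T) else 0)"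
        using val_recurrence[of T X] T X by (simp add: sum_distrib_left if_distrib cong: if_cong)
    qed
    also have "\<dots> = (\<Sum>Y\<in>above X - {X}. \<Sum>T\<in>topes \<inter> above X. if T \<in> above Y then q ^ disagree (zeros X) S T * (\<alpha> Y * val Y T) else 0)"
      by (rule sum.swap)
    also have "\<dots> = (\<Sum>Y\<in>above X - {X}. of_int (euler_sign Y) * q ^ disagree (zeros X) S Y)"
    proof (rule sum.cong[OF refl])
      fix Y assume Y: "Y \<in> above X - {X}"
      have eq: "{T \<in> topes \<inter> above X. T \<in> above Y} = topes \<inter> above Y"
        using above_trans[of Y X] Y by blast
      have "(\<Sum>T\<in>topes \<inter> above X. if T \<in> above Y then q ^ disagree (zeros X) S T * (\<alpha> Y * val Y T) else 0)
        = (\<Sum>T\<in>topes \<inter> above Y. q ^ disagree (zeros X) S T * (\<alpha> Y * val Y T))"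
        unfolding eq[symmetric] using finite_topes by (subst sum.inter_filter) auto
      also have "\<dots> = (\<Sum>T\<in>topes \<inter> above Y. of_int (euler_sign Y) * q ^ disagree (zeros X) S Y * (q ^ disagree (zeros Y) S T * val Y T))"
      proof (rule sum.cong[OF refl])
        fix T assume T: "T \<in> topes \<inter> above Y"
        have "q ^ disagree (zeros X) S T * q ^ card (zeros Y) = q ^ disagree (zeros X) S Y * q ^ disagree (zeros Y) S T"
        proof -
          have "disagree (zeros X) S T + card (zeros Y) = disagree (zeros X) S Y + disagree (zeros Y) S T"
            using disagree_split[of X Y T S] X Y T S by auto
          thus ?thesis by (simp flip: power_add)
        qed
        thus "q ^ disagree (zeros X) S T * (\<alpha> Y * val Y T) =
          of_int (euler_sign Y) * q ^ disagree (zeros X) S Y * (q ^ disagree (zeros Y) S T * val Y T)"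
          by (simp add: mult_ac)
      qed
      also have "\<dots> = of_int (euler_sign Y) * q ^ disagree (zeros X) S Y"
        using IH[OF Y] by (simp flip: sum_distrib_left)
      finally show "(\<Sum>T\<in>topes \<inter> above X. if T \<in> above Y then q ^ disagree (zeros X) S T * (\<alpha> Y * val Y T) else 0) =
        of_int (euler_sign Y) * q ^ disagree (zeros X) S Y" .
    qed
    also have "\<dots> = 1 - \<alpha> X"
    proof -
      \<comment> \<open>\<open>X\<close> disagrees with \<open>S\<close> at each of its zeros, so
        the omitted term of \<open>weighted_euler\<close> is exactly
        \<open>\<alpha> X\<close>.\<close>
      have "disagree (zeros X) S X = card (zeros X)"
        unfolding disagree_def using S zeros_subset[of X] by (intro arg_cong[of _ _ card]) (auto simp: topes_def zeros_def)
      moreover have "(\<Sum>Y\<in>above X. of_int (euler_sign Y) * q ^ disagree (zeros X) S Y) =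
        of_int (euler_sign X) * q ^ disagree (zeros X) S X + (\<Sum>Y\<in>above X - {X}. of_int (euler_sign Y) * q ^ disagree (zeros X) S Y)"
        by (rule sum.remove[OF finite_above above_self[OF X]])
      ultimately show ?thesis using weighted_euler[OF X S, of q] by simp
    qed
    finally show ?thesis using alpha_neq_1[OF False] by simp
  qed
qed

lemma tope_equation:
  assumes "S \<in> topes"
  shows "(\<Sum>T\<in>topes. q ^ disagree E S T * val (\<lambda>_. 0) T) = 1"
proof -
  have "topes \<inter> above (\<lambda>_. 0) = topes" by (auto simp: topes_def above_def)
  moreover have "zeros (\<lambda>_. 0) = E" by (simp add: zeros_def)
  ultimately show ?thesis using tope_equation_above[OF assms zero] by simp
qed

end

end

section \<open>Isometric cycles of topes\<close>

text \<open>In a cycle of length \<open>2 * n\<close> the vertex \<open>j\<close> and its antipode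
  have distances \<open>|i - j|\<close> and \<open>n - |i - j|\<close> from \<open>i\<close>. Moving
  \<open>i\<close> by one step only permutes them, and for \<open>i = 0\<close> the sum is
  \<open>1 + 2 * q + ... + 2 * q ^ (n - 1) + q ^ n\<close>.\<close>

lemma cycle_row_sum:
  fixes q :: real
  assumes "i < n"
  shows "(\<Sum>j<n. q ^ nat \<bar>int i - int j\<bar> + q ^ (n - nat \<bar>int i - int j\<bar>)) = (1 + q) * (\<Sum>k<n. q ^ k)"
  using assms
proof (induction i)
  case 0
  have "(\<Sum>j<n. q ^ (n - j)) = (\<Sum>j<n. q * q ^ j)"
  proof -
    have "(\<Sum>j<n. q ^ (n - j)) = (\<Sum>j<n. q ^ (n - (n - Suc j)))"
      by (rule sum.nat_diff_reindex[symmetric])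
    also have "\<dots> = (\<Sum>j<n. q * q ^ j)"
    proof (rule sum.cong[OF refl])
      fix j assume "j \<in> {..<n}"
      hence "n - (n - Suc j) = Suc j" by auto
      thus "q ^ (n - (n - Suc j)) = q * q ^ j" by simp
    qed
    finally show ?thesis .
  qed
  thus ?case by (simp add: sum.distrib algebra_simps sum_distrib_left)
next
  case (Suc i)
  define h where "h i j = q ^ nat \<bar>int i - int j\<bar> + q ^ (n - nat \<bar>int i - int j\<bar>)" for i j
  obtain m where m: "n = Suc m" using Suc.prems by (cases n) auto
  \<comment> \<open>When \<open>i\<close> and \<open>j\<close> are shifted together, the pair lost
    at the end of the range returns at its beginning with vertex and antipode exchanged.\<close>
  have ends: "h (Suc i) 0 = h i m"
  proof -
    have d: "nat \<bar>int (Suc i) - int 0\<bar> = Suc i" "nat \<bar>int i - int m\<bar> = m - i"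
      "n - Suc i = m - i" "n - (m - i) = Suc i" using Suc.prems m by auto
    show ?thesis unfolding h_def d by simp
  qed
  have "(\<Sum>j<n. h (Suc i) j) = h (Suc i) 0 + (\<Sum>j<m. h (Suc i) (Suc j))"
    unfolding m by (rule sum.lessThan_Suc_shift)
  also have "(\<Sum>j<m. h (Suc i) (Suc j)) = (\<Sum>j<m. h i j)" by (simp add: h_def)
  also have "h (Suc i) 0 + (\<Sum>j<m. h i j) = (\<Sum>j<n. h i j)" using ends m by simp
  finally show ?case using Suc by (simp add: h_def)
qed

text \<open>For negative \<open>q\<close> the geometric sum is positive because multiplied by
  \<open>1 - q\<close> it gives \<open>1 - q ^ n\<close>. The second inequality is the reason why
  the bound exceeds 1.\<close>

lemma cycle_bound:
  fixes q :: real
  assumes q: "-1 < q" "q < 1" and n: "n > 0"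
  shows "0 < (1 + q) * (\<Sum>k<n. q ^ k)" "(1 + q) * (\<Sum>k<n. q ^ k) < 2 * real n"
    "2 * real n * (1 - q) / ((1 + q) * (1 - q ^ n)) = 2 * real n / ((1 + q) * (\<Sum>k<n. q ^ k))"
proof -
  have geo: "(1 - q) * (\<Sum>k<n. q ^ k) = 1 - q ^ n"
    using sum_gp_strict[of q n] q by simp
  have "\<bar>q\<bar> ^ n < 1" using q n by (intro power_less_one_iff[THEN iffD2]) auto
  hence "\<bar>q ^ n\<bar> < 1" by (simp add: power_abs)
  hence "q ^ n < 1" by (rule abs_less_iff[THEN iffD1, THEN conjunct1])
  hence "0 < (1 - q) * (\<Sum>k<n. q ^ k)" using geo by simp
  hence pos: "0 < (\<Sum>k<n. q ^ k)" using q by (simp add: zero_less_mult_iff)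
  thus "0 < (1 + q) * (\<Sum>k<n. q ^ k)" using q by simp
  have "(\<Sum>k<n. q ^ k) \<le> (\<Sum>k<n. 1)"
  proof (rule sum_mono)
    fix k
    have "\<bar>q ^ k\<bar> \<le> 1" using q by (simp add: power_abs power_le_one)
    thus "q ^ k \<le> 1" by simp
  qed
  hence "(\<Sum>k<n. q ^ k) \<le> real n" by simp
  moreover have "(1 + q) * (\<Sum>k<n. q ^ k) < 2 * (\<Sum>k<n. q ^ k)" using pos q by (intro mult_strict_right_mono) auto
  ultimately show "(1 + q) * (\<Sum>k<n. q ^ k) < 2 * real n" by linarith
  show "2 * real n * (1 - q) / ((1 + q) * (1 - q ^ n)) = 2 * real n / ((1 + q) * (\<Sum>k<n. q ^ k))"
    unfolding geo[symmetric] using q by simp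
qed

section \<open>The quadratic form of the tope metric; flips and opposites\<close>

context covector_system
begin

text \<open>For signs \<open>a\<close>, \<open>b\<close> one has \<open>q ^ of_bool (a \<noteq> b) = (1 + q) / 2 + (1 - q) / 2 * (a * b)\<close>; expanding the
  product over \<open>E\<close> exhibits the quadratic form as a sum of squares.\<close>

lemma tope_form_nonneg:
  fixes q :: real and y :: "('a \<Rightarrow> int) \<Rightarrow> real"
  assumes q: "-1 \<le> q" "q \<le> 1"
  shows "0 \<le> (\<Sum>S\<in>topes. \<Sum>T\<in>topes. y S * y T * q ^ disagree E S T)"
proof -
  define a b where "a = (1 + q) / 2" and "b = (1 - q) / 2"
  define c where "c A = b ^ card A * a ^ card (E - A)" for A
  define p where "p A S = (\<Prod>e\<in>A. of_int (S e) :: real)" for A and S :: "'a \<Rightarrow> int"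
  have "q ^ disagree E S T = (\<Sum>A\<in>Pow E. c A * (p A S * p A T))" if S: "S \<in> topes" and T: "T \<in> topes" for S T
  proof -
    have "q ^ disagree E S T = (\<Prod>e\<in>E. if T e \<noteq> S e then q else 1)"
      using finite_E by (simp add: disagree_def prod.If_cases Int_def)
    also have "\<dots> = (\<Prod>e\<in>E. b * (of_int (S e) * of_int (T e)) + a)"
    proof (rule prod.cong[OF refl])
      fix e assume "e \<in> E"
      hence "S e \<in> {-1, 1}" "T e \<in> {-1, 1}" using S T tope_sign by blast+
      thus "(if T e \<noteq> S e then q else 1) = b * (of_int (S e) * of_int (T e)) + a"
        by (auto simp: a_def b_def field_simps)
    qed
    also have "\<dots> = (\<Sum>A\<in>Pow E. (\<Prod>e\<in>A. b * (of_int (S e) * of_int (T e))) * (\<Prod>e\<in>E - A. a))"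
      by (rule prod_add[OF finite_E])
    also have "\<dots> = (\<Sum>A\<in>Pow E. c A * (p A S * p A T))"
      by (simp add: c_def p_def prod.distrib mult_ac)
    finally show ?thesis .
  qed
  hence "(\<Sum>S\<in>topes. \<Sum>T\<in>topes. y S * y T * q ^ disagree E S T) =
    (\<Sum>S\<in>topes. \<Sum>T\<in>topes. \<Sum>A\<in>Pow E. c A * ((y S * p A S) * (y T * p A T)))"
    by (intro sum.cong) (auto simp: sum_distrib_left mult_ac)
  also have "\<dots> = (\<Sum>S\<in>topes. \<Sum>A\<in>Pow E. \<Sum>T\<in>topes. c A * ((y S * p A S) * (y T * p A T)))"
    by (intro sum.cong refl sum.swap)
  also have "\<dots> = (\<Sum>A\<in>Pow E. \<Sum>S\<in>topes. \<Sum>T\<in>topes. c A * ((y S * p A S) * (y T * p A T)))"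
    by (rule sum.swap)
  also have "\<dots> = (\<Sum>A\<in>Pow E. c A * (\<Sum>S\<in>topes. y S * p A S)\<^sup>2)"
  proof (rule sum.cong[OF refl])
    fix A
    show "(\<Sum>S\<in>topes. \<Sum>T\<in>topes. c A * ((y S * p A S) * (y T * p A T))) = c A * (\<Sum>S\<in>topes. y S * p A S)\<^sup>2"
      unfolding power2_eq_square sum_product by (simp add: sum_distrib_left)
  qed
  also have "\<dots> \<ge> 0"
    using q by (intro sum_nonneg mult_nonneg_nonneg) (auto simp: c_def a_def b_def)
  finally show ?thesis .
qed

lemma tope_comp: "X \<in> L \<Longrightarrow> T \<in> topes \<Longrightarrow> sign_comp X T \<in> topes"
  using comp[of X T] by (auto simp: topes_def sign_comp_def)

lemma tope_outside: "T \<in> topes \<Longrightarrow> e \<notin> E \<Longrightarrow> T e = 0"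
  using outside topes_L by blast

lemma tope_eqI: "S \<in> topes \<Longrightarrow> T \<in> topes \<Longrightarrow> (\<And>e. e \<in> E \<Longrightarrow> S e = T e) \<Longrightarrow> S = T"
  using tope_outside by (metis ext)

definition flip :: "('a \<Rightarrow> int) \<Rightarrow> 'a set \<Rightarrow> 'a \<Rightarrow> int" where
  "flip T A = (\<lambda>e. if e \<in> A then - T e else T e)"

lemma disagree_flip:
  assumes "T \<in> topes" "A \<subseteq> E" "B \<subseteq> E"
  shows "disagree E (flip T A) (flip T B) = card ((A - B) \<union> (B - A))"
proof -
  have "{e \<in> E. flip T B e \<noteq> flip T A e} = (A - B) \<union> (B - A)"
    using assms by (auto simp: flip_def topes_def)
  thus ?thesis by (simp add: disagree_def)
qed

lemma flip_inj:
  assumes "T \<in> topes" "A \<subseteq> E" "B \<subseteq> E" "flip T A = flip T B"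
  shows "A = B"
proof -
  have "disagree E (flip T A) (flip T B) = 0" using assms(4) by (simp add: disagree_def)
  moreover have "finite A" "finite B" using assms finite_E finite_subset by blast+
  ultimately have "(A - B) \<union> (B - A) = {}" using disagree_flip[OF assms(1-3)] by simp
  thus ?thesis by blast
qed

lemma uminus_flip: "A \<subseteq> E \<Longrightarrow> T \<in> topes \<Longrightarrow> (\<lambda>e. - flip T A e) = flip T (E - A)"
  using tope_outside[of T] by (fastforce simp: flip_def)

lemma uminus_tope: "T \<in> topes \<Longrightarrow> (\<lambda>e. - T e) \<in> topes"
  using minus by (auto simp: topes_def)

lemma disagree_uminus:
  assumes S: "S \<in> topes" and T: "T \<in> topes"
  shows "disagree E S (\<lambda>e. - T e) = card E - disagree E S T" "disagree E (\<lambda>e. - S e) T = card E - disagree E S T"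
    "disagree E S T \<le> card E"
proof -
  have "{e \<in> E. - T e \<noteq> S e} = E - {e \<in> E. T e \<noteq> S e}" "{e \<in> E. T e \<noteq> - S e} = E - {e \<in> E. T e \<noteq> S e}"
    using tope_sign[OF S] tope_sign[OF T] by fastforce+
  thus "disagree E S (\<lambda>e. - T e) = card E - disagree E S T" "disagree E (\<lambda>e. - S e) T = card E - disagree E S T"
    using finite_E by (simp_all add: disagree_def card_Diff_subset)
  show "disagree E S T \<le> card E" using finite_E by (auto simp: disagree_def intro: card_mono)
qed

end

section \<open>Galleries and cycles in simple systems\<close>

locale simple_covector_system = covector_system +
  assumes rank_1: "e \<in> E \<Longrightarrow> r {e} = 1"
    and rank_2: "e \<in> E \<Longrightarrow> f \<in> E \<Longrightarrow> e \<noteq> f \<Longrightarrow> r {e, f} = 2"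
begin

lemma nonzero_at:
  assumes e: "e \<in> E"
  shows "\<exists>X \<in> L. X e \<noteq> 0"
proof (rule ccontr)
  assume "\<not> ?thesis"
  hence "\<forall>X\<in>L. (\<forall>f\<in>{}. X f = 0) \<longrightarrow> X e = 0" by blast
  hence "r {e} = r {}" using r_insert[of "{}" e] e by simp
  thus False using rank_1[OF e] r_empty by simp
qed

lemma separate:
  assumes e: "e \<in> E" and f: "f \<in> E" and ne: "e \<noteq> f"
  shows "\<exists>X \<in> L. X e = 0 \<and> X f \<noteq> 0"
proof (rule ccontr)
  assume "\<not> ?thesis"
  hence "\<forall>X\<in>L. (\<forall>g\<in>{e}. X g = 0) \<longrightarrow> X f = 0" by blast
  hence "r {f, e} = r {e}" using r_insert[of "{e}" f] e f ne by simp
  thus False using rank_1[OF e] rank_2[OF f e] ne by simp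
qed

lemma topes_nonempty: "topes \<noteq> {}"
proof -
  have "\<exists>X \<in> L. \<forall>e\<in>G. X e \<noteq> 0" if "finite G" "G \<subseteq> E" for G
    using that
  proof (induction G rule: finite_induct)
    case empty
    thus ?case using zero by blast
  next
    case (insert e G)
    then obtain X where X: "X \<in> L" "\<And>e. e \<in> G \<Longrightarrow> X e \<noteq> 0" by blast
    obtain Y where Y: "Y \<in> L" "Y e \<noteq> 0" using nonzero_at insert.prems by blast
    show ?case using comp[OF X(1) Y(1)] X(2) Y(2) by (intro bexI[of _ "sign_comp X Y"]) (auto simp: sign_comp_def)
  qed
  from this[OF finite_E] show ?thesis by (auto simp: topes_def)
qed

text \<open>Choose \<open>V\<close> with fewest elements separating it from \<open>T\<close>, all of
  them separating \<open>S\<close> from \<open>T\<close>. Eliminate one of these, \<open>e\<close>,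
  between \<open>T\<close> and \<open>V\<close>; by minimality the result \<open>Z\<close> vanishes
  on the whole separation set \<open>D V\<close> and equals \<open>T\<close> elsewhere in
  \<open>E\<close>. For a second element \<open>f\<close> of \<open>D V\<close>, simplicity gives a
  covector that vanishes at \<open>e\<close> and is opposite to \<open>T\<close> at
  \<open>f\<close>; composing \<open>Z\<close> with it and with \<open>T\<close> yields a tope
  closer to \<open>T\<close>, a contradiction.\<close>

lemma adjacent_tope:
  assumes T: "T \<in> topes" and S: "S \<in> topes" and ne: "T \<noteq> S"
  shows "\<exists>e \<in> E. T e \<noteq> S e \<and> flip T {e} \<in> topes"
proof -
  define D where "D V = {e \<in> E. T e \<noteq> V e}" for V
  have finD: "finite (D V)" for V using finite_E by (simp add: D_def)
  define P where "P V \<longleftrightarrow> V \<in> topes \<and> V \<noteq> T \<and> D V \<subseteq> D S" for V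
  have "P S" using S ne by (auto simp: P_def)
  then obtain V where V: "P V" and min: "\<And>W. P W \<Longrightarrow> card (D V) \<le> card (D W)"
    using ex_has_least_nat[of P S "\<lambda>V. card (D V)"] by blast
  have Vt: "V \<in> topes" "V \<noteq> T" "D V \<subseteq> D S" using V by (auto simp: P_def)
  obtain e where e: "e \<in> E" "T e \<noteq> V e" using tope_eqI[OF T Vt(1)] Vt(2) by metis
  have small: "W = T" if "W \<in> topes" "D W \<subset> D V" for W
  proof (rule ccontr)
    assume "W \<noteq> T"
    hence "P W" using that Vt by (auto simp: P_def)
    thus False using min[of W] psubset_card_mono[OF finD that(2)] by simp
  qed
  have opp: "V g = - T g" if "g \<in> E" "T g \<noteq> V g" for g
    using tope_sign[OF T that(1)] tope_sign[OF Vt(1) that(1)] that(2) by auto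
  obtain Z where Z: "Z \<in> L" "Z e = 0" "\<And>f. T f = 0 \<or> T f \<noteq> - V f \<Longrightarrow> Z f = sign_comp T V f"
  proof -
    have "T e = - V e" "T e \<noteq> 0" using opp[OF e] tope_sign[OF T e(1)] by auto
    from elim[OF topes_L[OF T] topes_L[OF Vt(1)] this] show thesis using that by blast
  qed
  have Zoff: "Z f = T f" if "f \<in> E" "f \<notin> D V" for f
    using Z(3)[of f] tope_sign[OF T that(1)] that by (auto simp: D_def sign_comp_def)
  have "sign_comp Z T = T"
  proof (rule small[OF tope_comp[OF Z(1) T]])
    have "e \<in> D V" "e \<notin> D (sign_comp Z T)" using e Z(2) by (auto simp: D_def sign_comp_def)
    moreover have "D (sign_comp Z T) \<subseteq> D V" using Zoff by (auto simp: D_def sign_comp_def)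
    ultimately show "D (sign_comp Z T) \<subset> D V" by blast
  qed
  hence ZT: "Z f = 0 \<or> Z f = T f" for f by (metis sign_comp_def)
  have Zon: "Z f = 0" if f: "f \<in> D V" for f
  proof (rule ccontr)
    assume "Z f \<noteq> 0"
    hence "f \<notin> D (sign_comp Z V)" using ZT[of f] by (auto simp: D_def sign_comp_def)
    moreover have "D (sign_comp Z V) \<subseteq> D V" using Zoff by (auto simp: D_def sign_comp_def)
    ultimately have "sign_comp Z V = T" using f by (intro small tope_comp Z(1) Vt(1)) blast
    hence "sign_comp Z V e = T e" by simp
    thus False using Z(2) e by (simp add: sign_comp_def)
  qed
  have "D V = {e}"
  proof (rule ccontr)
    assume "D V \<noteq> {e}"
    then obtain f where f: "f \<in> D V" "f \<noteq> e" using e by (auto simp: D_def)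
    have fE: "f \<in> E" using f by (simp add: D_def)
    obtain Y0 where Y0: "Y0 \<in> L" "Y0 e = 0" "Y0 f \<noteq> 0" using separate[OF e(1) fE] f by auto
    have "Y0 f = - T f \<or> - Y0 f = - T f" using sign[OF Y0(1), of f] Y0(3) tope_sign[OF T fE] by auto
    then obtain Y where Y: "Y \<in> L" "Y e = 0" "Y f = - T f"
      using Y0 minus[OF Y0(1)] that[of Y0] by (elim disjE) auto
    define W where "W = sign_comp (sign_comp Z Y) T"
    have W: "W \<in> topes" unfolding W_def by (intro tope_comp comp Z Y T)
    have "W g = T g" if "g \<in> E" "g \<notin> D V" for g
      using Zoff[OF that] tope_sign[OF T that(1)] by (auto simp: W_def sign_comp_def)
    hence "D W \<subseteq> D V" by (auto simp: D_def)
    moreover have "e \<in> D V" "e \<notin> D W" using e Z(2) Y(2) by (auto simp: D_def W_def sign_comp_def)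
    ultimately have "W = T" by (intro small W) blast
    moreover have "W f = - T f" using Zon[OF f(1)] Y(3) tope_sign[OF T fE] by (auto simp: W_def sign_comp_def)
    ultimately show False using tope_sign[OF T fE] by auto
  qed
  have "V g = flip T {e} g" if "g \<in> E" for g
  proof (cases "g = e")
    case True
    thus ?thesis using opp[OF e] by (simp add: flip_def)
  next
    case False
    hence "g \<notin> D V" using \<open>D V = {e}\<close> by simp
    thus ?thesis using that False by (simp add: D_def flip_def)
  qed
  moreover have "V g = flip T {e} g" if "g \<notin> E" for g
    using tope_outside[OF T that] tope_outside[OF Vt(1) that] e(1) that by (auto simp: flip_def)
  ultimately have "flip T {e} = V" by (metis ext)
  thus ?thesis using Vt e \<open>D V = {e}\<close> by (auto simp: D_def)
qed

text \<open>Each new wall separates the current tope from the opposite of \<open>T\<close>, so no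
  element is flipped twice and the flipped sets form a chain.\<close>

lemma gallery:
  assumes T: "T \<in> topes" and k: "k \<le> card E"
  shows "\<exists>A. (\<forall>i\<le>k. A i \<subseteq> E \<and> card (A i) = i \<and> flip T (A i) \<in> topes) \<and> (\<forall>i j. i \<le> j \<longrightarrow> j \<le> k \<longrightarrow> A i \<subseteq> A j)"
  using k
proof (induction k)
  case 0
  have "flip T {} = T" by (simp add: flip_def)
  thus ?case using T by (intro exI[of _ "\<lambda>_. {}"]) auto
next
  case (Suc k)
  then obtain A where A: "\<And>i. i \<le> k \<Longrightarrow> A i \<subseteq> E \<and> card (A i) = i \<and> flip T (A i) \<in> topes"
    "\<And>i j. i \<le> j \<Longrightarrow> j \<le> k \<Longrightarrow> A i \<subseteq> A j" by auto
  let ?V = "flip T (A k)"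
  have Ak: "A k \<subseteq> E" "card (A k) = k" "?V \<in> topes" using A(1)[of k] by auto
  have fin: "finite (A k)" using Ak finite_E finite_subset by blast
  have "A k \<noteq> E" using Ak Suc.prems by auto
  have "?V \<noteq> (\<lambda>e. - T e)"
  proof
    assume eq: "?V = (\<lambda>e. - T e)"
    have "T e \<noteq> 0" if "e \<in> E" for e using T that by (simp add: topes_def)
    hence "E \<subseteq> A k" using eq by (auto simp: flip_def dest: fun_cong split: if_splits) (metis equal_neg_zero)
    thus False using Ak(1) \<open>A k \<noteq> E\<close> by blast
  qed
  from adjacent_tope[OF Ak(3) uminus_tope[OF T] this] obtain e where
    e: "e \<in> E" "?V e \<noteq> - T e" "flip ?V {e} \<in> topes" by blast
  have eA: "e \<notin> A k" using e(2) by (auto simp: flip_def)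
  have fl: "flip ?V {e} = flip T (insert e (A k))" using eA by (auto simp: flip_def)
  define B where "B i = (if i \<le> k then A i else insert e (A k))" for i
  have "B i \<subseteq> E \<and> card (B i) = i \<and> flip T (B i) \<in> topes" if "i \<le> Suc k" for i
  proof (cases "i \<le> k")
    case True
    thus ?thesis using A(1) by (simp add: B_def)
  next
    case False
    hence "i = Suc k" using that by simp
    thus ?thesis using Ak e eA fl fin by (simp add: B_def)
  qed
  moreover have "B i \<subseteq> B j" if "i \<le> j" "j \<le> Suc k" for i j
    using that A(2)[of i j] A(2)[of i k] by (auto simp: B_def)
  ultimately show ?case by (intro exI[of _ B]) auto
qed

text \<open>A gallery from a tope to its opposite followed by the opposite gallery closes up to a cycle that
  is isometrically embedded in the graph of topes.\<close>

lemma tope_cycle: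
  fixes q :: real
  assumes n: "n = card E"
  shows "\<exists>c :: nat \<Rightarrow> 'a \<Rightarrow> int. inj_on c {..<2 * n} \<and> c ` {..<2 * n} \<subseteq> topes \<and>
    (\<forall>i<2 * n. (\<Sum>j<2 * n. q ^ disagree E (c i) (c j)) = (1 + q) * (\<Sum>k<n. q ^ k))"
proof -
  obtain T where T: "T \<in> topes" using topes_nonempty by blast
  obtain A where A: "\<And>i. i \<le> n \<Longrightarrow> A i \<subseteq> E" "\<And>i. i \<le> n \<Longrightarrow> card (A i) = i"
    "\<And>i. i \<le> n \<Longrightarrow> flip T (A i) \<in> topes" "\<And>i j. i \<le> j \<Longrightarrow> j \<le> n \<Longrightarrow> A i \<subseteq> A j"
    using gallery[OF T, of n] n by auto
  have finA: "finite (A i)" if "i \<le> n" for i using A(1)[OF that] finite_E finite_subset by blast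
  define a where "a i = flip T (A i)" for i
  \<comment> \<open>Both halves use the indices below \<open>n\<close> only: \<open>a n\<close> is
    the opposite of \<open>a 0\<close> and opens the second half.\<close>
  define c where "c i = (if i < n then a i else (\<lambda>e. - a (i - n) e))" for i
  have at: "a i \<in> topes" if "i < n" for i using A(3)[of i] that by (simp add: a_def)
  have dist: "disagree E (a i) (a j) = nat \<bar>int i - int j\<bar>" if "i < n" "j < n" for i j
  proof -
    have main: "card ((A i - A j) \<union> (A j - A i)) = j - i \<and> card ((A j - A i) \<union> (A i - A j)) = j - i"
      if "i \<le> j" "j < n" for i j
    proof -
      have sub: "A i \<subseteq> A j" using A(4)[of i j] that by simp
      hence "(A i - A j) \<union> (A j - A i) = A j - A i" "(A j - A i) \<union> (A i - A j) = A j - A i" by auto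
      moreover have "card (A j - A i) = j - i"
        using card_Diff_subset[OF finA sub] that A(2)[of i] A(2)[of j] by simp
      ultimately show ?thesis by simp
    qed
    have "disagree E (a i) (a j) = card ((A i - A j) \<union> (A j - A i))"
      unfolding a_def using that A(1) by (intro disagree_flip[OF T]) auto
    thus ?thesis using main[of i j] main[of j i] that by (cases "i \<le> j") auto
  qed
  have split: "(\<Sum>j<2 * n. f j) = (\<Sum>j<n. f j) + (\<Sum>j<n. f (n + j))" for f :: "nat \<Rightarrow> real"
  proof -
    have "(\<Sum>j<2 * n. f j) = (\<Sum>j<n. f j) + (\<Sum>j=n..<2 * n. f j)"
      by (subst sum.atLeastLessThan_concat[of 0 n "2 * n", symmetric, unfolded atLeast0LessThan]) auto
    also have "(\<Sum>j=n..<2 * n. f j) = (\<Sum>j<n. f (n + j))"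
      using sum.shift_bounds_nat_ivl[of f 0 n n] by (simp add: atLeast0LessThan mult_2 add.commute)
    finally show ?thesis .
  qed
  have row: "(\<Sum>j<2 * n. q ^ disagree E (c i) (c j)) = (1 + q) * (\<Sum>k<n. q ^ k)" if i: "i < 2 * n" for i
  proof -
    define i' where "i' = (if i < n then i else i - n)"
    have i': "i' < n" using i by (auto simp: i'_def)
    have ci: "c i = a i' \<or> c i = (\<lambda>e. - a i' e)" by (auto simp: c_def i'_def)
    have cit: "c i \<in> topes" using ci at[OF i'] uminus_tope by auto
    have "(\<Sum>j<2 * n. q ^ disagree E (c i) (c j)) = (\<Sum>j<n. q ^ disagree E (c i) (c j) + q ^ disagree E (c i) (c (n + j)))"
      unfolding split sum.distrib ..
    also have "\<dots> = (\<Sum>j<n. q ^ nat \<bar>int i' - int j\<bar> + q ^ (n - nat \<bar>int i' - int j\<bar>))"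
    proof (rule sum.cong[OF refl])
      fix j assume "j \<in> {..<n}"
      hence j: "j < n" by simp
      have cj: "c j = a j" "c (n + j) = (\<lambda>e. - a j e)" using j by (auto simp: c_def)
      define m where "m = nat \<bar>int i' - int j\<bar>"
      have d: "disagree E (a i') (a j) = m" using dist[OF i' j] by (simp add: m_def)
      have "m \<le> n" using d disagree_uminus(3)[OF at[OF i'] at[OF j]] n by simp
      have e1: "disagree E (c i) (c (n + j)) = n - disagree E (c i) (c j)"
        unfolding cj using disagree_uminus(1)[OF cit at[OF j]] n by simp
      from ci show "q ^ disagree E (c i) (c j) + q ^ disagree E (c i) (c (n + j)) = q ^ nat \<bar>int i' - int j\<bar> + q ^ (n - nat \<bar>int i' - int j\<bar>)"
      proof
        assume "c i = a i'"
        hence "disagree E (c i) (c j) = m" using d cj by simp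
        thus ?thesis using e1 m_def by simp
      next
        assume "c i = (\<lambda>e. - a i' e)"
        hence "disagree E (c i) (c j) = n - m" using d cj disagree_uminus(2)[OF at[OF i'] at[OF j]] n by simp
        thus ?thesis using e1 m_def \<open>m \<le> n\<close> by simp
      qed
    qed
    also have "\<dots> = (1 + q) * (\<Sum>k<n. q ^ k)" by (rule cycle_row_sum[OF i'])
    finally show ?thesis .
  qed
  define B where "B i = (if i < n then A i else E - A (i - n))" for i
  have cB: "c i = flip T (B i)" "B i \<subseteq> E" if "i < 2 * n" for i
    using uminus_flip[OF A(1) T, of "i - n"] A(1)[of i] that by (auto simp: c_def a_def B_def)
  have mixed: False if "A i = E - A j" "i < n" "j < n" for i j
  proof (cases "i \<le> j")
    case True
    hence "A i = {}" using that A(4)[of i j] by auto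
    hence "E \<subseteq> A j" using that by auto
    hence "card E \<le> card (A j)" using finA[of j] that by (intro card_mono) auto
    thus False using A(2)[of j] that n by simp
  next
    case False
    hence "A j \<subseteq> E - A j" using that A(4)[of j i] by auto
    hence "A j = {}" by blast
    hence "A i = E" using that by auto
    thus False using A(2)[of i] that n by simp
  qed
  have "inj_on c {..<2 * n}"
  proof (rule inj_onI)
    fix i j assume ij: "i \<in> {..<2 * n}" "j \<in> {..<2 * n}" "c i = c j"
    hence eq: "B i = B j" using cB[of i] cB[of j] flip_inj[OF T, of "B i" "B j"] by simp
    consider "i < n" "j < n" | "i < n" "\<not> j < n" | "\<not> i < n" "j < n" | "\<not> i < n" "\<not> j < n" by blast
    thus "i = j"
    proof cases
      case 1
      hence "card (A i) = card (A j)" using eq by (simp add: B_def)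
      thus ?thesis using A(2)[OF less_imp_le[OF 1(1)]] A(2)[OF less_imp_le[OF 1(2)]] by linarith
    next
      case 2
      moreover have "j - n < n" using 2 ij by simp
      ultimately show ?thesis using eq mixed[of i "j - n"] by (simp add: B_def)
    next
      case 3
      moreover have "i - n < n" using 3 ij by simp
      ultimately show ?thesis using eq mixed[of j "i - n"] by (simp add: B_def)
    next
      case 4
      hence "E - A (i - n) = E - A (j - n)" using eq by (simp add: B_def)
      moreover have "A (i - n) \<subseteq> E" "A (j - n) \<subseteq> E" using ij by (auto intro!: A(1))
      ultimately have "A (i - n) = A (j - n)" by blast
      hence "card (A (i - n)) = card (A (j - n))" by (rule arg_cong)
      moreover have "card (A (i - n)) = i - n" "card (A (j - n)) = j - n" using ij by (auto intro!: A(2))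
      ultimately have "i - n = j - n" by linarith
      thus ?thesis using 4 by simp
    qed
  qed
  moreover have "c ` {..<2 * n} \<subseteq> topes"
    using at uminus_tope by (auto simp: c_def)
  ultimately show ?thesis using row by blast
qed

text \<open>For \<open>y = u - of_bool (T \<in> C) / R\<close> the equations for \<open>u\<close>
  turn the quadratic form into the sum of \<open>y S * (1 - (\<Sum>T\<in>C. ?z S T) / R)\<close>. On
  \<open>C\<close> the second factor vanishes, and by symmetry the part of \<open>u\<close> is
  \<open>s - 2 * n / R\<close>, which is thus nonnegative. If there are only \<open>2 * n\<close>
  topes, \<open>C\<close> contains them all and the same double sum gives equality.\<close>

lemma tope_sum_bound:
  fixes q :: real
  assumes q: "-1 < q" "q < 1" and n: "n = card E" "n > 0"
  defines "R \<equiv> (1 + q) * (\<Sum>k<n. q ^ k)"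
  shows "2 * real n / R \<le> (\<Sum>T\<in>topes. rational_value (series (\<lambda>_. 0) T) q)"
    and "card topes = 2 * n \<Longrightarrow> (\<Sum>T\<in>topes. rational_value (series (\<lambda>_. 0) T) q) = 2 * real n / R"
proof -
  define u where "u T = rational_value (series (\<lambda>_. 0) T) q" for T
  let ?z = "\<lambda>S T. q ^ disagree E S T"
  have sym: "?z S T = ?z T S" for S T unfolding disagree_def by (intro arg_cong[of _ _ "\<lambda>A. q ^ card A"]) auto
  have u: "(\<Sum>T\<in>topes. ?z S T * u T) = 1" if "S \<in> topes" for S
    using tope_equation[OF q that] by (simp add: u_def)
  obtain c where c: "inj_on c {..<2 * n}" "c ` {..<2 * n} \<subseteq> topes"
    "\<And>i. i < 2 * n \<Longrightarrow> (\<Sum>j<2 * n. ?z (c i) (c j)) = R"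
    using tope_cycle[OF n(1), of q] by (auto simp: R_def)
  define C where "C = c ` {..<2 * n}"
  have C: "C \<subseteq> topes" "finite C" "card C = 2 * n" using c card_image[OF c(1)] by (auto simp: C_def)
  have zC: "(\<Sum>T\<in>C. ?z S T) = R" if "S \<in> C" for S
    using that c(3) by (auto simp: C_def sum.reindex[OF c(1)])
  have R: "R > 0" using cycle_bound(1)[OF q n(2)] by (simp add: R_def)
  have uC: "(\<Sum>S\<in>topes. u S * (\<Sum>T\<in>C. ?z S T)) = 2 * real n"
  proof -
    have "(\<Sum>S\<in>topes. u S * (\<Sum>T\<in>C. ?z S T)) = (\<Sum>T\<in>C. \<Sum>S\<in>topes. ?z T S * u S)"
      unfolding sum_distrib_left by (subst sum.swap) (simp add: sym mult_ac)
    also have "\<dots> = (\<Sum>T\<in>C. 1)" using u C by (intro sum.cong) auto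
    finally show ?thesis using C by simp
  qed
  define s where "s = (\<Sum>T\<in>topes. u T)"
  show "(\<Sum>T\<in>topes. rational_value (series (\<lambda>_. 0) T) q) = 2 * real n / R" if "card topes = 2 * n"
  proof -
    have "C = topes" using C that finite_topes by (intro card_subset_eq) auto
    hence "(\<Sum>S\<in>topes. u S * (\<Sum>T\<in>C. ?z S T)) = (\<Sum>S\<in>topes. u S * R)" using zC by (intro sum.cong) auto
    hence "s * R = 2 * real n" using uC by (simp add: s_def sum_distrib_right)
    thus ?thesis using R by (simp add: s_def u_def field_simps)
  qed
  define y where "y T = u T - of_bool (T \<in> C) / R" for T
  have inner: "(\<Sum>T\<in>topes. y T * ?z S T) = 1 - (\<Sum>T\<in>C. ?z S T) / R" if "S \<in> topes" for S
  proof -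
    have "(\<Sum>T\<in>topes. of_bool (T \<in> C) / R * ?z S T) = (\<Sum>T\<in>topes. if T \<in> C then ?z S T / R else 0)"
      by (rule sum.cong) auto
    also have "\<dots> = (\<Sum>T\<in>C. ?z S T / R)"
      using C finite_topes by (simp add: sum.If_cases Int_absorb1)
    also have "\<dots> = (\<Sum>T\<in>C. ?z S T) / R" by (simp add: sum_divide_distrib)
    finally have 1: "(\<Sum>T\<in>topes. of_bool (T \<in> C) / R * ?z S T) = (\<Sum>T\<in>C. ?z S T) / R" .
    have "(\<Sum>T\<in>topes. y T * ?z S T) = (\<Sum>T\<in>topes. u T * ?z S T) - (\<Sum>T\<in>topes. of_bool (T \<in> C) / R * ?z S T)"
      unfolding y_def left_diff_distrib sum_subtractf ..
    thus ?thesis using u[OF that] 1 by (simp only: mult.commute)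
  qed
  have "0 \<le> (\<Sum>S\<in>topes. \<Sum>T\<in>topes. y S * y T * ?z S T)" using q by (intro tope_form_nonneg) auto
  also have "\<dots> = (\<Sum>S\<in>topes. y S * (1 - (\<Sum>T\<in>C. ?z S T) / R))"
    using inner by (intro sum.cong) (auto simp: mult.assoc simp flip: sum_distrib_left)
  also have "\<dots> = (\<Sum>S\<in>topes. u S * (1 - (\<Sum>T\<in>C. ?z S T) / R)) - (\<Sum>S\<in>topes. of_bool (S \<in> C) / R * (1 - (\<Sum>T\<in>C. ?z S T) / R))"
    by (simp add: y_def left_diff_distrib sum_subtractf)
  also have "(\<Sum>S\<in>topes. of_bool (S \<in> C) / R * (1 - (\<Sum>T\<in>C. ?z S T) / R)) = 0"
    using zC R by (intro sum.neutral) auto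
  also have "(\<Sum>S\<in>topes. u S * (1 - (\<Sum>T\<in>C. ?z S T) / R)) = s - 2 * real n / R"
    using uC by (simp add: s_def right_diff_distrib sum_subtractf sum_divide_distrib[symmetric])
  finally show "2 * real n / R \<le> (\<Sum>T\<in>topes. rational_value (series (\<lambda>_. 0) T) q)"
    by (simp add: s_def u_def)
qed

end

section \<open>The magnitude as a sum over topes\<close>

lemma poly_map_poly_of_int: "poly (map_poly of_int p) (of_int x) = (of_int (poly p x) :: 'a :: comm_ring_1)"
  by (induction p) (simp_all add: map_poly_pCons)

context signed_circuits
begin

sublocale covector_system E covectors "rank M"
  by (rule covector_system)

text \<open>The covectors of the initial matroid: level by level, the restriction of a covector of \<open>M\<close> that
  vanishes on all higher levels.\<close>

definition initial_covectors :: "('a \<Rightarrow> nat) \<Rightarrow> ('a \<Rightarrow> int) set" where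
  "initial_covectors w = {X. \<forall>c. \<exists>Y \<in> covectors. \<forall>e. (c < w e \<longrightarrow> Y e = 0) \<and> (w e = c \<longrightarrow> Y e = X e)}"

lemma initial_covectorD:
  assumes "X \<in> initial_covectors w"
  obtains Y where "Y \<in> covectors" "\<And>e. c < w e \<Longrightarrow> Y e = 0" "\<And>e. w e = c \<Longrightarrow> Y e = X e"
  using assms unfolding initial_covectors_def by blast

lemma initial_covectorI:
  assumes "\<And>c. \<exists>Y \<in> covectors. \<forall>e. (c < w e \<longrightarrow> Y e = 0) \<and> (w e = c \<longrightarrow> Y e = X e)"
  shows "X \<in> initial_covectors w"
  using assms unfolding initial_covectors_def by blast

lemma initial_covectors_restrict_level:
  assumes X: "X \<in> covectors" "\<And>e. c < w e \<Longrightarrow> X e = 0"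
  shows "(\<lambda>e. if w e = c then X e else 0) \<in> initial_covectors w"
proof (rule initial_covectorI)
  fix d
  show "\<exists>Y\<in>covectors. \<forall>e. (d < w e \<longrightarrow> Y e = 0) \<and> (w e = d \<longrightarrow> Y e = (if w e = c then X e else 0))"
  proof (cases "d = c")
    case True
    thus ?thesis using X by (intro bexI[of _ X]) auto
  next
    case False
    thus ?thesis using zero by (intro bexI[of _ "\<lambda>_. 0"]) auto
  qed
qed

text \<open>A witness for the level of \<open>e\<close> vanishes on all higher levels, so vanishing
  on \<open>S\<close> makes it vanish on \<open>F\<close>. Conversely, a covector that vanishes on
  \<open>F\<close> is cut down to the level of \<open>e\<close>.\<close>

lemma initial_matroid_spans_iff:
  fixes w :: "'a \<Rightarrow> nat"
  assumes S: "S \<subseteq> E" and e: "e \<in> E - S"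
  defines "F \<equiv> upper E w (w e) \<union> {f \<in> S. w f = w e}"
  shows "spans F e \<longleftrightarrow> (\<forall>X \<in> initial_covectors w. (\<forall>f\<in>S. X f = 0) \<longrightarrow> X e = 0)"
proof -
  have F: "F \<subseteq> E" "e \<in> E - F" using S e by (auto simp: F_def upper_def)
  have "(\<forall>X \<in> covectors. (\<forall>f\<in>F. X f = 0) \<longrightarrow> X e = 0) \<longleftrightarrow>
    (\<forall>X \<in> initial_covectors w. (\<forall>f\<in>S. X f = 0) \<longrightarrow> X e = 0)"
  proof (intro iffI ballI impI)
    fix X assume all: "\<forall>X \<in> covectors. (\<forall>f\<in>F. X f = 0) \<longrightarrow> X e = 0"
      and X: "X \<in> initial_covectors w" "\<forall>f\<in>S. X f = 0"
    obtain Y where Y: "Y \<in> covectors" "\<And>f. w e < w f \<Longrightarrow> Y f = 0" "\<And>f. w f = w e \<Longrightarrow> Y f = X f"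
      using initial_covectorD[OF X(1), of "w e"] by blast
    have "\<forall>f\<in>F. Y f = 0" using Y X(2) by (auto simp: F_def upper_def)
    thus "X e = 0" using all Y by auto
  next
    fix X assume all: "\<forall>X \<in> initial_covectors w. (\<forall>f\<in>S. X f = 0) \<longrightarrow> X e = 0"
      and X: "X \<in> covectors" "\<forall>f\<in>F. X f = 0"
    have "X f = 0" if "w e < w f" for f
      using X that covectorD(2)[OF X(1), of f] by (cases "f \<in> E") (auto simp: F_def upper_def)
    hence "(\<lambda>f. if w f = w e then X f else 0) \<in> initial_covectors w"
      by (rule initial_covectors_restrict_level[OF X(1)])
    moreover have "\<forall>f\<in>S. (if w f = w e then X f else 0) = 0" using X(2) by (auto simp: F_def)
    ultimately show "X e = 0" using all by fastforce
  qed
  thus ?thesis using spans_iff_covectors[OF F] by simp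
qed

text \<open>Composition, negation and elimination are checked one level at a time, on the covectors
  of \<open>M\<close> that witness the level.\<close>

lemma initial_covector_system:
  "covector_system E (initial_covectors w) (rank (initial_matroid M w))"
proof
  show "finite E" by (rule finite_ground)
  show "rank (initial_matroid M w) {} = 0" by (rule rank_initial_matroid_empty)
  show "rank (initial_matroid M w) (insert e S) = (if \<forall>X \<in> initial_covectors w. (\<forall>f \<in> S. X f = 0) \<longrightarrow> X e = 0
    then rank (initial_matroid M w) S else Suc (rank (initial_matroid M w) S))" if "S \<subseteq> E" "e \<in> E - S" for S e
    using rank_initial_matroid_insert[OF that, of w] initial_matroid_spans_iff[OF that, of w] by simp
  show "(\<lambda>_. 0) \<in> initial_covectors w"
    using zero by (intro initial_covectorI) (auto intro!: bexI[of _ "\<lambda>_. 0"])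
  show "X e \<in> {-1, 0, 1}" "e \<notin> E \<Longrightarrow> X e = 0" if X: "X \<in> initial_covectors w" for X e
  proof -
    obtain Y where "Y \<in> covectors" "Y e = X e" using initial_covectorD[OF X, of "w e"] by blast
    thus "X e \<in> {-1, 0, 1}" "e \<notin> E \<Longrightarrow> X e = 0" using covectorD(1,2)[of Y e] by auto
  qed
  show "(\<lambda>e. - X e) \<in> initial_covectors w" if X: "X \<in> initial_covectors w" for X
  proof (rule initial_covectorI)
    fix c
    obtain Y where Y: "Y \<in> covectors" "\<And>e. c < w e \<Longrightarrow> Y e = 0" "\<And>e. w e = c \<Longrightarrow> Y e = X e"
      using initial_covectorD[OF X] by blast
    show "\<exists>Y\<in>covectors. \<forall>e. (c < w e \<longrightarrow> Y e = 0) \<and> (w e = c \<longrightarrow> Y e = - X e)"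
      using Y uminus_covectors[OF Y(1)] by (intro bexI[of _ "\<lambda>e. - Y e"]) auto
  qed
  show "sign_comp X X' \<in> initial_covectors w" if X: "X \<in> initial_covectors w" and X': "X' \<in> initial_covectors w" for X X'
  proof (rule initial_covectorI)
    fix c
    obtain Y where Y: "Y \<in> covectors" "\<And>e. c < w e \<Longrightarrow> Y e = 0" "\<And>e. w e = c \<Longrightarrow> Y e = X e"
      using initial_covectorD[OF X] by blast
    obtain Y' where Y': "Y' \<in> covectors" "\<And>e. c < w e \<Longrightarrow> Y' e = 0" "\<And>e. w e = c \<Longrightarrow> Y' e = X' e"
      using initial_covectorD[OF X'] by blast
    show "\<exists>Y\<in>covectors. \<forall>e. (c < w e \<longrightarrow> Y e = 0) \<and> (w e = c \<longrightarrow> Y e = sign_comp X X' e)"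
      using Y Y' compose_covectors[OF Y(1) Y'(1)] by (intro bexI[of _ "sign_comp Y Y'"]) (auto simp: sign_comp_def)
  qed
  show "\<exists>Z\<in>initial_covectors w. Z e = 0 \<and> (\<forall>f. X f = 0 \<or> X f \<noteq> - X' f \<longrightarrow> Z f = sign_comp X X' f)"
    if X: "X \<in> initial_covectors w" and X': "X' \<in> initial_covectors w" and e: "X e = - X' e" "X e \<noteq> 0" for X X' e
  proof -
    obtain Y where Y: "Y \<in> covectors" "\<And>f. w e < w f \<Longrightarrow> Y f = 0" "\<And>f. w f = w e \<Longrightarrow> Y f = X f"
      using initial_covectorD[OF X, of "w e"] by blast
    obtain Y' where Y': "Y' \<in> covectors" "\<And>f. w e < w f \<Longrightarrow> Y' f = 0" "\<And>f. w f = w e \<Longrightarrow> Y' f = X' f"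
      using initial_covectorD[OF X', of "w e"] by blast
    obtain Z where Z: "Z \<in> covectors" "Z e = 0" "\<And>f. Y f = 0 \<or> Y f \<noteq> - Y' f \<Longrightarrow> Z f = sign_comp Y Y' f"
      using eliminate_covectors[OF Y(1) Y'(1), of e] Y(3)[of e] Y'(3)[of e] e by auto
    \<comment> \<open>Elimination has to act only on the level of \<open>e\<close>; on the other
      levels the composition is kept.\<close>
    define V where "V f = (if w f = w e then Z f else sign_comp X X' f)" for f
    have "V \<in> initial_covectors w"
    proof (rule initial_covectorI)
      fix c
      show "\<exists>Y\<in>covectors. \<forall>f. (c < w f \<longrightarrow> Y f = 0) \<and> (w f = c \<longrightarrow> Y f = V f)"
      proof (cases "c = w e")
        case True
        have "Z f = 0" if "w e < w f" for f using Z(3)[of f] Y(2)[OF that] Y'(2)[OF that] by (simp add: sign_comp_def)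
        thus ?thesis using Z True by (intro bexI[of _ Z]) (auto simp: V_def)
      next
        case False
        obtain U where U: "U \<in> covectors" "\<And>f. c < w f \<Longrightarrow> U f = 0" "\<And>f. w f = c \<Longrightarrow> U f = X f"
          using initial_covectorD[OF X] by blast
        obtain U' where U': "U' \<in> covectors" "\<And>f. c < w f \<Longrightarrow> U' f = 0" "\<And>f. w f = c \<Longrightarrow> U' f = X' f"
          using initial_covectorD[OF X'] by blast
        show ?thesis
          using U U' False compose_covectors[OF U(1) U'(1)]
          by (intro bexI[of _ "sign_comp U U'"]) (auto simp: sign_comp_def V_def)
      qed
    qed
    moreover have "V e = 0" using Z by (simp add: V_def)
    moreover have "V f = sign_comp X X' f" if "X f = 0 \<or> X f \<noteq> - X' f" for f
      using Z(3)[of f] Y(3)[of f] Y'(3)[of f] that by (auto simp: V_def sign_comp_def)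
    ultimately show ?thesis by blast
  qed
qed

text \<open>Composing \<open>cut T w j\<close> with a witness for level \<open>j\<close> gives
  \<open>cut T w (Suc j)\<close>, so all cuts of an initial tope are covectors. Conversely,
  \<open>cut T w (Suc c)\<close> is itself a witness for level \<open>c\<close>.\<close>

lemma initial_topes:
  "covector_system.topes E (initial_covectors w) = {T \<in> topes. \<forall>j. cut T w j \<in> covectors}"
proof -
  interpret I: covector_system E "initial_covectors w" "rank (initial_matroid M w)"
    by (rule initial_covector_system)
  show ?thesis
  proof (intro equalityI subsetI)
    fix T assume "T \<in> I.topes"
    hence T: "T \<in> initial_covectors w" "\<And>e. e \<in> E \<Longrightarrow> T e \<noteq> 0" by (auto simp: I.topes_def)
    have cut: "cut T w j \<in> covectors" for j
    proof (induction j)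
      case 0
      thus ?case using zero by (simp add: cut_def)
    next
      case (Suc j)
      obtain Y where Y: "Y \<in> covectors" "\<And>e. j < w e \<Longrightarrow> Y e = 0" "\<And>e. w e = j \<Longrightarrow> Y e = T e"
        using initial_covectorD[OF T(1)] by blast
      have "sign_comp (cut T w j) Y e = cut T w (Suc j) e" for e
        using T(2)[of e] I.outside[OF T(1), of e] covectorD(2)[OF Y(1), of e] Y(2,3)[of e]
        by (cases "e \<in> E") (auto simp: sign_comp_def cut_def less_Suc_eq)
      hence "cut T w (Suc j) = sign_comp (cut T w j) Y" by (metis ext)
      thus ?case using compose_covectors[OF Suc Y(1)] by simp
    qed
    obtain N where N: "\<And>e. e \<in> E \<Longrightarrow> w e \<le> N" using weight_bound by blast
    have "cut T w (Suc N) e = T e" for e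
      using N[of e] I.outside[OF T(1), of e] by (cases "e \<in> E") (auto simp: cut_def)
    hence "cut T w (Suc N) = T" by (metis ext)
    thus "T \<in> {T \<in> topes. \<forall>j. cut T w j \<in> covectors}" using cut cut[of "Suc N"] T(2) by (simp add: topes_def)
  next
    fix T assume T: "T \<in> {T \<in> topes. \<forall>j. cut T w j \<in> covectors}"
    have "T \<in> initial_covectors w"
    proof (rule initial_covectorI)
      fix c
      show "\<exists>Y\<in>covectors. \<forall>e. (c < w e \<longrightarrow> Y e = 0) \<and> (w e = c \<longrightarrow> Y e = T e)"
        using T by (intro bexI[of _ "cut T w (Suc c)"]) (auto simp: cut_def)
    qed
    thus "T \<in> I.topes" using T by (auto simp: topes_def I.topes_def)
  qed
qed

text \<open>Zaslavsky's theorem for the initial matroid produces the sign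
  \<open>(-1) ^ rank M E\<close>, which the power of the first variable cancels, leaving
  \<open>(-1) ^ wt M w\<close>.\<close>

lemma magnitude_term:
  "poly (map_poly of_int (char_poly (initial_matroid M w))) (-1) * (-1) powi (- int (rank M E) - int (wt M w))
    = (-1 :: real) ^ wt M w * real (card {T \<in> topes. \<forall>j. cut T w j \<in> covectors})"
proof -
  let ?M = "initial_matroid M w"
  interpret I: covector_system E "initial_covectors w" "rank ?M" by (rule initial_covector_system)
  have gr: "ground ?M = E" by (simp add: initial_matroid_def)
  have sgn: "(-1 :: int) ^ (rank M E - rank ?M S) = (-1) ^ rank M E * (-1) ^ rank ?M S" if "S \<in> Pow E" for S
  proof -
    \<comment> \<open>\<open>char_poly\<close> subtracts ranks in the natural numbers, so the sign
      splits only after this comparison, which is made between weights of \<open>M\<close>.\<close>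
    have "rank ?M S \<le> rank ?M E"
    proof -
      have "rank ?M S + 2 * wt M w = wt M (\<lambda>e. 2 * w e + of_bool (e \<in> S))"
        using rank_initial_matroid[of S w] that by simp
      also have "\<dots> \<le> wt M (\<lambda>e. 2 * w e + of_bool (e \<in> E))"
      proof -
        obtain B where B: "B \<in> bases M" "\<forall>c. card (B \<inter> upper E (\<lambda>e. 2 * w e + of_bool (e \<in> S)) c) = rank M (upper E (\<lambda>e. 2 * w e + of_bool (e \<in> S)) c)"
          using greedy_basis by blast
        have "(\<Sum>e\<in>B. 2 * w e + of_bool (e \<in> S)) \<le> (\<Sum>e\<in>B. 2 * w e + of_bool (e \<in> E))"
          using that by (intro sum_mono) auto
        thus ?thesis using greedy_wt[OF B] basis_weight_le_wt[OF B(1), of "\<lambda>e. 2 * w e + of_bool (e \<in> E)"] by simp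
      qed
      also have "\<dots> = rank ?M E + 2 * wt M w" using rank_initial_matroid[of E w] by simp
      finally show ?thesis by simp
    qed
    hence "rank ?M S \<le> rank M E" using rank_initial_matroid_ground[of w] by simp
    thus ?thesis by (auto simp: minus_one_power_iff)
  qed
  have "poly (char_poly ?M) (-1) = (\<Sum>S\<in>Pow E. (-1) ^ card S * (-1) ^ (rank M E - rank ?M S))"
    unfolding char_poly_def gr rank_initial_matroid_ground by (simp add: poly_sum poly_monom)
  also have "\<dots> = (-1) ^ rank M E * (\<Sum>S\<in>Pow E. (-1) ^ (card S + rank ?M S))"
    using sgn by (simp add: sum_distrib_left power_add mult_ac)
  also have "\<dots> = (-1) ^ rank M E * int (card {T \<in> topes. \<forall>j. cut T w j \<in> covectors})"
    unfolding I.card_topes[symmetric] initial_topes ..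
  finally have p: "poly (char_poly ?M) (-1) = (-1) ^ rank M E * int (card {T \<in> topes. \<forall>j. cut T w j \<in> covectors})" .
  have "poly (map_poly of_int (char_poly ?M)) (-1 :: real) = of_int (poly (char_poly ?M) (-1))"
    using poly_map_poly_of_int[of "char_poly ?M" "-1", where ?'a = real] by simp
  also have "\<dots> = (-1) ^ rank M E * real (card {T \<in> topes. \<forall>j. cut T w j \<in> covectors})"
    unfolding p by simp
  finally have 1: "poly (map_poly of_int (char_poly ?M)) (-1 :: real) = (-1) ^ rank M E * real (card {T \<in> topes. \<forall>j. cut T w j \<in> covectors})" .
  have "(-1 :: real) powi (- int (rank M E) - int (wt M w)) = (-1) powi (- int (rank M E + wt M w))" by simp
  also have "\<dots> = (-1) ^ (rank M E + wt M w)"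
    unfolding power_int_minus power_int_of_nat by (simp flip: power_inverse)
  finally show ?thesis unfolding 1 by (simp add: power_add mult_ac)
qed

lemma magnitude_series_eq: "magnitude_series M = (\<Sum>T\<in>topes. series (\<lambda>_. 0) T)"
proof (rule fps_ext)
  fix d
  let ?W = "weights M d"
  have fin: "finite ?W" using finite_weights_sum[of d] by (simp add: weights_def)
  have "magnitude_series M $ d = (\<Sum>w\<in>?W. (-1) ^ wt M w * real (card {T \<in> topes. \<forall>j. cut T w j \<in> covectors}))"
    unfolding magnitude_series_def motivic_zeta_def fps_nth_Abs_fps magnitude_term ..
  also have "\<dots> = (\<Sum>w\<in>?W. \<Sum>T\<in>topes. if \<forall>j. cut T w j \<in> covectors then (-1) ^ wt M w else 0)"
  proof (rule sum.cong[OF refl])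
    fix w
    show "(-1) ^ wt M w * real (card {T \<in> topes. \<forall>j. cut T w j \<in> covectors}) = (\<Sum>T\<in>topes. if \<forall>j. cut T w j \<in> covectors then (-1) ^ wt M w else 0)"
      using finite_topes by (simp flip: sum.inter_filter)
  qed
  also have "\<dots> = (\<Sum>T\<in>topes. \<Sum>w\<in>?W. if \<forall>j. cut T w j \<in> covectors then (-1) ^ wt M w else 0)" by (rule sum.swap)
  also have "\<dots> = (\<Sum>T\<in>topes. series (\<lambda>_. 0) T $ d)"
  proof (rule sum.cong[OF refl])
    fix T
    have "(\<Sum>w\<in>?W. if \<forall>j. cut T w j \<in> covectors then (-1 :: real) ^ wt M w else 0) = (\<Sum>w | w \<in> ?W \<and> (\<forall>j. cut T w j \<in> covectors). (-1) ^ wt M w)"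
      using fin by (simp flip: sum.inter_filter)
    also have "\<dots> = (\<Sum>w\<in>compatible (\<lambda>_. 0) T d. (-1) ^ weight w d)"
    proof (rule sum.cong)
      show "{w. w \<in> ?W \<and> (\<forall>j. cut T w j \<in> covectors)} = compatible (\<lambda>_. 0) T d"
        by (auto simp: weights_def compatible_def)
      fix w assume "w \<in> compatible (\<lambda>_. 0) T d"
      hence "(\<Sum>e\<in>E. w e) = d" by (simp add: compatible_def)
      hence "wt M w = weight w d" unfolding weight_def by (intro wt_eq_sum_rank weight_le)
      thus "(-1 :: real) ^ wt M w = (-1) ^ weight w d" by simp
    qed
    finally show "(\<Sum>w\<in>?W. if \<forall>j. cut T w j \<in> covectors then (-1 :: real) ^ wt M w else 0) = series (\<lambda>_. 0) T $ d"
      by (simp add: series_def)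
  qed
  finally show "magnitude_series M $ d = (\<Sum>T\<in>topes. series (\<lambda>_. 0) T) $ d" by (simp add: fps_sum_nth)
qed

lemma magnitude_eq:
  assumes q: "-1 < q" "q < 1"
  shows "magnitude M q = (\<Sum>T\<in>topes. rational_value (series (\<lambda>_. 0) T) q)"
  unfolding magnitude_def magnitude_series_eq
proof (rule regular_at_sum[THEN conjunct2])
  show "regular_at q (series (\<lambda>_. 0) T)" if "T \<in> topes" for T
    using that zero topes_L by (intro regular_series[OF q]) (auto simp: above_def)
qed (rule finite_topes)

lemma simple_imp_simple_covector_system:
  assumes "simple_matroid M"
  shows "simple_covector_system E covectors (rank M)"
proof
  have indep1: "indep M {e}" if "e \<in> E" for e
  proof (rule ccontr)
    assume "\<not> indep M {e}"
    moreover have "D = {}" if "D \<subset> {e}" for D using that by auto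
    ultimately have "{e} \<in> circuits M" using that indep_empty by (auto simp: circuits_def)
    thus False using assms by (auto simp: simple_matroid_def loop_def)
  qed
  show "rank M {e} = 1" if "e \<in> E" for e using rank_indep[OF indep1[OF that]] by simp
  show "rank M {e, f} = 2" if ef: "e \<in> E" "f \<in> E" "e \<noteq> f" for e f
  proof -
    have "indep M {e, f}"
    proof (rule ccontr)
      assume n: "\<not> indep M {e, f}"
      have "indep M D" if "D \<subset> {e, f}" for D
      proof -
        have "D \<subseteq> {e} \<or> D \<subseteq> {f}" using that by auto
        thus ?thesis using indep1 ef indep_subset by blast
      qed
      hence "{e, f} \<in> circuits M" using n ef by (auto simp: circuits_def)
      thus False using assms ef by (auto simp: simple_matroid_def parallel_def)
    qed
    from rank_indep[OF this] show ?thesis using ef by simp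
  qed
qed

text \<open>The equality case is phrased with Zaslavsky's sum, so that the number of topes can be
  checked from the rank function alone.\<close>

lemma magnitude_bound:
  assumes "simple_matroid M" and q: "-1 < q" "q < 1" and n: "card E = n" "n > 0"
  shows "2 * real n * (1 - q) / ((1 + q) * (1 - q ^ n)) \<le> magnitude M q"
    and "int (2 * n) = (\<Sum>S\<in>Pow E. (-1) ^ (card S + rank M S)) \<Longrightarrow>
      magnitude M q = 2 * real n * (1 - q) / ((1 + q) * (1 - q ^ n))"
proof -
  interpret S: simple_covector_system E covectors "rank M"
    by (rule simple_imp_simple_covector_system[OF assms(1)])
  show "2 * real n * (1 - q) / ((1 + q) * (1 - q ^ n)) \<le> magnitude M q"
    using S.tope_sum_bound(1)[OF q n(1)[symmetric] n(2)] cycle_bound(3)[OF q n(2)] magnitude_eq[OF q] by simp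
  show "magnitude M q = 2 * real n * (1 - q) / ((1 + q) * (1 - q ^ n))"
    if "int (2 * n) = (\<Sum>S\<in>Pow E. (-1) ^ (card S + rank M S))"
  proof -
    have "card topes = 2 * n" using that card_topes by simp
    thus ?thesis
      using S.tope_sum_bound(2)[OF q n(1)[symmetric] n(2)] cycle_bound(3)[OF q n(2)] magnitude_eq[OF q] by simp
  qed
qed

end

section \<open>From signed sets to sign functions\<close>

definition signs :: "'a signed_set \<Rightarrow> 'a \<Rightarrow> int" where
  "signs X e = (if e \<in> fst X then 1 else if e \<in> snd X then -1 else 0)"

lemma (in matroid) signed_circuits_of_orientable:
  assumes "orientable M"
  shows "\<exists>\<S>. signed_circuits M \<S>"
proof -
  obtain \<C> where om: "oriented_matroid (ground M) \<C>" and circ: "circuits M = supp ` \<C>"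
    using assms by (auto simp: orientable_def)
  interpret O: oriented_matroid "ground M" \<C> by (rule om)
  have disj: "fst X \<inter> snd X = {}" if "X \<in> \<C>" for X using O.signed_subset[OF that] by blast
  have supp: "{e. signs X e \<noteq> 0} = supp X" for X :: "'a signed_set" by (auto simp: signs_def supp_def)
  have pos: "signs X e = 1 \<longleftrightarrow> e \<in> fst X" and neg: "signs X e = -1 \<longleftrightarrow> e \<in> snd X" if "X \<in> \<C>" for X e
    using disj[OF that] by (auto simp: signs_def)
  have signs_opp: "signs (opp X) = (\<lambda>e. - signs X e)" if "X \<in> \<C>" for X
    using disj[OF that] by (intro ext) (auto simp: signs_def opp_def)
  have "signed_circuits M (signs ` \<C>)"
  proof
    fix C e assume "C \<in> signs ` \<C>"
    thus "C e \<in> {-1, 0, 1}" by (elim imageE) (simp add: signs_def)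
  next
    fix C assume "C \<in> signs ` \<C>"
    thus "{e. C e \<noteq> 0} \<in> circuits M" using supp circ by auto
  next
    fix K assume "K \<in> circuits M"
    thus "\<exists>C\<in>signs ` \<C>. {e. C e \<noteq> 0} = K" using supp circ by auto
  next
    fix C assume "C \<in> signs ` \<C>"
    then obtain X where X: "X \<in> \<C>" "C = signs X" by blast
    thus "(\<lambda>e. - C e) \<in> signs ` \<C>" using signs_opp[OF X(1)] O.symmetric[OF X(1)] by (metis imageI)
  next
    fix C D assume "C \<in> signs ` \<C>" "D \<in> signs ` \<C>" and eq: "\<And>e. C e \<noteq> 0 \<longleftrightarrow> D e \<noteq> 0"
    then obtain X Y where XY: "X \<in> \<C>" "C = signs X" "Y \<in> \<C>" "D = signs Y" by blast
    have "supp X = supp Y" unfolding supp[symmetric] using eq XY(2,4) by simp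
    hence "X = Y \<or> X = opp Y" using O.incomparable XY by simp
    thus "C = D \<or> C = (\<lambda>e. - D e)" using XY signs_opp[of Y] by auto
  next
    fix C D e assume "C \<in> signs ` \<C>" "D \<in> signs ` \<C>" and ne: "C \<noteq> (\<lambda>e. - D e)" and e: "C e = 1" "D e = -1"
    then obtain X Y where XY: "X \<in> \<C>" "C = signs X" "Y \<in> \<C>" "D = signs Y" by blast
    have "X \<noteq> opp Y" using ne XY signs_opp[of Y] by auto
    moreover have "e \<in> fst X \<inter> snd Y" using e XY pos neg by blast
    ultimately obtain Z where Z: "Z \<in> \<C>" "fst Z \<subseteq> (fst X \<union> fst Y) - {e}" "snd Z \<subseteq> (snd X \<union> snd Y) - {e}"
      using O.elimination XY by blast
    have "signs Z e = 0" using Z by (auto simp: signs_def)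
    moreover have "signs Z f \<in> {0, C f, D f}" for f
    proof -
      consider "f \<in> fst Z" | "f \<in> snd Z" | "f \<notin> fst Z" "f \<notin> snd Z" by blast
      thus ?thesis
      proof cases
        case 1
        hence "C f = 1 \<or> D f = 1" using Z(2) XY pos by blast
        thus ?thesis using pos[OF Z(1)] 1 by auto
      next
        case 2
        hence "C f = -1 \<or> D f = -1" using Z(3) XY neg by blast
        thus ?thesis using neg[OF Z(1)] 2 by auto
      next
        case 3
        thus ?thesis by (simp add: signs_def)
      qed
    qed
    ultimately show "\<exists>Z\<in>signs ` \<C>. Z e = 0 \<and> (\<forall>f. Z f \<in> {0, C f, D f})" using Z(1) by blast
  qed
  thus ?thesis by blast
qed

lemma magnitude_orientable:
  assumes "matroid M" "simple_matroid M" "orientable M" "card (ground M) = n" "n > 0" "-1 < q" "q < 1"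
  shows "2 * real n * (1 - q) / ((1 + q) * (1 - q ^ n)) \<le> magnitude M q"
    and "int (2 * n) = (\<Sum>S\<in>Pow (ground M). (-1) ^ (card S + rank M S)) \<Longrightarrow>
      magnitude M q = 2 * real n * (1 - q) / ((1 + q) * (1 - q ^ n))"
proof -
  obtain \<S> where "signed_circuits M \<S>"
    using matroid.signed_circuits_of_orientable[OF assms(1,3)] by blast
  then interpret signed_circuits M \<S> .
  show "2 * real n * (1 - q) / ((1 + q) * (1 - q ^ n)) \<le> magnitude M q"
    "int (2 * n) = (\<Sum>S\<in>Pow (ground M). (-1) ^ (card S + rank M S)) \<Longrightarrow>
      magnitude M q = 2 * real n * (1 - q) / ((1 + q) * (1 - q ^ n))"
    using magnitude_bound[OF assms(2,6,7,4,5)] by blast+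
qed

section \<open>Uniform matroids\<close>

lemma matroid_uniform:
  assumes "r \<le> n"
  shows "matroid (uniform_matroid r n)"
proof
  have "{..<r} \<in> bases (uniform_matroid r n)" using assms by (auto simp: uniform_matroid_def)
  thus "bases (uniform_matroid r n) \<noteq> {}" by blast
  fix B1 B2 x assume B: "B1 \<in> bases (uniform_matroid r n)" "B2 \<in> bases (uniform_matroid r n)" "x \<in> B1 - B2"
  hence B': "B1 \<subseteq> {..<n}" "card B1 = r" "B2 \<subseteq> {..<n}" "card B2 = r" by (auto simp: uniform_matroid_def)
  have fin: "finite B1" "finite B2" using B' finite_subset by blast+
  have "\<not> B2 \<subseteq> B1" using card_subset_eq[OF fin(1)] B B' by blast
  then obtain y where y: "y \<in> B2 - B1" by blast
  have "card (insert y (B1 - {x})) = Suc (card (B1 - {x}))" using y fin by auto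
  also have "\<dots> = card B1" using B(3) fin by (intro card_Suc_Diff1) auto
  finally have "card (insert y (B1 - {x})) = r" using B'(2) by simp
  hence "insert y (B1 - {x}) \<in> bases (uniform_matroid r n)" using y B' by (auto simp: uniform_matroid_def)
  thus "\<exists>y\<in>B2 - B1. insert y (B1 - {x}) \<in> bases (uniform_matroid r n)" using y by blast
qed (auto simp: uniform_matroid_def)

lemma indep_uniform:
  assumes "r \<le> n"
  shows "indep (uniform_matroid r n) I \<longleftrightarrow> I \<subseteq> {..<n} \<and> card I \<le> r"
proof
  assume "indep (uniform_matroid r n) I"
  then obtain B where "B \<subseteq> {..<n}" "card B = r" "I \<subseteq> B" by (auto simp: indep_def uniform_matroid_def)
  thus "I \<subseteq> {..<n} \<and> card I \<le> r" using card_mono[of B I] finite_subset[of B "{..<n}"] by auto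
next
  assume I: "I \<subseteq> {..<n} \<and> card I \<le> r"
  obtain B where "I \<subseteq> B" "B \<subseteq> {..<n}" "card B = r"
    using exists_subset_between[of I r "{..<n}"] I assms by auto
  thus "indep (uniform_matroid r n) I" by (auto simp: indep_def uniform_matroid_def)
qed

lemma rank_uniform:
  assumes "r \<le> n" and S: "S \<subseteq> {..<n}"
  shows "rank (uniform_matroid r n) S = min (card S) r"
proof -
  interpret matroid "uniform_matroid r n" by (rule matroid_uniform[OF assms(1)])
  have fin: "finite S" using S finite_subset by blast
  obtain I where I: "I \<subseteq> S" "card I = min (card S) r"
    using exists_subset_between[of "{}" "min (card S) r" S] fin by auto
  have "indep (uniform_matroid r n) I" using I S indep_uniform[OF assms(1)] by auto
  hence "min (card S) r \<le> rank (uniform_matroid r n) S" using card_le_rank I by metis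
  moreover obtain J where J: "J \<subseteq> S" "indep (uniform_matroid r n) J" "card J = rank (uniform_matroid r n) S"
    using rank_witness by blast
  moreover have "card J \<le> card S" using card_mono[OF fin J(1)] .
  moreover have "card J \<le> r" using J(2) indep_uniform[OF assms(1)] by simp
  ultimately show ?thesis using J by simp
qed

lemma circuits_uniform:
  assumes "r \<le> n"
  shows "circuits (uniform_matroid r n) = {C. C \<subseteq> {..<n} \<and> card C = Suc r}"
proof (intro equalityI subsetI)
  fix C assume C: "C \<in> circuits (uniform_matroid r n)"
  hence C': "C \<subseteq> {..<n}" "r < card C" "\<And>D. D \<subset> C \<Longrightarrow> card D \<le> r"
    using indep_uniform[OF assms] by (auto simp: circuits_def uniform_matroid_def)
  then obtain x where "x \<in> C" by (metis card.empty not_less_zero ex_in_conv)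
  hence "card (C - {x}) \<le> r" using C'(3)[of "C - {x}"] by blast
  hence "card C \<le> Suc r" using \<open>x \<in> C\<close> by (simp add: card_Diff_singleton)
  thus "C \<in> {C. C \<subseteq> {..<n} \<and> card C = Suc r}" using C' by simp
next
  fix C assume C: "C \<in> {C. C \<subseteq> {..<n} \<and> card C = Suc r}"
  have fin: "finite C" using C finite_subset by blast
  have "card D \<le> r" if "D \<subset> C" for D using psubset_card_mono[OF fin that] C by simp
  thus "C \<in> circuits (uniform_matroid r n)"
    using C indep_uniform[OF assms] by (auto simp: circuits_def uniform_matroid_def)
qed

lemma simple_uniform:
  assumes "r \<le> n" "r = 2 \<or> r = 1 \<and> n = 1"
  shows "simple_matroid (uniform_matroid r n)"
proof -
  have "{e, f} \<notin> circuits (uniform_matroid r n)" for e f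
    using assms card_mono[of "{..<n}" "{e, f}"] by (auto simp: circuits_uniform card_insert_if)
  thus ?thesis unfolding simple_matroid_def loop_def parallel_def by (metis insert_absorb2)
qed

text \<open>The sum of \<open>(-1) ^ card S\<close> vanishes. Against it only the \<open>n\<close>
  singletons change sign, each adding 2: larger sets have the even rank 2, and for
  \<open>r = n = 1\<close> there are none.\<close>

lemma uniform_rank_sum:
  assumes "r \<le> n" "r = 2 \<or> r = 1 \<and> n = 1"
  shows "int (2 * n) = (\<Sum>S\<in>Pow (ground (uniform_matroid r n)). (-1) ^ (card S + rank (uniform_matroid r n) S))"
proof -
  have "(\<Sum>S\<in>Pow {..<n}. (-1 :: int) ^ (card S + rank (uniform_matroid r n) S)) = (\<Sum>S\<in>Pow {..<n}. (-1) ^ card S + (if card S = 1 then 2 else 0))"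
  proof (rule sum.cong[OF refl])
    fix S assume S: "S \<in> Pow {..<n}"
    have "card S \<le> n" using card_mono[of "{..<n}" S] S by simp
    consider "card S = 0" | "card S = 1" | "card S \<ge> 2" "r = 2" using assms(2) \<open>card S \<le> n\<close> by linarith
    thus "(-1 :: int) ^ (card S + rank (uniform_matroid r n) S) = (-1) ^ card S + (if card S = 1 then 2 else 0)"
      using rank_uniform[OF assms(1), of S] S assms(2) by cases auto
  qed
  also have "\<dots> = 0 + 2 * int (card {S. S \<subseteq> {..<n} \<and> card S = 1})"
  proof -
    have "0 \<in> {..<n}" using assms by auto
    hence "{..<n} \<noteq> {}" by blast
    hence "(\<Sum>S\<in>Pow {..<n}. (-1 :: int) ^ card S) = 0" using alternating_sum_Pow[of "{..<n}"] by simp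
    thus ?thesis by (simp add: sum.distrib sum.If_cases Int_def)
  qed
  also have "card {S. S \<subseteq> {..<n} \<and> card S = 1} = n" using n_subsets[of "{..<n}" 1] by simp
  finally show ?thesis by (simp add: uniform_matroid_def)
qed

text \<open>The oriented matroid of \<open>n\<close> vectors in an open half plane, ordered by angle.\<close>

definition alternating :: "nat \<Rightarrow> nat signed_set set" where
  "alternating n = {X. \<exists>i j k. i < j \<and> j < k \<and> k < n \<and> (X = ({i, k}, {j}) \<or> X = ({j}, {i, k}))}"

lemma alternatingI:
  assumes "i < j" "j < k" "k < n"
    and "i \<in> P \<and> j \<in> N \<and> k \<in> P \<or> i \<in> N \<and> j \<in> P \<and> k \<in> N"
  shows "\<exists>Z \<in> alternating n. fst Z \<subseteq> P \<and> snd Z \<subseteq> N"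
  using assms(4)
proof
  assume "i \<in> P \<and> j \<in> N \<and> k \<in> P"
  thus ?thesis using assms(1-3) by (intro bexI[of _ "({i, k}, {j})"]) (auto simp: alternating_def)
next
  assume "i \<in> N \<and> j \<in> P \<and> k \<in> N"
  thus ?thesis using assms(1-3) by (intro bexI[of _ "({j}, {i, k})"]) (auto simp: alternating_def)
qed

lemma alternating_opp: "X \<in> alternating n \<Longrightarrow> opp X \<in> alternating n"
  unfolding alternating_def opp_def by fastforce

text \<open>A normal form around \<open>e\<close>: when \<open>e\<close> is an end of the triple,
  \<open>a\<close> is the middle and \<open>b\<close> the other end. Negative elements are treated
  by passing to \<open>opp\<close>.\<close>

lemma alternating_positive:
  assumes "X \<in> alternating n" "e \<in> fst X"
  shows "\<exists>a b. a < n \<and> b < n \<and> e < n \<and> (e < a \<and> a < b \<and> X = ({e, b}, {a}) \<or> b < a \<and> a < e \<and> X = ({e, b}, {a}) \<or>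
    a < e \<and> e < b \<and> X = ({e}, {a, b}))"
proof -
  obtain i j k where ijk: "i < j" "j < k" "k < n" "X = ({i, k}, {j}) \<or> X = ({j}, {i, k})"
    using assms(1) by (auto simp: alternating_def)
  then consider "e = i" "X = ({i, k}, {j})" | "e = k" "X = ({i, k}, {j})" | "e = j" "X = ({j}, {i, k})"
    using assms(2) by auto
  thus ?thesis
  proof cases
    case 1
    thus ?thesis using ijk by (intro exI[of _ j] exI[of _ k]) auto
  next
    case 2
    thus ?thesis using ijk by (intro exI[of _ j] exI[of _ i]) auto
  next
    case 3
    thus ?thesis using ijk by (intro exI[of _ i] exI[of _ k]) auto
  qed
qed

text \<open>Of the nine combinations of the positions of \<open>e\<close> in \<open>X\<close> and
  \<open>Y\<close>, six give an alternating triple at once. If the positions coincide,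
  \<open>X \<noteq> opp Y\<close> says that \<open>a\<close>, \<open>b\<close> and \<open>c\<close>,
  \<open>d\<close> are not the same pair, and comparing \<open>a\<close> with \<open>c\<close>, or
  \<open>b\<close> with \<open>d\<close> if these are equal, gives one.\<close>

lemma alternating_elimination:
  assumes X: "X \<in> alternating n" and Y: "Y \<in> alternating n" and ne: "X \<noteq> opp Y"
    and e: "e \<in> fst X \<inter> snd Y"
  shows "\<exists>Z \<in> alternating n. fst Z \<subseteq> (fst X \<union> fst Y) - {e} \<and> snd Z \<subseteq> (snd X \<union> snd Y) - {e}"
proof -
  let ?P = "(fst X \<union> fst Y) - {e}" and ?N = "(snd X \<union> snd Y) - {e}"
  note I = alternatingI[of _ _ _ n ?P ?N]
  obtain a b where ab: "a < n" "b < n" and X_cases: "e < a \<and> a < b \<and> X = ({e, b}, {a}) \<or>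
    b < a \<and> a < e \<and> X = ({e, b}, {a}) \<or> a < e \<and> e < b \<and> X = ({e}, {a, b})"
    using alternating_positive[OF X, of e] e by blast
  obtain c d where cd: "c < n" "d < n" and Y'_cases: "e < c \<and> c < d \<and> opp Y = ({e, d}, {c}) \<or>
    d < c \<and> c < e \<and> opp Y = ({e, d}, {c}) \<or> c < e \<and> e < d \<and> opp Y = ({e}, {c, d})"
    using alternating_positive[OF alternating_opp[OF Y], of e] e by (auto simp: opp_def)
  have Y_cases: "e < c \<and> c < d \<and> Y = ({c}, {e, d}) \<or> d < c \<and> c < e \<and> Y = ({c}, {e, d}) \<or> c < e \<and> e < d \<and> Y = ({c, d}, {e})"
    using Y'_cases by (cases Y) (auto simp: opp_def)
  from X_cases show ?thesis
  proof (elim disjE conjE)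
    assume x: "e < a" "a < b" "X = ({e, b}, {a})"
    from Y_cases show ?thesis
    proof (elim disjE conjE)
      assume y: "e < c" "c < d" "Y = ({c}, {e, d})"
      have "\<not> (a = c \<and> b = d)" using ne x y by (auto simp: opp_def)
      then consider "a < c" | "c < a" | "a = c" "b < d" | "a = c" "d < b" by linarith
      thus ?thesis
      proof cases
        case 1 thus ?thesis using x y ab cd by (intro I[of a c d]) auto
      next
        case 2 thus ?thesis using x y ab cd by (intro I[of c a b]) auto
      next
        case 3 thus ?thesis using x y ab cd by (intro I[of a b d]) auto
      next
        case 4 thus ?thesis using x y ab cd by (intro I[of c d b]) auto
      qed
    next
      assume y: "d < c" "c < e" "Y = ({c}, {e, d})"
      thus ?thesis using x ab cd by (intro I[of d c a]) auto
    next
      assume y: "c < e" "e < d" "Y = ({c, d}, {e})"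
      thus ?thesis using x ab cd by (intro I[of c a b]) auto
    qed
  next
    assume x: "b < a" "a < e" "X = ({e, b}, {a})"
    from Y_cases show ?thesis
    proof (elim disjE conjE)
      assume y: "e < c" "c < d" "Y = ({c}, {e, d})"
      thus ?thesis using x ab cd by (intro I[of b a c]) auto
    next
      assume y: "d < c" "c < e" "Y = ({c}, {e, d})"
      have "\<not> (a = c \<and> b = d)" using ne x y by (auto simp: opp_def)
      then consider "a < c" | "c < a" | "a = c" "b < d" | "a = c" "d < b" by linarith
      thus ?thesis
      proof cases
        case 1 thus ?thesis using x y ab cd by (intro I[of b a c]) auto
      next
        case 2 thus ?thesis using x y ab cd by (intro I[of d c a]) auto
      next
        case 3 thus ?thesis using x y ab cd by (intro I[of b d c]) auto
      next
        case 4 thus ?thesis using x y ab cd by (intro I[of d b a]) auto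
      qed
    next
      assume y: "c < e" "e < d" "Y = ({c, d}, {e})"
      thus ?thesis using x ab cd by (intro I[of b a d]) auto
    qed
  next
    assume x: "a < e" "e < b" "X = ({e}, {a, b})"
    from Y_cases show ?thesis
    proof (elim disjE conjE)
      assume y: "e < c" "c < d" "Y = ({c}, {e, d})"
      thus ?thesis using x ab cd by (intro I[of a c d]) auto
    next
      assume y: "d < c" "c < e" "Y = ({c}, {e, d})"
      thus ?thesis using x ab cd by (intro I[of d c b]) auto
    next
      assume y: "c < e" "e < d" "Y = ({c, d}, {e})"
      have "\<not> (a = c \<and> b = d)" using ne x y by (auto simp: opp_def)
      then consider "a < c" | "c < a" | "a = c" "b < d" | "a = c" "d < b" by linarith
      thus ?thesis
      proof cases
        case 1 thus ?thesis using x y ab cd by (intro I[of a c b]) auto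
      next
        case 2 thus ?thesis using x y ab cd by (intro I[of c a d]) auto
      next
        case 3 thus ?thesis using x y ab cd by (intro I[of c b d]) auto
      next
        case 4 thus ?thesis using x y ab cd by (intro I[of a d b]) auto
      qed
    qed
  qed
qed

lemma alternating_support:
  assumes "X \<in> alternating n"
  shows "\<exists>i j k. i < j \<and> j < k \<and> k < n \<and> supp X = {i, j, k} \<and> (X = ({i, k}, {j}) \<or> X = ({j}, {i, k}))"
proof -
  obtain i j k where "i < j" "j < k" "k < n" "X = ({i, k}, {j}) \<or> X = ({j}, {i, k})"
    using assms by (auto simp: alternating_def)
  moreover from this have "supp X = {i, j, k}" by (auto simp: supp_def)
  ultimately show ?thesis by blast
qed

lemma triple_subset:
  fixes i j k :: nat
  assumes "i < j" "j < k" "i' < j'" "j' < k'" "{i, j, k} \<subseteq> {i', j', k'}"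
  shows "i = i' \<and> j = j' \<and> k = k'"
  using assms by auto

lemma orientable_uniform_2:
  assumes "n \<ge> 2"
  shows "orientable (uniform_matroid 2 n)"
  unfolding orientable_def
proof (intro exI[of _ "alternating n"] conjI)
  show "oriented_matroid (ground (uniform_matroid 2 n)) (alternating n)"
  proof
    show "finite (ground (uniform_matroid 2 n))" by (simp add: uniform_matroid_def)
    show "({}, {}) \<notin> alternating n" by (auto simp: alternating_def)
    show "supp X \<subseteq> ground (uniform_matroid 2 n) \<and> fst X \<inter> snd X = {}" if "X \<in> alternating n" for X
      using that by (auto simp: alternating_def supp_def uniform_matroid_def)
    show "X = Y \<or> X = opp Y" if X: "X \<in> alternating n" and Y: "Y \<in> alternating n" and sub: "supp X \<subseteq> supp Y" for X Y
    proof -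
      obtain i j k where x: "i < j" "j < k" "supp X = {i, j, k}" "X = ({i, k}, {j}) \<or> X = ({j}, {i, k})"
        using alternating_support[OF X] by blast
      obtain i' j' k' where y: "i' < j'" "j' < k'" "supp Y = {i', j', k'}" "Y = ({i', k'}, {j'}) \<or> Y = ({j'}, {i', k'})"
        using alternating_support[OF Y] by blast
      have "{i, j, k} \<subseteq> {i', j', k'}" using sub unfolding x(3) y(3) .
      hence "i = i' \<and> j = j' \<and> k = k'" by (rule triple_subset[OF x(1,2) y(1,2)])
      thus ?thesis using x(4) y(4) by (auto simp: opp_def)
    qed
  qed (rule alternating_opp alternating_elimination; assumption)+
  show "circuits (uniform_matroid 2 n) = supp ` alternating n"
  proof (intro equalityI subsetI)
    fix C assume "C \<in> circuits (uniform_matroid 2 n)"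
    hence C: "C \<subseteq> {..<n}" "card C = 3" using circuits_uniform[OF assms] by auto
    hence fin: "finite C" using finite_subset by blast
    define xs where "xs = sorted_list_of_set C"
    have xs: "set xs = C" "sorted_wrt (<) xs" "length xs = 3" using fin C by (simp_all add: xs_def)
    then obtain i j k where "xs = [i, j, k]" by (auto simp: numeral_3_eq_3 length_Suc_conv)
    hence "C = {i, j, k}" "i < j" "j < k" using xs by auto
    hence "C = supp ({i, k}, {j})" "({i, k}, {j}) \<in> alternating n" using C by (auto simp: supp_def alternating_def)
    thus "C \<in> supp ` alternating n" by blast
  next
    fix C assume "C \<in> supp ` alternating n"
    then obtain i j k where "i < j" "j < k" "k < n" "C = {i, j, k}" using alternating_support by blast
    thus "C \<in> circuits (uniform_matroid 2 n)" by (auto simp: circuits_uniform[OF assms])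
  qed
qed

lemma orientable_uniform_1_1: "orientable (uniform_matroid 1 1)"
  unfolding orientable_def
proof (intro exI[of _ "{}"] conjI)
  have "card C \<noteq> Suc 1" if "C \<subseteq> {..<1}" for C :: "nat set" using card_mono[of "{..<1}" C] that by simp
  hence "circuits (uniform_matroid 1 1) = {}" unfolding circuits_uniform[OF order_refl] by blast
  thus "circuits (uniform_matroid 1 1) = supp ` {}" by simp
qed (unfold_locales, auto simp: uniform_matroid_def)

lemma magnitude_uniform:
  assumes "r \<le> n" "r = 2 \<or> r = 1 \<and> n = 1" "-1 < q" "q < 1"
  shows "magnitude (uniform_matroid r n) q = 2 * real n * (1 - q) / ((1 + q) * (1 - q ^ n))"
proof (rule magnitude_orientable(2))
  show "orientable (uniform_matroid r n)"
    using assms orientable_uniform_2 orientable_uniform_1_1 by auto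
qed (use assms matroid_uniform simple_uniform uniform_rank_sum in \<open>auto simp: uniform_matroid_def\<close>)

theorem theorem4p6:
  "(\<forall>(M :: 'a matroid_data) (n :: nat) (q :: real).
      matroid M \<and> simple_matroid M \<and> orientable M \<and> card (ground M) = n \<and> n > 0 \<and>
      - 1 < q \<and> q < 1 \<longrightarrow>
        magnitude M q \<ge> 2 * real n * (1 - q) / ((1 + q) * (1 - q ^ n)) \<and>
        2 * real n * (1 - q) / ((1 + q) * (1 - q ^ n)) > 1)
   \<and> (let U = uniform_matroid 1 1 in
        matroid U \<and> simple_matroid U \<and> orientable U \<and> card (ground U) = 1 \<and>
        (\<forall>q :: real. - 1 < q \<and> q < 1 \<longrightarrow>
          magnitude U q = 2 * real 1 * (1 - q) / ((1 + q) * (1 - q ^ 1))))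
   \<and> (\<forall>n :: nat. n \<ge> 2 \<longrightarrow>
       (let U = uniform_matroid 2 n in
          matroid U \<and> simple_matroid U \<and> orientable U \<and> card (ground U) = n \<and>
          (\<forall>q :: real. - 1 < q \<and> q < 1 \<longrightarrow>
            magnitude U q = 2 * real n * (1 - q) / ((1 + q) * (1 - q ^ n)))))"
proof (intro conjI allI impI)
  fix M :: "'a matroid_data" and n q
  assume asm: "matroid M \<and> simple_matroid M \<and> orientable M \<and> card (ground M) = n \<and> n > 0 \<and> - 1 < q \<and> q < (1 :: real)"
  thus "magnitude M q \<ge> 2 * real n * (1 - q) / ((1 + q) * (1 - q ^ n))" by (intro magnitude_orientable(1)) auto
  have q: "-1 < q" "q < 1" and n: "n > 0" using asm by auto
  show "2 * real n * (1 - q) / ((1 + q) * (1 - q ^ n)) > 1"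
    unfolding cycle_bound(3)[OF q n] using cycle_bound(1,2)[OF q n] by simp
next
  have "card (ground (uniform_matroid 1 1)) = 1" by (simp add: uniform_matroid_def)
  thus "let U = uniform_matroid 1 1 in
        matroid U \<and> simple_matroid U \<and> orientable U \<and> card (ground U) = 1 \<and>
        (\<forall>q :: real. - 1 < q \<and> q < 1 \<longrightarrow>
          magnitude U q = 2 * real 1 * (1 - q) / ((1 + q) * (1 - q ^ 1)))"
    unfolding Let_def using matroid_uniform[of 1 1] simple_uniform[of 1 1] orientable_uniform_1_1
      magnitude_uniform[of 1 1] by blast
next
  fix n :: nat assume n: "n \<ge> 2"
  have "card (ground (uniform_matroid 2 n)) = n" by (simp add: uniform_matroid_def)
  thus "let U = uniform_matroid 2 n in
          matroid U \<and> simple_matroid U \<and> orientable U \<and> card (ground U) = n \<and>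
          (\<forall>q :: real. - 1 < q \<and> q < 1 \<longrightarrow>
            magnitude U q = 2 * real n * (1 - q) / ((1 + q) * (1 - q ^ n)))"
    unfolding Let_def using n matroid_uniform[of 2 n] simple_uniform[of 2 n] orientable_uniform_2[of n]
      magnitude_uniform[of 2 n] by blast
qed

end
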